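(* Let $p$ be a prime, let $G$ be a group with subgroups $A$ and $B$, and let $\varphi : A\to B$ be an isomorphism. Let $G^{*}=(G,t;\ t^{-1}At=B,\ \varphi)$ be the HNN-extension of $G$. Then: (1) if the group $G^{*}$ is residually a finite $p$-group, then the family $\mathcal F_{G}^{p}(A,B,\varphi)$ is a filtration; (2) if the family $\mathcal F_{G}^{p}(A,B,\varphi)$ is an $(A,B)$-filtration, then the group $G^{*}$ is residually a finite $p$-group.
   Context: Maps are written on the right. The HNN-extension $(G,t;\ t^{-1}At=B,\ \varphi)$ is the group generated by $G$ and a new letter $t$ subject to the relations of $G$ together with $t^{-1}at=a\varphi$ for all $a\in A$. A group is residually a finite $p$-group if for each of its non-identity elements $g$ there is a homomorphism onto a finite $p$-group whose value at $g$ is not $1$. A subgroup $H$ of $G$ is called $(A,B,\varphi)$-compatible if $(A\cap H)\varphi=B\cap H$. A subgroup $H$ of $G$ is called $(A,B,\varphi,p)$-compatible if there exists a sequence $H=G_{0}\leqslant G_{1}\leqslant\cdots\leqslant G_{n}=G$ of subgroups of $G$ such that (i) for every $i=0,1,\dots,n$ the subgroup $G_i$ is $(A,B,\varphi)$-compatible and normal in $G$, and (ii) for every $i=0,1,\dots,n-1$ the quotient $G_{i+1}/G_i$ has order $p$ and $(a\varphi)G_i=aG_i$ for every $a\in A\cap G_{i+1}$. $\mathcal F_{G}^{p}(A,B,\varphi)$ denotes the family of all $(A,B,\varphi,p)$-compatible subgroups of $G$. A family $(N_\lambda)_{\lambda\in\Lambda}$ of normal subgroups of $G$ is a filtration if $\bigcap_{\lambda}N_\lambda=1$.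 For a subgroup $H\leqslant G$, a filtration is an $H$-filtration if moreover $\bigcap_{\lambda}HN_\lambda=H$. An $(H,K)$-filtration is a filtration that is simultaneously an $H$-filtration and a $K$-filtration. *)

theory Defs
  imports "HOL-Computational_Algebra.Primes" "HOL-Algebra.Coset"
begin

section \<open>Groups given by generators and relators\<close>

text \<open>A letter is a generator with a sign: \<open>(x, True)\<close> is \<open>x\<close> and \<open>(x, False)\<close> is its formal inverse.\<close>

type_synonym 'x word = "('x \<times> bool) list"

definition words :: "'x set \<Rightarrow> 'x word set" where
  "words X = lists (X \<times> UNIV)"

definition inverse_word :: "'x word \<Rightarrow> 'x word" where
  "inverse_word w = rev (map (\<lambda>(x, e). (x, \<not> e)) w)"

inductive word_eq :: "'x set \<Rightarrow> 'x word set \<Rightarrow> 'x word \<Rightarrow> 'x word \<Rightarrow> bool"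
  for X :: "'x set" and R :: "'x word set" where
  refl: "w \<in> words X \<Longrightarrow> word_eq X R w w"
| sym: "word_eq X R u v \<Longrightarrow> word_eq X R v u"
| trans: "word_eq X R u v \<Longrightarrow> word_eq X R v w \<Longrightarrow> word_eq X R u w"
| cancel: "u \<in> words X \<Longrightarrow> v \<in> words X \<Longrightarrow> x \<in> X \<Longrightarrow>
    word_eq X R (u @ [(x, e), (x, \<not> e)] @ v) (u @ v)"
| relator: "u \<in> words X \<Longrightarrow> v \<in> words X \<Longrightarrow> r \<in> R \<Longrightarrow> r \<in> words X \<Longrightarrow>
    word_eq X R (u @ r @ v) (u @ v)"

definition word_class :: "'x set \<Rightarrow> 'x word set \<Rightarrow> 'x word \<Rightarrow> 'x word set" where
  "word_class X R w = {v. word_eq X R w v}"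

definition presented_group :: "'x set \<Rightarrow> 'x word set \<Rightarrow> 'x word set monoid" where
  "presented_group X R =
    \<lparr>carrier = word_class X R ` words X,
     mult = (\<lambda>P Q. {w. \<exists>u\<in>P. \<exists>v\<in>Q. word_eq X R (u @ v) w}),
     one = word_class X R []\<rparr>"

lemma words_append [simp]: "u @ v \<in> words X \<longleftrightarrow> u \<in> words X \<and> v \<in> words X"
  by (auto simp: words_def)

lemma words_Nil [simp]: "[] \<in> words X"
  by (simp add: words_def)

lemma words_Cons [simp]: "a # v \<in> words X \<longleftrightarrow> fst a \<in> X \<and> v \<in> words X"
  by (cases a) (auto simp: words_def)

lemma words_inverse [simp]: "inverse_word w \<in> words X \<longleftrightarrow> w \<in> words X"
  by (induction w) (auto simp: inverse_word_def)

lemma word_eq_words: "word_eq X R u v \<Longrightarrow> u \<in> words X \<and> v \<in> words X"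
  by (induction rule: word_eq.induct) auto

lemma word_eq_context:
  assumes "word_eq X R u v" "a \<in> words X" "b \<in> words X"
  shows "word_eq X R (a @ u @ b) (a @ v @ b)"
  using assms
proof (induction rule: word_eq.induct)
  case (cancel u v x e)
  then show ?case using word_eq.cancel[of "a @ u" X "v @ b" x R e] by simp
next
  case (relator u v r)
  then show ?case using word_eq.relator[of "a @ u" X "v @ b" r R] by simp
qed (auto intro: word_eq.intros)

lemma word_eq_append:
  assumes "word_eq X R u u'" "word_eq X R v v'"
  shows "word_eq X R (u @ v) (u' @ v')"
  using word_eq_context[OF assms(1), of "[]" v] word_eq_context[OF assms(2), of u' "[]"]
    word_eq_words[OF assms(1)] word_eq_words[OF assms(2)]
  by (auto intro: word_eq.trans)

lemma word_eq_inverse: "w \<in> words X \<Longrightarrow> word_eq X R (inverse_word w @ w) []"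
proof (induction w)
  case Nil
  then show ?case by (simp add: inverse_word_def word_eq.refl)
next
  case (Cons a w)
  obtain x e where a: "a = (x, e)" by force
  have "word_eq X R (inverse_word w @ [(x, \<not> e), (x, \<not> \<not> e)] @ w) (inverse_word w @ w)"
    using Cons.prems a by (intro word_eq.cancel) auto
  then have "word_eq X R (inverse_word (a # w) @ (a # w)) (inverse_word w @ w)"
    by (simp add: inverse_word_def a)
  then show ?case using Cons by (auto intro: word_eq.trans)
qed

lemma word_class_eq_iff:
  "u \<in> words X \<Longrightarrow> word_class X R u = word_class X R v \<longleftrightarrow> word_eq X R u v"
  unfolding word_class_def by (metis Collect_cong mem_Collect_eq word_eq.refl word_eq.sym word_eq.trans)

lemma word_class_mult:
  assumes "u \<in> words X" "v \<in> words X"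
  shows "word_class X R u \<otimes>\<^bsub>presented_group X R\<^esub> word_class X R v = word_class X R (u @ v)"
proof -
  have "word_eq X R (u @ v) w"
    if "word_eq X R u u'" "word_eq X R v v'" "word_eq X R (u' @ v') w" for u' v' w
    using word_eq_append[OF that(1,2)] that(3) by (rule word_eq.trans)
  then show ?thesis
    using assms by (auto simp: presented_group_def word_class_def intro: word_eq.refl)
qed

lemma group_presented_group: "group (presented_group X R)"
proof (rule groupI)
  show "\<one>\<^bsub>presented_group X R\<^esub> \<in> carrier (presented_group X R)"
    by (auto simp: presented_group_def)
next
  fix P assume "P \<in> carrier (presented_group X R)"
  then obtain u where u: "P = word_class X R u" "u \<in> words X"
    by (auto simp: presented_group_def)
  have one: "\<one>\<^bsub>presented_group X R\<^esub> = word_class X R []"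
    by (simp add: presented_group_def)
  show "\<one>\<^bsub>presented_group X R\<^esub> \<otimes>\<^bsub>presented_group X R\<^esub> P = P"
    by (simp add: one u word_class_mult)
  have "word_class X R (inverse_word u) \<in> carrier (presented_group X R)"
    using u by (auto simp: presented_group_def)
  moreover have "word_class X R (inverse_word u) \<otimes>\<^bsub>presented_group X R\<^esub> P
      = \<one>\<^bsub>presented_group X R\<^esub>"
    using u by (simp add: one word_class_mult word_class_eq_iff word_eq_inverse)
  ultimately show "\<exists>Q\<in>carrier (presented_group X R).
      Q \<otimes>\<^bsub>presented_group X R\<^esub> P = \<one>\<^bsub>presented_group X R\<^esub>" by blast
next
  fix P Q assume "P \<in> carrier (presented_group X R)" "Q \<in> carrier (presented_group X R)"
  then obtain u v where "P = word_class X R u" "u \<in> words X" "Q = word_class X R v" "v \<in> words X"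
    by (auto simp: presented_group_def)
  then show "P \<otimes>\<^bsub>presented_group X R\<^esub> Q \<in> carrier (presented_group X R)"
    by (simp add: word_class_mult) (simp add: presented_group_def)
next
  fix P Q S
  assume "P \<in> carrier (presented_group X R)" "Q \<in> carrier (presented_group X R)"
    "S \<in> carrier (presented_group X R)"
  then obtain u v w where "P = word_class X R u" "u \<in> words X" "Q = word_class X R v" "v \<in> words X"
      "S = word_class X R w" "w \<in> words X"
    by (auto simp: presented_group_def)
  then show "P \<otimes>\<^bsub>presented_group X R\<^esub> Q \<otimes>\<^bsub>presented_group X R\<^esub> S
      = P \<otimes>\<^bsub>presented_group X R\<^esub> (Q \<otimes>\<^bsub>presented_group X R\<^esub> S)"
    by (simp add: word_class_mult)
qed


section \<open>HNN-extensions\<close>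

text \<open>The generators are \<open>Some x\<close> for \<open>x\<close> in \<open>G\<close>, and the stable letter \<open>t = None\<close>.
  The relations of \<open>G\<close> are those of its multiplication table; the others are
  \<open>t\<inverse> a t = \<phi> a\<close> for \<open>a\<close> in \<open>A\<close>. The subgroup \<open>B\<close> is the image \<open>\<phi> ` A\<close>.\<close>

definition hnn_generators :: "('a, 'm) monoid_scheme \<Rightarrow> 'a option set" where
  "hnn_generators G = insert None (Some ` carrier G)"

definition hnn_relators ::
    "('a, 'm) monoid_scheme \<Rightarrow> 'a set \<Rightarrow> ('a \<Rightarrow> 'a) \<Rightarrow> 'a option word set" where
  "hnn_relators G A \<phi> =
     {[(Some x, True), (Some y, True), (Some (x \<otimes>\<^bsub>G\<^esub> y), False)] | x y.
        x \<in> carrier G \<and> y \<in> carrier G}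
   \<union> {[(None, False), (Some a, True), (None, True), (Some (\<phi> a), False)] | a. a \<in> A}"

definition HNN ::
    "('a, 'm) monoid_scheme \<Rightarrow> 'a set \<Rightarrow> ('a \<Rightarrow> 'a) \<Rightarrow> 'a option word set monoid" where
  "HNN G A \<phi> = presented_group (hnn_generators G) (hnn_relators G A \<phi>)"

lemma group_HNN: "group (HNN G A \<phi>)"
  unfolding HNN_def by (rule group_presented_group)


section \<open>Residually finite \<open>p\<close>-groups\<close>

definition finite_p_group :: "nat \<Rightarrow> ('a, 'm) monoid_scheme \<Rightarrow> bool" where
  "finite_p_group p P \<longleftrightarrow> group P \<and> finite (carrier P) \<and> (\<exists>k. order P = p ^ k)"

text \<open>Every finite group has an isomorphic copy with elements of type \<^typ>\<open>nat\<close>, so it is no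
  restriction to take the finite quotients there; see \<open>residually_finite_p_groupI\<close>.\<close>

definition residually_finite_p_group :: "nat \<Rightarrow> ('a, 'm) monoid_scheme \<Rightarrow> bool" where
  "residually_finite_p_group p G \<longleftrightarrow>
     (\<forall>g\<in>carrier G. g \<noteq> \<one>\<^bsub>G\<^esub> \<longrightarrow>
        (\<exists>(P :: nat monoid) h. finite_p_group p P \<and> h \<in> epi G P \<and> h g \<noteq> \<one>\<^bsub>P\<^esub>))"

lemma finite_p_group_nat_copy:
  fixes P :: "('b, 'm) monoid_scheme"
  assumes "finite_p_group p P"
  obtains Q :: "nat monoid" and f where "finite_p_group p Q" "f \<in> iso P Q"
proof -
  from assms interpret group P by (simp add: finite_p_group_def)
  from assms obtain f :: "'b \<Rightarrow> nat" where f: "inj_on f (carrier P)"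
    by (auto simp: finite_p_group_def dest: finite_imp_inj_to_nat_seg)
  define g where "g = inv_into (carrier P) f"
  define Q where "Q = \<lparr>carrier = f ` carrier P, mult = (\<lambda>x y. f (g x \<otimes>\<^bsub>P\<^esub> g y)), one = f \<one>\<^bsub>P\<^esub>\<rparr>"
  have g: "g (f x) = x" if "x \<in> carrier P" for x
    using f that by (simp add: g_def)
  have iso: "f \<in> iso P Q"
    using f by (auto simp: iso_def hom_def bij_betw_def Q_def g)
  have "group (Q\<lparr>one := f \<one>\<^bsub>P\<^esub>\<rparr>)"
    by (rule iso_imp_img_group[OF iso])
  then have "group Q" by (simp add: Q_def)
  moreover have "order Q = order P"
    using f by (simp add: order_def Q_def card_image)
  moreover have "finite (carrier Q)"
    using assms by (simp add: finite_p_group_def Q_def)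
  ultimately have "finite_p_group p Q"
    using assms by (simp add: finite_p_group_def)
  with iso that show thesis by blast
qed

lemma residually_finite_p_groupI:
  fixes G :: "('a, 'm) monoid_scheme"
  assumes "\<And>g. g \<in> carrier G \<Longrightarrow> g \<noteq> \<one>\<^bsub>G\<^esub> \<Longrightarrow>
    \<exists>(P :: 'b monoid) h. finite_p_group p P \<and> h \<in> epi G P \<and> h g \<noteq> \<one>\<^bsub>P\<^esub>"
  shows "residually_finite_p_group p G"
  unfolding residually_finite_p_group_def
proof (intro ballI impI)
  fix g assume g: "g \<in> carrier G" "g \<noteq> \<one>\<^bsub>G\<^esub>"
  from assms[OF g] obtain P :: "'b monoid" and h
    where P: "finite_p_group p P" and h: "h \<in> epi G P" "h g \<noteq> \<one>\<^bsub>P\<^esub>" by blast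
  obtain Q :: "nat monoid" and f where Q: "finite_p_group p Q" and f: "f \<in> iso P Q"
    using finite_p_group_nat_copy[OF P] by blast
  have "group P" "group Q" using P Q by (auto simp: finite_p_group_def)
  then have "f \<one>\<^bsub>P\<^esub> = \<one>\<^bsub>Q\<^esub>"
    using f by (auto simp: iso_def intro: hom_one)
  moreover have "inj_on f (carrier P)" "\<one>\<^bsub>P\<^esub> \<in> carrier P" "h g \<in> carrier P"
    using f h g \<open>group P\<close> by (auto simp: iso_def bij_betw_def epi_def hom_def group.is_monoid)
  ultimately have "(f \<circ> h) g \<noteq> \<one>\<^bsub>Q\<^esub>"
    using h(2) by (metis comp_apply inj_onD)
  moreover have "f \<circ> h \<in> epi G Q"
  proof -
    have "f ` (h ` carrier G) = carrier Q"
      using f h(1) by (simp add: epi_def iso_def bij_betw_def)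
    then have "(f \<circ> h) ` carrier G = carrier Q"
      by (simp only: image_comp)
    moreover have "f \<circ> h \<in> hom G Q"
      using f h(1) by (auto simp: epi_def iso_def intro: hom_compose)
    ultimately show ?thesis by (simp add: epi_def)
  qed
  ultimately show "\<exists>(P :: nat monoid) h. finite_p_group p P \<and> h \<in> epi G P \<and> h g \<noteq> \<one>\<^bsub>P\<^esub>"
    using Q by blast
qed


section \<open>Compatible subgroups and filtrations\<close>

definition compatible :: "'a set \<Rightarrow> 'a set \<Rightarrow> ('a \<Rightarrow> 'a) \<Rightarrow> 'a set \<Rightarrow> bool" where
  "compatible A B \<phi> H \<longleftrightarrow> \<phi> ` (A \<inter> H) = B \<inter> H"

definition p_compatible ::
    "('a, 'm) monoid_scheme \<Rightarrow> 'a set \<Rightarrow> 'a set \<Rightarrow> ('a \<Rightarrow> 'a) \<Rightarrow> nat \<Rightarrow> 'a set \<Rightarrow> bool" where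
  "p_compatible G A B \<phi> p H \<longleftrightarrow>
     (\<exists>(n :: nat) (N :: nat \<Rightarrow> 'a set).
        N 0 = H \<and> N n = carrier G \<and> (\<forall>i<n. N i \<subseteq> N (Suc i)) \<and>
        (\<forall>i\<le>n. compatible A B \<phi> (N i) \<and> N i \<lhd> G) \<and>
        (\<forall>i<n. order (G\<lparr>carrier := N (Suc i)\<rparr> Mod N i) = p \<and>
               (\<forall>a\<in>A \<inter> N (Suc i). \<phi> a <#\<^bsub>G\<^esub> N i = a <#\<^bsub>G\<^esub> N i)))"

definition p_compatible_family ::
    "('a, 'm) monoid_scheme \<Rightarrow> 'a set \<Rightarrow> 'a set \<Rightarrow> ('a \<Rightarrow> 'a) \<Rightarrow> nat \<Rightarrow> 'a set set" where
  "p_compatible_family G A B \<phi> p = {H. subgroup H G \<and> p_compatible G A B \<phi> p H}"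

text \<open>Intersections are taken inside \<open>G\<close>, so that the empty family intersects to \<open>G\<close>.\<close>

definition filtration :: "('a, 'm) monoid_scheme \<Rightarrow> 'a set set \<Rightarrow> bool" where
  "filtration G \<F> \<longleftrightarrow> (\<forall>N\<in>\<F>. N \<lhd> G) \<and> carrier G \<inter> \<Inter>\<F> = {\<one>\<^bsub>G\<^esub>}"

definition subgroup_filtration :: "('a, 'm) monoid_scheme \<Rightarrow> 'a set \<Rightarrow> 'a set set \<Rightarrow> bool" where
  "subgroup_filtration G H \<F> \<longleftrightarrow>
     filtration G \<F> \<and> carrier G \<inter> (\<Inter>N\<in>\<F>. H <#>\<^bsub>G\<^esub> N) = H"

definition pair_filtration ::
    "('a, 'm) monoid_scheme \<Rightarrow> 'a set \<Rightarrow> 'a set \<Rightarrow> 'a set set \<Rightarrow> bool" where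
  "pair_filtration G H K \<F> \<longleftrightarrow> subgroup_filtration G H \<F> \<and> subgroup_filtration G K \<F>"

end

theory Submission
  imports Defs "HOL-Algebra.Sylow" "HOL-Algebra.Group_Action" "HOL-Algebra.Zassenhaus"
    "HOL-Number_Theory.Residues" "HOL-Combinatorics.Permutations" "HOL-Library.Equipollence"
begin

text \<open>
  (1) A central series of a finite \<open>p\<close>-quotient of \<open>G\<^sup>*\<close> pulls back along the embedding
  \<open>G \<rightarrow> G\<^sup>*\<close> to a chain as required for \<open>p\<close>-compatibility.

  (2) A non-trivial element of \<open>G\<^sup>*\<close> is the value of a reduced word
  \<open>g\<^sub>0 t\<^bsup>\<epsilon>\<^esup> g\<^sub>1 \<dots>\<close>. Since \<open>p\<close>-compatible subgroups are closed under intersection, some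
  \<open>p\<close>-compatible \<open>H\<close> keeps the word reduced modulo \<open>H\<close>. The chain above \<open>H\<close> allows \<open>\<phi>\<close> to be
  realised as conjugation by a permutation \<open>s\<close> of \<open>G / H\<close> that, with the translations by \<open>G\<close>,
  respects the chain. Now \<open>G\<^sup>*\<close> acts on \<open>G / H \<times> (\<int>/q)\<^sup>k\<close> with \<open>q\<close> a power of \<open>p\<close>: \<open>t\<inverse>\<close> acts
  through \<open>s\<close> on the first factor and by a unipotent shear on the second, the shear depending only on
  the \<open>A\<close>-orbit of the first coordinate. This action factors through an iterated wreath product of
  finite \<open>p\<close>-groups. The given word moves \<open>H\<close> along a path through \<open>A\<close>-orbits, and if the shears
  are adapted to this path, its last vector coordinate becomes the product of the signed lengths of
  the runs inside one orbit. This product is not zero modulo \<open>q\<close> for large \<open>q\<close>.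
\<close>

section \<open>Permutation groups and presentations\<close>

text \<open>In (1) the embedding matters because a non-trivial \<open>g\<close> must stay
  non-trivial in the HNN-extension before a quotient can separate it. In (2) the action on
  \<open>G / H\<close> alone generates one fixed finite group, in which already a power of
  \<open>t\<close> dies, so the kernel of that action has to be detected too. The vector coordinate
  does this, in the role that unipotent matrices play for free groups. Moving a point by
  \<open>a\<close> in \<open>A\<close> must not change its shear, as
  \<open>t\<inverse> a t = \<phi> a\<close> has to hold; this is why the tests are
  \<open>A\<close>-invariant. Reducedness modulo \<open>H\<close> says that a run inside one orbit
  never changes sign, so nothing cancels. The resulting integer \<open>D\<close> depends on the word
  only, and the exponent in \<open>q\<close> is chosen last. That the image is a
  \<open>p\<close>-group is read off from exponents: raising to the power \<open>p ^ e\<close>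
  improves agreement with the identity by one level of the tower, and Cauchy's theorem turns a
  \<open>p\<close>-power exponent into a \<open>p\<close>-power order. Permutations are composed as
  functions, so the last syllable acts first and \<open>t\<inverse>\<close> is the forward
  letter.\<close>

definition permutation_group :: "'s set \<Rightarrow> ('s \<Rightarrow> 's) monoid" where
  "permutation_group S = \<lparr>carrier = {f. f permutes S}, mult = (\<circ>), one = id\<rparr>"

lemma permutation_group_simps [simp]:
  "carrier (permutation_group S) = {f. f permutes S}"
  "f \<otimes>\<^bsub>permutation_group S\<^esub> g = f \<circ> g"
  "\<one>\<^bsub>permutation_group S\<^esub> = id"
  by (simp_all add: permutation_group_def)

lemma group_permutation_group: "group (permutation_group S)"
proof (rule groupI)
  fix f assume "f \<in> carrier (permutation_group S)"
  then show "\<exists>g\<in>carrier (permutation_group S). g \<otimes>\<^bsub>permutation_group S\<^esub> f = \<one>\<^bsub>permutation_group S\<^esub>"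
    by (intro bexI[of _ "Hilbert_Choice.inv f"])
      (auto simp: permutes_inv_o permutes_inv)
qed (auto simp: permutes_compose permutes_id o_assoc)

lemma inv_permutation_group:
  assumes "f permutes S"
  shows "inv\<^bsub>permutation_group S\<^esub> f = Hilbert_Choice.inv f"
  using assms
  by (intro group.inv_equality[OF group_permutation_group]) (auto simp: permutes_inv_o permutes_inv)

lemma pow_permutation_group: "f [^]\<^bsub>permutation_group S\<^esub> (n :: nat) = f ^^ n"
  by (induction n) (simp_all add: funpow_swap1 nat_pow_def comp_def fun_eq_iff)

primrec word_value :: "('b, 'n) monoid_scheme \<Rightarrow> ('x \<Rightarrow> 'b) \<Rightarrow> 'x word \<Rightarrow> 'b" where
  "word_value E f [] = \<one>\<^bsub>E\<^esub>"
| "word_value E f (a # w) =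
     (if snd a then f (fst a) else inv\<^bsub>E\<^esub> f (fst a)) \<otimes>\<^bsub>E\<^esub> word_value E f w"

context group
begin

lemma word_value_closed:
  "f \<in> X \<rightarrow> carrier G \<Longrightarrow> w \<in> words X \<Longrightarrow> word_value G f w \<in> carrier G"
  by (induction w) (auto simp: Pi_iff)

lemma word_value_append:
  "f \<in> X \<rightarrow> carrier G \<Longrightarrow> u \<in> words X \<Longrightarrow> v \<in> words X \<Longrightarrow>
    word_value G f (u @ v) = word_value G f u \<otimes> word_value G f v"
  by (induction u) (auto simp: word_value_closed m_assoc Pi_iff)

lemma word_value_eq:
  assumes "word_eq X R u v" "f \<in> X \<rightarrow> carrier G"
    and "\<And>r. r \<in> R \<Longrightarrow> r \<in> words X \<Longrightarrow> word_value G f r = \<one>"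
  shows "word_value G f u = word_value G f v"
  using assms(1)
proof (induction rule: word_eq.induct)
  case (cancel u v x e)
  then have "f x \<in> carrier G" using assms(2) by auto
  then have "word_value G f ([(x, e), (x, \<not> e)] @ v) = word_value G f v"
    using word_value_closed[OF assms(2)] cancel by (simp add: m_assoc[symmetric])
  then show ?case
    using cancel by (simp add: word_value_append[OF assms(2)] del: append.simps)
next
  case (relator u v r)
  then show ?case
    by (simp add: word_value_append[OF assms(2)] word_value_closed[OF assms(2)] assms(3))
qed auto

text \<open>Von Dyck's theorem: since the words of one class have one value, a class may be
  evaluated at an arbitrarily chosen member.\<close>

lemma presented_group_hom:
  assumes f: "f \<in> X \<rightarrow> carrier G"
    and R: "\<And>r. r \<in> R \<Longrightarrow> r \<in> words X \<Longrightarrow> word_value G f r = \<one>"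
  obtains F where "F \<in> hom (presented_group X R) G"
    "\<And>w. w \<in> words X \<Longrightarrow> F (word_class X R w) = word_value G f w"
proof
  define F where "F P = word_value G f (SOME w. w \<in> P)" for P
  show F: "F (word_class X R w) = word_value G f w" if "w \<in> words X" for w
  proof -
    have "w \<in> word_class X R w"
      using that by (simp add: word_class_def word_eq.refl)
    then have "(SOME v. v \<in> word_class X R w) \<in> word_class X R w"
      by (rule someI)
    then show ?thesis
      unfolding F_def using word_value_eq[OF _ f R] by (auto simp: word_class_def)
  qed
  show "F \<in> hom (presented_group X R) G"
  proof (rule homI)
    fix P assume "P \<in> carrier (presented_group X R)"
    then show "F P \<in> carrier G"
      using F word_value_closed[OF f] by (auto simp: presented_group_def)
  next
    fix P Q assume "P \<in> carrier (presented_group X R)" "Q \<in> carrier (presented_group X R)"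
    then obtain u v where "P = word_class X R u" "u \<in> words X" "Q = word_class X R v" "v \<in> words X"
      by (auto simp: presented_group_def)
    then show "F (P \<otimes>\<^bsub>presented_group X R\<^esub> Q) = F P \<otimes> F Q"
      by (simp add: word_class_mult F word_value_append[OF f])
  qed
qed

end

section \<open>HNN-extensions: universal property and defining relations\<close>

locale hnn_data = group G for G (structure) +
  fixes A B :: "'a set" and \<phi> :: "'a \<Rightarrow> 'a"
  assumes A: "subgroup A G" and B: "subgroup B G"
    and iso: "\<phi> \<in> iso (G\<lparr>carrier := A\<rparr>) (G\<lparr>carrier := B\<rparr>)"
begin

lemma A_closed [intro, simp]: "a \<in> A \<Longrightarrow> a \<in> carrier G"
  using A by (rule subgroup.mem_carrier)

lemma B_closed [intro, simp]: "b \<in> B \<Longrightarrow> b \<in> carrier G"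
  using B by (rule subgroup.mem_carrier)

lemma phi_image: "\<phi> ` A = B"
  using iso by (simp add: iso_def bij_betw_def)

lemma phi_mem [simp]: "a \<in> A \<Longrightarrow> \<phi> a \<in> B"
  using phi_image by auto

lemma phi_inj: "inj_on \<phi> A"
  using iso by (simp add: iso_def bij_betw_def)

lemma phi_mult: "a \<in> A \<Longrightarrow> b \<in> A \<Longrightarrow> \<phi> (a \<otimes> b) = \<phi> a \<otimes> \<phi> b"
  using iso by (auto simp: iso_def hom_def)

lemma hnn_generators_mem [simp]:
  "None \<in> hnn_generators G" "Some g \<in> hnn_generators G \<longleftrightarrow> g \<in> carrier G"
  by (auto simp: hnn_generators_def)

abbreviation "\<Gamma> \<equiv> HNN G A \<phi>"

definition base :: "'a \<Rightarrow> 'a option word set" where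
  "base g = word_class (hnn_generators G) (hnn_relators G A \<phi>) [(Some g, True)]"

definition stable :: "'a option word set" where
  "stable = word_class (hnn_generators G) (hnn_relators G A \<phi>) [(None, True)]"

sublocale \<Gamma>: group \<Gamma> by (rule group_HNN)

lemma base_closed [simp, intro]: "g \<in> carrier G \<Longrightarrow> base g \<in> carrier \<Gamma>"
  by (auto simp: base_def HNN_def presented_group_def hnn_generators_def)

lemma stable_closed [simp, intro]: "stable \<in> carrier \<Gamma>"
  by (auto simp: stable_def HNN_def presented_group_def hnn_generators_def)

text \<open>The universal property. The relation is required as \<open>a u = u (\<phi> a)\<close>,
  free of inverses, which is the form in which actions satisfy it.\<close>

lemma hnn_hom:
  assumes "group E" "f \<in> hom G E" "u \<in> carrier E"
    and rel: "\<And>a. a \<in> A \<Longrightarrow> f a \<otimes>\<^bsub>E\<^esub> u = u \<otimes>\<^bsub>E\<^esub> f (\<phi> a)"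
  obtains F where "F \<in> hom \<Gamma> E" "\<And>g. g \<in> carrier G \<Longrightarrow> F (base g) = f g" "F stable = u"
proof -
  interpret E: group E by fact
  have f: "f x \<in> carrier E" if "x \<in> carrier G" for x
    using assms(2) that by (auto simp: hom_def)
  define f' where "f' = case_option u f"
  have f': "f' \<in> hnn_generators G \<rightarrow> carrier E"
    using f assms(3) by (auto simp: f'_def hnn_generators_def)
  have R: "word_value E f' r = \<one>\<^bsub>E\<^esub>" if "r \<in> hnn_relators G A \<phi>" for r
    using that unfolding hnn_relators_def
  proof (elim UnE CollectE exE conjE)
    fix x y assume "r = [(Some x, True), (Some y, True), (Some (x \<otimes> y), False)]"
      "x \<in> carrier G" "y \<in> carrier G"
    then show ?thesis
      using assms(2) f by (simp add: f'_def hom_mult[OF assms(2)] E.m_assoc[symmetric])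
  next
    fix a assume a: "r = [(None, False), (Some a, True), (None, True), (Some (\<phi> a), False)]" "a \<in> A"
    have "inv\<^bsub>E\<^esub> u \<otimes>\<^bsub>E\<^esub> (f a \<otimes>\<^bsub>E\<^esub> (u \<otimes>\<^bsub>E\<^esub> inv\<^bsub>E\<^esub> f (\<phi> a))) = 
       inv\<^bsub>E\<^esub> u \<otimes>\<^bsub>E\<^esub> (u \<otimes>\<^bsub>E\<^esub> f (\<phi> a)) \<otimes>\<^bsub>E\<^esub> inv\<^bsub>E\<^esub> f (\<phi> a)"
      using a(2) f assms(3) by (simp add: rel[symmetric] E.m_assoc)
    also have "\<dots> = \<one>\<^bsub>E\<^esub>"
      using a(2) f assms(3) by (simp add: E.m_assoc[symmetric])
    finally show ?thesis using a f assms(3) by (simp add: f'_def)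
  qed
  obtain F where F: "F \<in> hom \<Gamma> E"
    "\<And>w. w \<in> words (hnn_generators G) \<Longrightarrow>
       F (word_class (hnn_generators G) (hnn_relators G A \<phi>) w) = word_value E f' w"
    using E.presented_group_hom[OF f' R] unfolding HNN_def by blast
  show thesis
  proof (rule that[OF F(1)])
    show "F (base g) = f g" if "g \<in> carrier G" for g
      using that f by (simp add: base_def F(2) f'_def)
    show "F stable = u"
      using assms(3) by (simp add: stable_def F(2) f'_def)
  qed
qed

lemma relator_eq_one:
  assumes "r \<in> hnn_relators G A \<phi>" "r \<in> words (hnn_generators G)"
  shows "word_class (hnn_generators G) (hnn_relators G A \<phi>) r = \<one>\<^bsub>\<Gamma>\<^esub>"
  using word_eq.relator[of "[]" _ "[]" r] assms
  by (simp add: HNN_def presented_group_def word_class_eq_iff)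

lemma word_class_inverse:
  assumes "x \<in> hnn_generators G"
  shows "word_class (hnn_generators G) (hnn_relators G A \<phi>) [(x, False)]
    = inv\<^bsub>\<Gamma>\<^esub> word_class (hnn_generators G) (hnn_relators G A \<phi>) [(x, True)]"
proof (rule \<Gamma>.inv_equality[symmetric])
  show "word_class (hnn_generators G) (hnn_relators G A \<phi>) [(x, False)] \<otimes>\<^bsub>\<Gamma>\<^esub>
    word_class (hnn_generators G) (hnn_relators G A \<phi>) [(x, True)] = \<one>\<^bsub>\<Gamma>\<^esub>"
    using assms word_eq.cancel[of "[]" "hnn_generators G" "[]" x "hnn_relators G A \<phi>" False]
    unfolding HNN_def by (simp add: word_class_mult) (simp add: presented_group_def word_class_eq_iff)
qed (use assms in \<open>auto simp: HNN_def presented_group_def\<close>)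

text \<open>Turns classes into products inside the group, so that each relator becomes an equation
  between \<open>base\<close> and \<open>stable\<close> open to ordinary group calculation.\<close>

lemma word_class_value:
  assumes "w \<in> words (hnn_generators G)"
  shows "word_class (hnn_generators G) (hnn_relators G A \<phi>) w
    = word_value \<Gamma> (case_option stable base) w"
  using assms
proof (induction w)
  case Nil
  then show ?case by (simp add: HNN_def presented_group_def)
next
  case (Cons a w)
  let ?cls = "word_class (hnn_generators G) (hnn_relators G A \<phi>)"
  obtain x e where a: "a = (x, e)" by force
  have "?cls (a # w) = ?cls [a] \<otimes>\<^bsub>\<Gamma>\<^esub> ?cls w"
    using Cons.prems unfolding HNN_def by (simp add: word_class_mult)
  moreover have "?cls [(x, True)] = case_option stable base x"
    by (cases x) (simp_all add: stable_def base_def)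
  ultimately show ?case
    using Cons a word_class_inverse[of x] by (cases e) auto
qed

lemma base_mult:
  assumes "x \<in> carrier G" "y \<in> carrier G"
  shows "base (x \<otimes> y) = base x \<otimes>\<^bsub>\<Gamma>\<^esub> base y"
proof -
  have rel: "[(Some x, True), (Some y, True), (Some (x \<otimes> y), False)] \<in> hnn_relators G A \<phi>"
    using assms by (auto simp: hnn_relators_def)
  have "base x \<otimes>\<^bsub>\<Gamma>\<^esub> (base y \<otimes>\<^bsub>\<Gamma>\<^esub> inv\<^bsub>\<Gamma>\<^esub> base (x \<otimes> y)) = \<one>\<^bsub>\<Gamma>\<^esub>"
    using relator_eq_one[OF rel] assms by (simp add: word_class_value)
  then have "inv\<^bsub>\<Gamma>\<^esub> (inv\<^bsub>\<Gamma>\<^esub> base (x \<otimes> y)) = base x \<otimes>\<^bsub>\<Gamma>\<^esub> base y"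
    using assms by (intro \<Gamma>.inv_equality) (simp_all add: \<Gamma>.m_assoc)
  then show ?thesis
    using assms by simp
qed

lemma base_hom: "base \<in> hom G \<Gamma>"
  by (auto simp: hom_def base_mult)

lemma base_one: "base \<one> = \<one>\<^bsub>\<Gamma>\<^esub>"
  using base_hom by (rule hom_one) (rule is_group, rule group_HNN)

lemma base_stable:
  assumes "a \<in> A"
  shows "base a \<otimes>\<^bsub>\<Gamma>\<^esub> stable = stable \<otimes>\<^bsub>\<Gamma>\<^esub> base (\<phi> a)"
proof -
  have rel: "[(None, False), (Some a, True), (None, True), (Some (\<phi> a), False)] \<in> hnn_relators G A \<phi>"
    using assms by (auto simp: hnn_relators_def)
  have "inv\<^bsub>\<Gamma>\<^esub> stable \<otimes>\<^bsub>\<Gamma>\<^esub> (base a \<otimes>\<^bsub>\<Gamma>\<^esub> (stable \<otimes>\<^bsub>\<Gamma>\<^esub> inv\<^bsub>\<Gamma>\<^esub> base (\<phi> a))) = \<one>\<^bsub>\<Gamma>\<^esub>"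
    using relator_eq_one[OF rel] assms by (simp add: word_class_value)
  then have "inv\<^bsub>\<Gamma>\<^esub> (inv\<^bsub>\<Gamma>\<^esub> base (\<phi> a)) = inv\<^bsub>\<Gamma>\<^esub> stable \<otimes>\<^bsub>\<Gamma>\<^esub> (base a \<otimes>\<^bsub>\<Gamma>\<^esub> stable)"
    using assms by (intro \<Gamma>.inv_equality) (simp_all add: \<Gamma>.m_assoc)
  then show ?thesis
    using assms by (simp add: \<Gamma>.m_assoc[symmetric])
qed

end

section \<open>Reduced words\<close>

text \<open>The target group is a parameter because the same expression is evaluated both in the
  HNN-extension and in permutation groups; see \<open>hom_nu\<close>.\<close>

primrec syllable_value ::
    "('b, 'n) monoid_scheme \<Rightarrow> ('a \<Rightarrow> 'b) \<Rightarrow> 'b \<Rightarrow> 'a \<Rightarrow> (bool \<times> 'a) list \<Rightarrow> 'b" where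
  "syllable_value E f u g [] = f g"
| "syllable_value E f u g (s # L) =
     f g \<otimes>\<^bsub>E\<^esub> ((if fst s then u else inv\<^bsub>E\<^esub> u) \<otimes>\<^bsub>E\<^esub> syllable_value E f u (snd s) L)"

lemma (in group) syllable_value_closed:
  "f \<in> S \<rightarrow> carrier G \<Longrightarrow> u \<in> carrier G \<Longrightarrow> g \<in> S \<Longrightarrow> snd ` set L \<subseteq> S \<Longrightarrow>
    syllable_value G f u g L \<in> carrier G"
  by (induction L arbitrary: g) (auto simp: Pi_iff)

context hnn_data
begin

abbreviation "\<nu> \<equiv> syllable_value \<Gamma> base stable"

lemma nu_closed: "g \<in> carrier G \<Longrightarrow> snd ` set L \<subseteq> carrier G \<Longrightarrow> \<nu> g L \<in> carrier \<Gamma>"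
  by (rule \<Gamma>.syllable_value_closed) auto

lemma nu_mult:
  assumes "x \<in> carrier G" "g \<in> carrier G" "snd ` set L \<subseteq> carrier G"
  shows "base x \<otimes>\<^bsub>\<Gamma>\<^esub> \<nu> g L = \<nu> (x \<otimes> g) L"
proof (cases L)
  case Nil
  then show ?thesis using assms by (simp add: base_mult)
next
  case (Cons s L')
  then show ?thesis using assms nu_closed[of "snd s" L'] by (simp add: base_mult \<Gamma>.m_assoc)
qed

lemma nu_surj:
  assumes "\<gamma> \<in> carrier \<Gamma>"
  obtains g L where "g \<in> carrier G" "snd ` set L \<subseteq> carrier G" "\<gamma> = \<nu> g L"
proof -
  have "\<exists>g L. g \<in> carrier G \<and> snd ` set L \<subseteq> carrier G \<and>
      word_value \<Gamma> (case_option stable base) w = \<nu> g L" if "w \<in> words (hnn_generators G)" for w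
    using that
  proof (induction w)
    case Nil
    show ?case by (intro exI[of _ \<one>] exI[of _ "[]"]) (simp add: base_one)
  next
    case (Cons a w)
    then obtain g L where gL: "g \<in> carrier G" "snd ` set L \<subseteq> carrier G"
      "word_value \<Gamma> (case_option stable base) w = \<nu> g L" by auto
    note closed = nu_closed[OF gL(1,2)]
    show ?case
    proof (cases "fst a")
      case None
      then show ?thesis using gL closed
        by (intro exI[of _ \<one>] exI[of _ "(snd a, g) # L"]) (simp add: base_one)
    next
      case (Some x)
      then have x: "x \<in> carrier G" using Cons.prems by simp
      have "inv\<^bsub>\<Gamma>\<^esub> base x = base (inv x)"
        using x base_mult[of "inv x" x] by (intro \<Gamma>.inv_equality) (simp_all add: base_one)
      then show ?thesis using gL closed x Some
        by (intro exI[of _ "(if snd a then x else inv x) \<otimes> g"] exI[of _ L]) (simp add: nu_mult)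
    qed
  qed
  moreover obtain w where "w \<in> words (hnn_generators G)"
    "\<gamma> = word_class (hnn_generators G) (hnn_relators G A \<phi>) w"
    using assms by (auto simp: HNN_def presented_group_def)
  ultimately show thesis
    using that by (metis word_class_value)
qed

text \<open>Britton's condition, which forbids \<open>t\<inverse> a t\<close> and
  \<open>t b t\<inverse>\<close>. A pair holds the base element to the right of its letter, so the
  element of the last pair is unrestricted.\<close>

definition reduced :: "(bool \<times> 'a) list \<Rightarrow> bool" where
  "reduced = successively (\<lambda>(e, g) (e', g'). e \<noteq> e' \<longrightarrow> g \<notin> (if e then B else A))"

lemma cancel_stable:
  assumes "a \<in> A" "\<gamma> \<in> carrier \<Gamma>"
  shows "inv\<^bsub>\<Gamma>\<^esub> stable \<otimes>\<^bsub>\<Gamma>\<^esub> (base a \<otimes>\<^bsub>\<Gamma>\<^esub> (stable \<otimes>\<^bsub>\<Gamma>\<^esub> \<gamma>)) = base (\<phi> a) \<otimes>\<^bsub>\<Gamma>\<^esub> \<gamma>"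
    and "stable \<otimes>\<^bsub>\<Gamma>\<^esub> (base (\<phi> a) \<otimes>\<^bsub>\<Gamma>\<^esub> (inv\<^bsub>\<Gamma>\<^esub> stable \<otimes>\<^bsub>\<Gamma>\<^esub> \<gamma>)) = base a \<otimes>\<^bsub>\<Gamma>\<^esub> \<gamma>"
proof -
  have "inv\<^bsub>\<Gamma>\<^esub> stable \<otimes>\<^bsub>\<Gamma>\<^esub> (base a \<otimes>\<^bsub>\<Gamma>\<^esub> (stable \<otimes>\<^bsub>\<Gamma>\<^esub> \<gamma>))
      = inv\<^bsub>\<Gamma>\<^esub> stable \<otimes>\<^bsub>\<Gamma>\<^esub> ((base a \<otimes>\<^bsub>\<Gamma>\<^esub> stable) \<otimes>\<^bsub>\<Gamma>\<^esub> \<gamma>)"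
    using assms by (simp add: \<Gamma>.m_assoc)
  also have "\<dots> = base (\<phi> a) \<otimes>\<^bsub>\<Gamma>\<^esub> \<gamma>"
    unfolding base_stable[OF assms(1)] using assms by (simp add: \<Gamma>.m_assoc[symmetric])
  finally show "inv\<^bsub>\<Gamma>\<^esub> stable \<otimes>\<^bsub>\<Gamma>\<^esub> (base a \<otimes>\<^bsub>\<Gamma>\<^esub> (stable \<otimes>\<^bsub>\<Gamma>\<^esub> \<gamma>)) = base (\<phi> a) \<otimes>\<^bsub>\<Gamma>\<^esub> \<gamma>" .
  have "stable \<otimes>\<^bsub>\<Gamma>\<^esub> (base (\<phi> a) \<otimes>\<^bsub>\<Gamma>\<^esub> (inv\<^bsub>\<Gamma>\<^esub> stable \<otimes>\<^bsub>\<Gamma>\<^esub> \<gamma>))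
      = (stable \<otimes>\<^bsub>\<Gamma>\<^esub> base (\<phi> a)) \<otimes>\<^bsub>\<Gamma>\<^esub> (inv\<^bsub>\<Gamma>\<^esub> stable \<otimes>\<^bsub>\<Gamma>\<^esub> \<gamma>)"
    using assms by (simp add: \<Gamma>.m_assoc)
  also have "\<dots> = base a \<otimes>\<^bsub>\<Gamma>\<^esub> (stable \<otimes>\<^bsub>\<Gamma>\<^esub> (inv\<^bsub>\<Gamma>\<^esub> stable \<otimes>\<^bsub>\<Gamma>\<^esub> \<gamma>))"
    unfolding base_stable[OF assms(1), symmetric] using assms by (simp add: \<Gamma>.m_assoc)
  also have "\<dots> = base a \<otimes>\<^bsub>\<Gamma>\<^esub> \<gamma>"
    using assms by (simp add: \<Gamma>.m_assoc[symmetric])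
  finally show "stable \<otimes>\<^bsub>\<Gamma>\<^esub> (base (\<phi> a) \<otimes>\<^bsub>\<Gamma>\<^esub> (inv\<^bsub>\<Gamma>\<^esub> stable \<otimes>\<^bsub>\<Gamma>\<^esub> \<gamma>)) = base a \<otimes>\<^bsub>\<Gamma>\<^esub> \<gamma>" .
qed

text \<open>A forbidden pattern equals a base element \<open>k\<close> by
  \<open>cancel_stable\<close>; merging \<open>k\<close> with its neighbours removes two
  letters.\<close>

lemma not_reduced:
  assumes "\<not> reduced L" "g \<in> carrier G" "snd ` set L \<subseteq> carrier G"
  obtains g' L' where "g' \<in> carrier G" "snd ` set L' \<subseteq> carrier G"
    "length L' < length L" "\<nu> g L = \<nu> g' L'"
proof -
  have "\<exists>g' L'. g' \<in> carrier G \<and> snd ` set L' \<subseteq> carrier G \<and>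
    length L' < length L \<and> \<nu> g L = \<nu> g' L'"
    using assms
  proof (induction L arbitrary: g)
    case Nil
    then show ?case by (simp add: reduced_def)
  next
    case (Cons s L)
    obtain e h where s: "s = (e, h)" by force
    have h: "h \<in> carrier G" using Cons.prems s by simp
    show ?case
    proof (cases "reduced L")
      case False
      then obtain h' L' where *: "h' \<in> carrier G" "snd ` set L' \<subseteq> carrier G"
        "length L' < length L" "\<nu> h L = \<nu> h' L'"
        using Cons.IH[of h] Cons.prems h by auto
      then show ?thesis
        using Cons.prems s by (intro exI[of _ g] exI[of _ "(e, h') # L'"]) simp
    next
      case True
      then obtain e' h' L' where L: "L = (e', h') # L'" "e \<noteq> e'" "h \<in> (if e then B else A)"
        using Cons.prems s by (cases L) (auto simp: reduced_def)
      have h': "h' \<in> carrier G" "snd ` set L' \<subseteq> carrier G"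
        using Cons.prems L by auto
      obtain k where k: "k \<in> carrier G" "\<nu> g (s # L) = base g \<otimes>\<^bsub>\<Gamma>\<^esub> (base k \<otimes>\<^bsub>\<Gamma>\<^esub> \<nu> h' L')"
      proof (cases e)
        case False
        then show thesis
          using L s h' nu_closed[OF h'] by (intro that[of "\<phi> h"]) (auto simp: cancel_stable)
      next
        case True
        then obtain a where "a \<in> A" "h = \<phi> a" using L phi_image by auto
        then show thesis
          using L s h' True nu_closed[OF h'] by (intro that[of a]) (auto simp: cancel_stable)
      qed
      then have "\<nu> g (s # L) = \<nu> (g \<otimes> (k \<otimes> h')) L'"
        using h' Cons.prems by (simp only: nu_mult m_closed)
      then show ?thesis
        using k h' L Cons.prems by (intro exI[of _ "g \<otimes> (k \<otimes> h')"] exI[of _ L']) simp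
    qed
  qed
  then show thesis using that by blast
qed

text \<open>An expression with the fewest stable letters will do, by
  \<open>not_reduced\<close>.\<close>

lemma reduced_form:
  assumes "\<gamma> \<in> carrier \<Gamma>"
  obtains g L where "g \<in> carrier G" "snd ` set L \<subseteq> carrier G" "\<gamma> = \<nu> g L" "reduced L"
proof -
  define P where "P n \<longleftrightarrow> (\<exists>g L. g \<in> carrier G \<and> snd ` set L \<subseteq> carrier G \<and> \<gamma> = \<nu> g L \<and> length L = n)" for n
  have "\<exists>n. P n" using nu_surj[OF assms] unfolding P_def by metis
  then have "P (LEAST n. P n)" by (rule LeastI_ex)
  then obtain g L where gL: "g \<in> carrier G" "snd ` set L \<subseteq> carrier G" "\<gamma> = \<nu> g L" "length L = (LEAST n. P n)"
    unfolding P_def by blast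
  have "reduced L"
  proof (rule ccontr)
    assume "\<not> reduced L"
    then obtain g' L' where "g' \<in> carrier G" "snd ` set L' \<subseteq> carrier G"
      "length L' < length L" "\<nu> g L = \<nu> g' L'"
      using not_reduced gL by metis
    then show False
      using gL not_less_Least[of "length L'" P] unfolding P_def by metis
  qed
  with gL show thesis using that by blast
qed

lemma hom_nu:
  assumes "group E" "F \<in> hom \<Gamma> E" "\<And>g. g \<in> carrier G \<Longrightarrow> F (base g) = f g" "F stable = u"
    and "g \<in> carrier G" "snd ` set L \<subseteq> carrier G"
  shows "F (\<nu> g L) = syllable_value E f u g L"
  using assms(5,6)
proof (induction L arbitrary: g)
  case (Cons s L)
  interpret F: group_hom \<Gamma> E F
    using assms by (simp add: group_hom_def group_hom_axioms_def \<Gamma>.is_group)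
  show ?case
    using Cons nu_closed[of "snd s" L] by (simp add: assms(3,4) nu_closed)
qed (simp add: assms(3))

end

section \<open>Cosets and quotients of prime order\<close>

context group
begin

text \<open>The choice is made from the coset as a set, so that equal cosets have identical
  representatives.\<close>

definition coset_rep :: "'a set \<Rightarrow> 'a \<Rightarrow> 'a" where
  "coset_rep H x = (SOME y. y \<in> H #> x)"

lemma coset_rep_mem: "subgroup H G \<Longrightarrow> x \<in> carrier G \<Longrightarrow> coset_rep H x \<in> H #> x"
  unfolding coset_rep_def using rcos_self by (rule someI)

lemma coset_rep_closed: "subgroup H G \<Longrightarrow> x \<in> carrier G \<Longrightarrow> coset_rep H x \<in> carrier G"
  using coset_rep_mem subgroup.elemrcos_carrier is_group by metis

lemma coset_rep_eq: "subgroup H G \<Longrightarrow> x \<in> carrier G \<Longrightarrow> H #> coset_rep H x = H #> x"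
  using repr_independence[OF coset_rep_mem] by metis

lemma coset_rep_cong: "H #> x = H #> y \<Longrightarrow> coset_rep H x = coset_rep H y"
  by (simp add: coset_rep_def)

lemma coset_rep_idem:
  "subgroup H G \<Longrightarrow> x \<in> carrier G \<Longrightarrow> coset_rep H (coset_rep H x) = coset_rep H x"
  by (intro coset_rep_cong coset_rep_eq)

lemma coset_rep_mult:
  assumes "subgroup H G" "x \<in> carrier G" "h \<in> H"
  shows "coset_rep H (h \<otimes> x) = coset_rep H x"
  using repr_independence[of "h \<otimes> x" H x] rcosI[of h H x] subgroup.subset[OF assms(1)] assms
  by (intro coset_rep_cong) simp

lemma coset_rep_split:
  assumes "subgroup H G" "x \<in> carrier G"
  obtains h where "h \<in> H" "x = h \<otimes> coset_rep H x"
  using coset_rep_eq[OF assms] rcos_self[OF assms(2,1)] by (auto simp: r_coset_def)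

lemma coset_eq_iff:
  assumes "M \<lhd> G" "x \<in> carrier G" "y \<in> carrier G"
  shows "M #> x = M #> y \<longleftrightarrow> x \<otimes> inv y \<in> M"
proof -
  interpret normal M G by fact
  show ?thesis
    using repr_independence[of x M y] rcos_self[of x M] rcos_module[of y x] assms is_group subgroup_axioms
    by auto
qed

lemma coset_eq_self_iff:
  assumes "M \<lhd> G" "x \<in> carrier G"
  shows "M #> x = M \<longleftrightarrow> x \<in> M"
  using coset_eq_iff[OF assms, of \<one>] assms(2)
    coset_mult_one[OF subgroup.subset[OF normal_imp_subgroup[OF assms(1)]]] by simp

lemma coset_mult_cong:
  assumes "M \<lhd> G" "M #> x = M #> x'" "M #> y = M #> y'"
    and "x \<in> carrier G" "x' \<in> carrier G" "y \<in> carrier G" "y' \<in> carrier G"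
  shows "M #> (x \<otimes> y) = M #> (x' \<otimes> y')"
  using assms normal.rcos_sum[OF assms(1)] by metis

lemma coset_pow_cong:
  assumes "M \<lhd> G" "M #> x = M #> x'" "x \<in> carrier G" "x' \<in> carrier G"
  shows "M #> x [^] (n::nat) = M #> x' [^] n"
  using assms normal.FactGroup_pow[OF assms(1)] by metis

lemma coset_eq_mono:
  assumes "M \<lhd> G" "N \<lhd> G" "M \<subseteq> N" "M #> x = M #> y" "x \<in> carrier G" "y \<in> carrier G"
  shows "N #> x = N #> y"
  using assms coset_eq_iff by blast

lemma subgroup_coset [simp]: "M #>\<^bsub>G\<lparr>carrier := N\<rparr>\<^esub> x = M #> x"
  by (simp add: r_coset_def)

lemma subgroup_set_mult [simp]: "X <#>\<^bsub>G\<lparr>carrier := N\<rparr>\<^esub> Y = X <#> Y"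
  by (simp add: set_mult_def)

lemma carrier_subgroup_quotient: "carrier (G\<lparr>carrier := N\<rparr> Mod M) = (\<lambda>x. M #> x) ` N"
  by (auto simp: FactGroup_def RCOSETS_def)

text \<open>The quotient is cyclic and generated by each \<open>y\<close> outside \<open>M\<close>.
  The consequences are phrased with elements of \<open>G\<close>, where the later coset calculations
  take place.\<close>

lemma quotient_order_prime:
  assumes "prime p" "M \<lhd> G" "N \<lhd> G" "M \<subseteq> N" "order (G\<lparr>carrier := N\<rparr> Mod M) = p" "y \<in> N"
  shows "y [^] p \<in> M"
    and "y \<notin> M \<Longrightarrow> z \<in> N \<Longrightarrow> \<exists>k::nat. M #> z = M #> y [^] k"
    and "y \<notin> M \<Longrightarrow> M #> y [^] (k::nat) = M #> y [^] (l::nat) \<Longrightarrow> [k = l] (mod p)"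
proof -
  let ?Q = "G\<lparr>carrier := N\<rparr> Mod M"
  have N: "subgroup N G" using assms(3) by (rule normal_imp_subgroup)
  have M: "M \<lhd> G\<lparr>carrier := N\<rparr>"
    using normal_restrict_supergroup[OF N assms(2,4)] .
  interpret Q: group ?Q using M by (rule normal.factorgroup_is_group)
  have fin: "finite (carrier ?Q)"
    using assms(1,5) by (metis Q.order_gt_0_iff_finite prime_gt_0_nat)
  have pow: "(M #> x) [^]\<^bsub>?Q\<^esub> (k::nat) = M #> x [^] k" if "x \<in> N" for x k
    using normal.FactGroup_pow[OF M, of x k] that
    by (simp add: nat_pow_consistent[symmetric])
  have y: "M #> y \<in> carrier ?Q" "y \<in> carrier G"
    using assms(6) subgroup.subset[OF N] by (auto simp: carrier_subgroup_quotient)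
  have "M #> y [^] p = M"
    using Q.pow_order_eq_1[OF y(1)] assms(5) pow[OF assms(6)] by simp
  then show "y [^] p \<in> M"
    using coset_eq_self_iff[OF assms(2)] y by simp
  assume "y \<notin> M"
  then have "Q.ord (M #> y) \<noteq> 1"
    using Q.ord_eq_1[OF y(1)] coset_eq_self_iff[OF assms(2) y(2)] by simp
  then have ord: "Q.ord (M #> y) = p"
    using Q.ord_dvd_group_order[OF y(1)] assms(1,5) by (metis prime_nat_iff)
  show "\<exists>k::nat. M #> z = M #> y [^] k" if "z \<in> N"
  proof -
    have "generate ?Q {M #> y} = carrier ?Q"
      using Q.generate_pow_card[OF y(1)] fin ord assms(5) Q.generate_incl[of "{M #> y}"] y
      by (intro card_subset_eq) (auto simp: order_def)
    then have "M #> z \<in> generate ?Q {M #> y}"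
      using that by (auto simp: carrier_subgroup_quotient)
    then show ?thesis
      using Q.generate_pow_on_finite_carrier[OF fin y(1)] pow[OF assms(6)] by auto
  qed
  assume "M #> y [^] k = M #> y [^] l"
  then have "(M #> y) [^]\<^bsub>?Q\<^esub> k = (M #> y) [^]\<^bsub>?Q\<^esub> l"
    using pow[OF assms(6)] by simp
  then show "[k = l] (mod p)"
    using Q.int_pow_eq[OF y(1), of "int l" "int k"] ord
    by (simp add: int_pow_int cong_iff_dvd_diff cong_sym_eq flip: cong_int_iff)
qed

text \<open>If \<open>g\<close> conjugates \<open>y\<close> to \<open>y\<^sup>k\<close> modulo \<open>M\<close>, then \<open>k\<close> to the power \<open>p\<^sup>n\<close> is \<open>1\<close> modulo \<open>p\<close>, so
  \<open>k\<close> is \<open>1\<close> by Fermat.\<close>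

lemma prime_quotient_central:
  assumes "prime p" "M \<lhd> G" "N \<lhd> G" "M \<subseteq> N" "order (G\<lparr>carrier := N\<rparr> Mod M) = p" "y \<in> N"
    and g: "g \<in> carrier G" "g [^] (p ^ n) \<in> M"
  shows "M #> (g \<otimes> y) = M #> (y \<otimes> g)"
proof (cases "y \<in> M")
  case True
  have "y \<in> carrier G" using True assms(2) by (meson normal_imp_subgroup subgroup.mem_carrier)
  moreover have "M #> y = M #> \<one>" 
    using True assms(2) \<open>y \<in> carrier G\<close> coset_eq_iff by simp
  ultimately show ?thesis
    using coset_mult_cong[OF assms(2), of g g y \<one>] coset_mult_cong[OF assms(2), of y \<one> g g] g by simp
next
  case False
  note Q = quotient_order_prime[OF assms(1-6)]
  have sub: "subgroup M G" "subgroup N G" using assms(2,3) by (simp_all add: normal_imp_subgroup)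
  have y: "y \<in> carrier G" using sub(2) assms(6) by (rule subgroup.mem_carrier)
  have "g \<otimes> y \<otimes> inv g \<in> N"
    using assms(3,6) g by (simp add: normal_inv_iff)
  then obtain k :: nat where k: "M #> (g \<otimes> y \<otimes> inv g) = M #> y [^] k"
    using Q(2)[OF False] by blast
  have step: "M #> (g \<otimes> y) = M #> (y [^] k \<otimes> g)"
    using coset_mult_cong[OF assms(2) k HOL.refl, of g] g y by (simp add: m_assoc)
  have pow: "M #> (g \<otimes> y [^] l) = M #> (y [^] (k * l) \<otimes> g)" for l :: nat
  proof (induction l)
    case (Suc l)
    have "M #> (g \<otimes> y [^] Suc l) = M #> ((g \<otimes> y [^] l) \<otimes> y)"
      using g y by (simp add: m_assoc)
    also have "\<dots> = M #> (y [^] (k * l) \<otimes> g \<otimes> y)"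
      using g y by (intro coset_mult_cong[OF assms(2) Suc.IH HOL.refl]) auto
    also have "\<dots> = M #> (y [^] (k * l) \<otimes> (g \<otimes> y))"
      using g y by (simp add: m_assoc)
    also have "\<dots> = M #> (y [^] (k * l) \<otimes> (y [^] k \<otimes> g))"
      using g y by (intro coset_mult_cong[OF assms(2) HOL.refl step]) auto
    also have "\<dots> = M #> (y [^] (k * Suc l) \<otimes> g)"
      using g y by (simp add: m_assoc[symmetric] nat_pow_mult add.commute)
    finally show ?case .
  qed (use g in simp)
  have gpow: "M #> (g [^] m \<otimes> y) = M #> (y [^] (k ^ m) \<otimes> g [^] m)" for m :: nat
  proof (induction m)
    case (Suc m)
    have "M #> (g [^] Suc m \<otimes> y) = M #> (g \<otimes> (g [^] m \<otimes> y))"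
      using g y by (metis m_assoc nat_pow_Suc2 nat_pow_closed)
    also have "\<dots> = M #> (g \<otimes> (y [^] (k ^ m) \<otimes> g [^] m))"
      using g y by (intro coset_mult_cong[OF assms(2) HOL.refl Suc.IH]) auto
    also have "\<dots> = M #> ((g \<otimes> y [^] (k ^ m)) \<otimes> g [^] m)"
      using g y by (simp add: m_assoc)
    also have "\<dots> = M #> (y [^] (k * k ^ m) \<otimes> g \<otimes> g [^] m)"
      using g y by (intro coset_mult_cong[OF assms(2) pow HOL.refl]) auto
    also have "\<dots> = M #> (y [^] (k ^ Suc m) \<otimes> g [^] Suc m)"
      using g y by (metis m_assoc nat_pow_Suc2 nat_pow_closed power_Suc)
    finally show ?case .
  qed (use y in simp)
  have one: "M #> g [^] (p ^ n) = M #> \<one>"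
    using assms(2) g coset_eq_iff by simp
  have "M #> y [^] (1::nat) = M #> (g [^] (p ^ n) \<otimes> y)"
    using coset_mult_cong[OF assms(2) one HOL.refl, of y] g y by simp
  also have "\<dots> = M #> y [^] (k ^ (p ^ n))"
    using coset_mult_cong[OF assms(2) HOL.refl one, of "y [^] (k ^ (p ^ n))"] g y by (simp add: gpow)
  finally have "[1 = k ^ (p ^ n)] (mod p)"
    by (rule Q(3)[OF False])
  moreover have "[a ^ (p ^ n) = a] (mod p)" for a :: nat
  proof (induction n)
    case (Suc n)
    have fermat: "[b ^ p = b] (mod p)" for b :: nat
    proof (cases "p dvd b")
      case True
      then have "p dvd b ^ p"
        using assms(1) prime_gt_0_nat by (meson dvd_power dvd_trans)
      then show ?thesis using True by (simp add: cong_def mod_0_imp_dvd dvd_imp_mod_0)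
    next
      case False
      have "[b * b ^ (p - 1) = b * 1] (mod p)"
        by (intro cong_scalar_left fermat_theorem assms(1) False)
      then show ?thesis
        using assms(1) by (metis mult.right_neutral power_eq_if prime_gt_0_nat not_gr0)
    qed
    have "[a ^ (p ^ Suc n) = (a ^ (p ^ n)) ^ p] (mod p)"
      by (simp add: mult.commute flip: power_mult)
    also have "[(a ^ (p ^ n)) ^ p = a ^ p] (mod p)"
      by (rule cong_pow[OF Suc.IH])
    also note fermat
    finally show ?case .
  qed simp
  ultimately have "[k = 1] (mod p)"
    by (metis cong_sym cong_trans)
  \<comment> \<open>The second fact guards against truncated subtraction in
    \<open>k - 1\<close>.\<close>
  then have "p dvd k - 1" "k \<noteq> 0"
    using assms(1) cong_to_1_nat cong_0_1_nat by (blast, metis not_prime_1)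
  then obtain j where j: "k = 1 + p * j"
    by (metis dvdE le_add_diff_inverse less_one linorder_not_less)
  have "M #> (y [^] p) [^] j = M #> \<one> [^] j"
    using Q(1) y assms(2) by (intro coset_pow_cong) (simp_all add: coset_eq_iff)
  then have "M #> (y \<otimes> y [^] (p * j)) = M #> (y \<otimes> \<one>)"
    using y by (intro coset_mult_cong[OF assms(2) HOL.refl]) (simp_all add: nat_pow_pow)
  then have "M #> y [^] k = M #> y"
    using y unfolding j by (metis nat_pow_eone nat_pow_mult r_one)
  then have "M #> (y [^] k \<otimes> g) = M #> (y \<otimes> g)"
    using y g by (intro coset_mult_cong[OF assms(2) _ HOL.refl]) auto
  then show ?thesis using step by simp
qed

text \<open>\<open>N / M\<close> embeds in a group of order \<open>p\<close>, so Lagrange leaves two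
  possibilities. Both can occur when a chain is intersected with a subgroup or pulled back.\<close>

lemma quotient_index_1_or_prime:
  assumes "prime p" "M \<lhd> G" "N \<lhd> G" "M \<subseteq> N" "group Q" "order Q = p"
    and f: "f \<in> hom (G\<lparr>carrier := N\<rparr>) Q" "\<And>x. x \<in> N \<Longrightarrow> f x = \<one>\<^bsub>Q\<^esub> \<longleftrightarrow> x \<in> M"
  shows "M = N \<or> order (G\<lparr>carrier := N\<rparr> Mod M) = p"
proof -
  interpret Q: group Q by fact
  have N: "subgroup N G" using assms(3) by (rule normal_imp_subgroup)
  then interpret f: group_hom "G\<lparr>carrier := N\<rparr>" Q f
    using f by (simp add: group_hom_def group_hom_axioms_def subgroup_imp_group)
  have ker: "kernel (G\<lparr>carrier := N\<rparr>) Q f = M"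
    using f(2) assms(4) by (auto simp: kernel_def)
  let ?I = "f ` N"
  have I: "subgroup ?I Q"
    using f.img_is_subgroup by simp
  have "card (carrier (G\<lparr>carrier := N\<rparr> Mod M)) = card ?I"
  proof -
    have "(\<lambda>X. the_elem (f ` X)) ` carrier (G\<lparr>carrier := N\<rparr> Mod M) = ?I"
    proof -
      have "the_elem (f ` (M #> x)) = f x" if "x \<in> N" for x
      proof -
        have "f (m \<otimes> x) = f x" if "m \<in> M" for m
          using f(2)[of m] hom_mult[OF f(1), of m x] f.hom_closed[of x] that \<open>x \<in> N\<close> assms(4) by auto
        then have "f ` (M #> x) = {f x}"
          using subgroup.one_closed[OF normal_imp_subgroup[OF assms(2)]]
          by (auto simp: r_coset_def image_UN)
        then show ?thesis by simp
      qed
      then show ?thesis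
        unfolding carrier_subgroup_quotient image_image by (auto simp: image_iff)
    qed
    then show ?thesis
      using card_image[OF f.FactGroup_inj_on] unfolding ker by simp
  qed
  then have "order (G\<lparr>carrier := N\<rparr> Mod M) dvd p"
    using Q.lagrange[OF I] assms(6) unfolding order_def by (metis dvd_triv_right)
  then consider "order (G\<lparr>carrier := N\<rparr> Mod M) = p" | "card ?I = 1"
    using assms(1) \<open>card (carrier (G\<lparr>carrier := N\<rparr> Mod M)) = card ?I\<close> 
    by (auto simp: order_def prime_nat_iff)
  then show ?thesis
  proof cases
    case 2
    then obtain c where "?I = {c}"
      by (auto simp: card_1_singleton_iff)
    then have "?I = {\<one>\<^bsub>Q\<^esub>}"
      using subgroup.one_closed[OF I] by simp
    then show ?thesis using f(2) assms(4) by auto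
  qed simp
qed

end

section \<open>Finite \<open>p\<close>-groups\<close>

text \<open>The class equation: with a trivial centre every conjugacy class except
  \<open>{\<one>}\<close> has size divisible by \<open>p\<close>, so \<open>p\<close> would divide
  both \<open>order G\<close> and \<open>order G - 1\<close>.\<close>

lemma (in group) p_group_center_nontrivial:
  assumes p: "prime p" and fin: "finite_p_group p G" and nontriv: "carrier G \<noteq> {\<one>}"
  obtains z where "z \<in> carrier G" "z \<noteq> \<one>" "\<And>g. g \<in> carrier G \<Longrightarrow> g \<otimes> z = z \<otimes> g"
proof (rule ccontr)
  note witness = that
  assume "\<not> thesis"
  then have noncentral: "\<exists>g\<in>carrier G. g \<otimes> z \<noteq> z \<otimes> g" if "z \<in> carrier G" "z \<noteq> \<one>" for z
    using that witness \<open>\<not> thesis\<close> by metis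
  let ?c = "\<lambda>g. \<lambda>h\<in>carrier G. g \<otimes> h \<otimes> inv g"
  interpret c: group_action G "carrier G" ?c by (rule action_by_conjugation)
  obtain k where k: "order G = p ^ k" and finG: "finite (carrier G)"
    using fin by (auto simp: finite_p_group_def)
  let ?O = "orbits G (carrier G) ?c"
  have orbit_self: "x \<in> orbit G ?c x" if "x \<in> carrier G" for x
    using c.orbit_refl[OF that] .
  have one: "orbit G ?c \<one> = {\<one>}"
  proof
    show "orbit G ?c \<one> \<subseteq> {\<one>}" by (auto simp: orbit_def)
  qed (use orbit_self[of \<one>] in simp)
  have dvd: "p dvd card U" if "U \<in> ?O - {{\<one>}}" for U
  proof -
    obtain x where x: "x \<in> carrier G" "U = orbit G ?c x"
      using \<open>U \<in> ?O - {{\<one>}}\<close> by (auto simp: orbits_def)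
    then have "x \<noteq> \<one>" using one \<open>U \<in> ?O - {{\<one>}}\<close> by auto
    then obtain g where g: "g \<in> carrier G" "g \<otimes> x \<noteq> x \<otimes> g" using noncentral x by blast
    then have "g \<otimes> x \<otimes> inv g \<noteq> x" using x by (metis inv_solve_right m_closed)
    moreover have "g \<otimes> x \<otimes> inv g \<in> U" using x g by (auto simp: orbit_def)
    ultimately have "card U \<noteq> 1"
      using orbit_self[OF x(1)] x(2) by (auto simp: card_1_singleton_iff)
    moreover have "card U dvd p ^ k"
      using dvdI[OF c.orbit_stabilizer_theorem[OF x(1), symmetric]] k x(2) by simp
    then obtain i where "card U = p ^ i"
      using divides_primepow_nat[OF p] by blast
    ultimately show ?thesis by (cases i) auto
  qed
  have fin_orbits: "finite ?O"
    using finG by (simp add: orbits_def)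
  have mem: "{\<one>} \<in> ?O"
    using one by (force simp: orbits_def)
  have "order G = (\<Sum>U\<in>?O. card U)"
    using c.disjoint_sum[OF finG, of "\<lambda>_. 1 :: nat"] by (simp add: order_def)
  also have "\<dots> = 1 + (\<Sum>U\<in>?O - {{\<one>}}. card U)"
    using fin_orbits mem by (simp add: sum.remove)
  finally have "order G = 1 + (\<Sum>U\<in>?O - {{\<one>}}. card U)" .
  moreover have "p dvd (\<Sum>U\<in>?O - {{\<one>}}. card U)"
    by (intro dvd_sum dvd)
  moreover have "p dvd order G"
  proof -
    have "k \<noteq> 0"
    proof
      assume "k = 0"
      then have "card (carrier G) = 1" using k by (simp add: order_def)
      then show False using nontriv one_closed by (metis card_1_singletonE singletonD)
    qed
    then show ?thesis using k by simp
  qed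
  ultimately show False using p dvd_add_left_iff[of p _ 1] by fastforce
qed

lemma (in group) p_group_central_prime_order:
  assumes p: "prime p" and fin: "finite_p_group p G" and nontriv: "carrier G \<noteq> {\<one>}"
  obtains z where "z \<in> carrier G" "ord z = p" "\<And>g. g \<in> carrier G \<Longrightarrow> g \<otimes> z = z \<otimes> g"
proof -
  obtain z where z: "z \<in> carrier G" "z \<noteq> \<one>" "\<And>g. g \<in> carrier G \<Longrightarrow> g \<otimes> z = z \<otimes> g"
    using p_group_center_nontrivial[OF assms] by blast
  obtain k where k: "order G = p ^ k" using fin by (auto simp: finite_p_group_def)
  \<comment> \<open>The last non-trivial element among the iterated \<open>p\<close>-th powers of
    \<open>z\<close> has order \<open>p\<close>.\<close>
  define m where "m = (LEAST m. z [^] (p ^ m) = \<one>)"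
  have "z [^] (p ^ k) = \<one>" using pow_order_eq_1[OF z(1)] k by simp
  then have m: "z [^] (p ^ m) = \<one>" unfolding m_def by (rule LeastI)
  have "m \<noteq> 0" using m z by (cases m) auto
  define w where "w = z [^] (p ^ (m - 1))"
  have w: "w \<in> carrier G" "w \<noteq> \<one>"
    using z \<open>m \<noteq> 0\<close> not_less_Least[of "m - 1" "\<lambda>m. z [^] (p ^ m) = \<one>"] 
    by (auto simp: w_def m_def)
  have "w [^] p = z [^] (p ^ m)"
    using \<open>m \<noteq> 0\<close> z by (simp add: w_def nat_pow_pow power_eq_if mult.commute)
  then have "ord w dvd p" using m w by (simp add: pow_eq_id)
  then have "ord w = p" using p w ord_eq_1[of w] by (auto simp: prime_nat_iff)
  moreover have "g \<otimes> w = w \<otimes> g" if "g \<in> carrier G" for g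
    using that z group_commutes_pow[of z g] by (simp add: w_def)
  ultimately show thesis using that w by blast
qed

text \<open>Lifts a central subgroup of order \<open>p\<close> of the quotient by \<open>L\<close>;
  the last conclusion expresses that \<open>N / L\<close> is central.\<close>

lemma (in group) p_group_central_step:
  assumes p: "prime p" and fin: "finite_p_group p G" and L: "L \<lhd> G" "L \<noteq> carrier G"
  obtains N where "N \<lhd> G" "L \<subset> N" "order (G\<lparr>carrier := N\<rparr> Mod L) = p"
    "\<And>x n. x \<in> carrier G \<Longrightarrow> n \<in> N \<Longrightarrow> L #> (x \<otimes> n) = L #> (n \<otimes> x)"
proof -
  let ?Q = "G Mod L"
  interpret L: normal L G by (rule L(1))
  interpret Q: group ?Q by (rule L.factorgroup_is_group)
  obtain k where k: "order G = p ^ k" and finG: "finite (carrier G)"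
    using fin by (auto simp: finite_p_group_def)
  have carrier_Q: "carrier ?Q = (\<lambda>x. L #> x) ` carrier G"
    by (rule carrier_FactGroup)
  have "order ?Q dvd p ^ k"
    using lagrange[OF L.subgroup_axioms] k by (simp add: order_def FactGroup_def) (metis dvd_triv_left)
  then have Qp: "finite_p_group p ?Q"
    using divides_primepow_nat[OF p] finG
    by (auto simp: finite_p_group_def carrier_Q Q.is_group)
  have "carrier ?Q \<noteq> {\<one>\<^bsub>?Q\<^esub>}"
  proof
    assume "carrier ?Q = {\<one>\<^bsub>?Q\<^esub>}"
    then have "L #> x = L" if "x \<in> carrier G" for x
      using that carrier_Q by auto
    then have "carrier G \<subseteq> L" using coset_eq_self_iff[OF L(1)] by blast
    then show False using L(2) L.subset by blast
  qed
  then obtain z where z: "z \<in> carrier ?Q" "Q.ord z = p"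
    "\<And>X. X \<in> carrier ?Q \<Longrightarrow> X \<otimes>\<^bsub>?Q\<^esub> z = z \<otimes>\<^bsub>?Q\<^esub> X"
    using Q.p_group_central_prime_order[OF p Qp] by blast
  let ?Z = "generate ?Q {z}"
  have Z: "subgroup ?Z ?Q" using z(1) by (simp add: Q.generate_is_subgroup)
  have comm: "X \<otimes>\<^bsub>?Q\<^esub> Y = Y \<otimes>\<^bsub>?Q\<^esub> X" if X: "X \<in> carrier ?Q" and Y: "Y \<in> ?Z" for X Y
  proof -
    obtain n :: nat where "Y = z [^]\<^bsub>?Q\<^esub> n"
      using Y Q.generate_pow_on_finite_carrier[OF _ z(1)] Qp by (auto simp: finite_p_group_def)
    then show ?thesis
      using Q.group_commutes_pow[of z X n] z X by simp
  qed
  define N where "N = {x \<in> carrier G. L #> x \<in> ?Z}"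
  have sub: "subgroup N G"
  proof (rule subgroupI)
    show "N \<noteq> {}" using subgroup.one_closed[OF Z] coset_mult_one[OF L.subset] by (auto simp: N_def)
    show "inv x \<in> N" if "x \<in> N" for x
      using that subgroup.m_inv_closed[OF Z, of "L #> x"]
      by (auto simp: N_def L.inv_FactGroup L.rcos_inv carrier_Q)
    show "x \<otimes> y \<in> N" if "x \<in> N" "y \<in> N" for x y
      using that subgroup.m_closed[OF Z, of "L #> x" "L #> y"] by (auto simp: N_def L.rcos_sum)
  qed (auto simp: N_def)
  have LN: "L \<subseteq> N"
    using subgroup.one_closed[OF Z] L.subset L.rcos_const[OF is_group] by (auto simp: N_def)
  have cent: "L #> (x \<otimes> n) = L #> (n \<otimes> x)" if "x \<in> carrier G" "n \<in> N" for x n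
    using comm[of "L #> x" "L #> n"] that by (auto simp: N_def carrier_Q L.rcos_sum)
  have NG: "N \<lhd> G"
  proof (rule normal_invI[OF sub])
    fix x n assume xn: "x \<in> carrier G" "n \<in> N"
    then have n: "n \<in> carrier G" by (simp add: N_def)
    have "L #> (x \<otimes> n \<otimes> inv x) = L #> (n \<otimes> x \<otimes> inv x)"
      using xn n by (intro coset_mult_cong[OF L(1) cent HOL.refl]) auto
    also have "\<dots> = L #> n" using xn n by (simp add: m_assoc)
    finally show "x \<otimes> n \<otimes> inv x \<in> N" using xn n by (simp add: N_def)
  qed
  have carr: "carrier (G\<lparr>carrier := N\<rparr> Mod L) = ?Z"
    using subgroup.subset[OF Z] by (auto simp: carrier_subgroup_quotient N_def carrier_Q)
  then have ord: "order (G\<lparr>carrier := N\<rparr> Mod L) = p"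
    using Q.generate_pow_card[OF z(1)] z(2) by (simp add: order_def)
  have "L \<noteq> N"
  proof
    assume "L = N"
    then have "carrier (G\<lparr>carrier := N\<rparr> Mod L) = {L}"
      using L.rcos_const[OF is_group] L.one_closed by (auto simp: carrier_subgroup_quotient)
    then show False using ord prime_gt_1_nat[OF p] by (simp add: order_def)
  qed
  with NG LN ord cent that show thesis by blast
qed

text \<open>For any other prime divisor \<open>q\<close> of the order, Sylow's theorem with exponent
  \<open>1\<close> gives a subgroup of order \<open>q\<close>; the order of its non-trivial elements
  would divide both \<open>q\<close> and \<open>p ^ m\<close>.\<close>

lemma (in group) finite_p_groupI:
  assumes p: "prime p" and fin: "finite (carrier G)"
    and pow: "\<And>x. x \<in> carrier G \<Longrightarrow> x [^] (p ^ m) = \<one>"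
  shows "finite_p_group p G"
proof -
  have only_p: "q = p" if q: "prime q" "q dvd order G" for q
  proof (rule ccontr)
    assume "q \<noteq> p"
    obtain r where "order G = q ^ 1 * r" using q(2) by auto
    then obtain H where H: "subgroup H G" "card H = q"
      using sylow_thm[OF q(1) is_group, of 1 r] fin by auto
    have "H \<noteq> {\<one>}" using H(2) q(1) not_prime_1 by auto
    then obtain x where x: "x \<in> H" "x \<noteq> \<one>" using subgroup.one_closed[OF H(1)] by auto
    interpret H: group "G\<lparr>carrier := H\<rparr>" using H(1) by (rule subgroup_imp_group)
    have xG: "x \<in> carrier G" using H(1) x(1) by (rule subgroup.mem_carrier)
    have "x [^] q = \<one>"
      using H.pow_order_eq_1[of x] x(1) H(2) by (simp add: order_def nat_pow_consistent[symmetric])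
    then have "ord x dvd q" "ord x dvd p ^ m" using pow xG by (simp_all add: pow_eq_id)
    moreover have "coprime q (p ^ m)" using p q(1) \<open>q \<noteq> p\<close> by (simp add: primes_coprime)
    ultimately have "ord x = 1" by (metis coprime_common_divisor_nat)
    then show False using xG x(2) ord_eq_1 by simp
  qed
  have "order G \<noteq> 0" using fin by (simp add: order_gt_0_iff_finite[symmetric])
  then obtain r where r: "order G = p ^ multiplicity p (order G) * r" "\<not> p dvd r"
    using multiplicity_decompose'[of "order G" p] p not_prime_unit by blast
  have "r = 1"
  proof (rule ccontr)
    assume "r \<noteq> 1"
    then obtain q where q: "prime q" "q dvd r" using prime_factor_nat by blast
    then have "q dvd order G" using r(1) by (metis dvd_mult)
    then show False using only_p q r(2) by auto
  qed
  then show ?thesis using r(1) fin is_group by (auto simp: finite_p_group_def)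
qed

text \<open>Think of \<open>\<Union>(Rel l)\<close> as a descending sequence of equivalence relations, and of the members of
  \<open>Rel l\<close> as the translations of the classes of one relation modulo the next. The permutations that
  respect all translations form an iterated wreath product of abelian groups.\<close>

locale translation_tower =
  fixes \<Omega> :: "'s set" and Rel :: "nat \<Rightarrow> ('s \<times> 's) set set" and m p e :: nat
  assumes prime: "prime p" and finite_space: "finite \<Omega>"
    and top: "s \<in> \<Omega> \<Longrightarrow> s' \<in> \<Omega> \<Longrightarrow> \<exists>r\<in>Rel 0. (s, s') \<in> r"
    and iterate: "l < m \<Longrightarrow> r \<in> Rel l \<Longrightarrow> (\<And>i. f i \<in> \<Omega>) \<Longrightarrow> (\<And>i. (f i, f (Suc i)) \<in> r) \<Longrightarrow>
      \<exists>r'\<in>Rel (Suc l). (f 0, f (p ^ e)) \<in> r'"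
    and bottom: "r \<in> Rel m \<Longrightarrow> s \<in> \<Omega> \<Longrightarrow> s' \<in> \<Omega> \<Longrightarrow> (s, s') \<in> r \<Longrightarrow> s = s'"
begin

definition respecting :: "('s \<Rightarrow> 's) set" where
  "respecting = {T. T permutes \<Omega> \<and>
     (\<forall>l<m. \<forall>r\<in>Rel l. \<forall>s\<in>\<Omega>. \<forall>s'\<in>\<Omega>. (s, s') \<in> r \<longrightarrow> (T s, T s') \<in> r)}"

lemma respecting_permutes: "T \<in> respecting \<Longrightarrow> T permutes \<Omega>"
  by (simp add: respecting_def)

lemma respectingD:
  "T \<in> respecting \<Longrightarrow> l < m \<Longrightarrow> r \<in> Rel l \<Longrightarrow> s \<in> \<Omega> \<Longrightarrow> s' \<in> \<Omega> \<Longrightarrow> (s, s') \<in> r \<Longrightarrow> (T s, T s') \<in> r"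
  by (simp add: respecting_def)

lemma respecting_comp: "S \<in> respecting \<Longrightarrow> T \<in> respecting \<Longrightarrow> S \<circ> T \<in> respecting"
  by (auto simp: respecting_def permutes_compose permutes_in_image)

lemma respecting_id: "id \<in> respecting"
  by (auto simp: respecting_def permutes_id)

lemma respecting_funpow: "T \<in> respecting \<Longrightarrow> T ^^ k \<in> respecting"
  by (induction k) (auto simp: respecting_id respecting_comp id_def[symmetric])

text \<open>By induction, \<open>T ^^ ((p ^ e) ^ j)\<close> moves each point by some relation of
  level \<open>j\<close>. As it respects that relation, it repeats the same translation along the
  orbit of the point, so \<open>iterate\<close> applies to \<open>p ^ e\<close> steps of it.\<close>

lemma exponent:
  assumes T: "T \<in> respecting"
  shows "T ^^ ((p ^ e) ^ m) = id"
proof -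
  have pow: "(T ^^ k) s \<in> \<Omega>" if "s \<in> \<Omega>" for k s
    using permutes_in_image[OF respecting_permutes[OF respecting_funpow[OF T]]] that by simp
  have step: "\<exists>r\<in>Rel j. (s, (T ^^ ((p ^ e) ^ j)) s) \<in> r" if "j \<le> m" "s \<in> \<Omega>" for j s
    using that
  proof (induction j)
    case 0
    then show ?case using top pow by blast
  next
    case (Suc j)
    let ?S = "T ^^ ((p ^ e) ^ j)"
    obtain r where r: "r \<in> Rel j" "(s, ?S s) \<in> r" using Suc by auto
    have f: "(?S ^^ i) s \<in> \<Omega>" for i
      using pow[OF Suc.prems(2)] by (simp add: funpow_mult)
    have "((?S ^^ i) s, (?S ^^ Suc i) s) \<in> r" for i
    proof (induction i)
      case 0
      then show ?case using r by simp
    next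
      case (Suc i)
      then show ?case
        using respectingD[OF respecting_funpow[OF T] _ r(1) f[of i] f[of "Suc i"]] \<open>Suc j \<le> m\<close>
        by simp
    qed
    from iterate[where f = "\<lambda>i. (?S ^^ i) s", OF _ r(1) f this] Suc.prems(1)
    have "\<exists>r'\<in>Rel (Suc j). ((?S ^^ 0) s, (?S ^^ (p ^ e)) s) \<in> r'" by simp
    then show ?case by (simp add: funpow_mult mult.commute)
  qed
  have "(T ^^ ((p ^ e) ^ m)) s = s" if "s \<in> \<Omega>" for s
    using step[OF order.refl that] bottom pow that by metis
  moreover have "(T ^^ ((p ^ e) ^ m)) s = s" if "s \<notin> \<Omega>" for s
    using permutes_not_in[OF respecting_permutes[OF respecting_funpow[OF T]] that] .
  ultimately show ?thesis by (metis eq_id_iff)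
qed

text \<open>Respecting is a one-way implication and says nothing about inverses; by
  \<open>exponent\<close> the inverse is a power with natural exponent.\<close>

lemma subgroup_respecting: "subgroup respecting (permutation_group \<Omega>)"
proof -
  interpret E: group "permutation_group \<Omega>" by (rule group_permutation_group)
  show ?thesis
  proof (rule E.subgroupI)
    show "inv\<^bsub>permutation_group \<Omega>\<^esub> T \<in> respecting" if "T \<in> respecting" for T
    proof -
      let ?k = "(p ^ e) ^ m"
      have "?k > 0" using prime_gt_0_nat[OF prime] by simp
      then have "T ^^ (?k - 1) \<circ> T = id"
        using exponent[OF that] by (metis Suc_diff_1 funpow_Suc_right)
      then have "inv\<^bsub>permutation_group \<Omega>\<^esub> T = T ^^ (?k - 1)"
        using that respecting_permutes respecting_funpow[OF that]
        by (intro E.inv_equality) auto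
      then show ?thesis using respecting_funpow[OF that] by simp
    qed
  qed (use respecting_permutes respecting_id respecting_comp in auto)
qed

lemma respecting_p_group:
  assumes "subgroup I (permutation_group \<Omega>)" "I \<subseteq> respecting"
  shows "finite_p_group p (permutation_group \<Omega>\<lparr>carrier := I\<rparr>)"
proof -
  interpret E: group "permutation_group \<Omega>" by (rule group_permutation_group)
  interpret I: group "permutation_group \<Omega>\<lparr>carrier := I\<rparr>"
    using assms(1) by (rule E.subgroup_imp_group)
  have "I \<subseteq> {f. f permutes \<Omega>}" using subgroup.subset[OF assms(1)] by simp
  then have "finite I" using finite_permutations[OF finite_space] by (rule finite_subset)
  moreover have "T [^]\<^bsub>permutation_group \<Omega>\<lparr>carrier := I\<rparr>\<^esub> (p ^ (e * m)) = \<one>\<^bsub>permutation_group \<Omega>\<^esub>"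
    if "T \<in> I" for T
    using exponent[of T] assms(2) that
    by (auto simp: E.nat_pow_consistent[symmetric] pow_permutation_group power_mult)
  ultimately show ?thesis
    by (intro I.finite_p_groupI[OF prime]) auto
qed

end

lemma residual_quotient:
  fixes E :: "('b, 'n) monoid_scheme"
  assumes "group K" "group E" "F \<in> hom K E" "\<gamma> \<in> carrier K" "F \<gamma> \<noteq> \<one>\<^bsub>E\<^esub>"
    and "finite_p_group p (E\<lparr>carrier := F ` carrier K\<rparr>)"
  shows "\<exists>(P :: ('b, 'n) monoid_scheme) h. finite_p_group p P \<and> h \<in> epi K P \<and> h \<gamma> \<noteq> \<one>\<^bsub>P\<^esub>"
  using assms
  by (intro exI[of _ "E\<lparr>carrier := F ` carrier K\<rparr>"] exI[of _ F]) (auto simp: epi_def hom_def)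

section \<open>Chains of compatible subgroups\<close>

context hnn_data
begin

text \<open>\<open>p_compatible\<close> in a form suited to induction: the chain grows downwards
  from \<open>G\<close>, one bottom term at a time. The equivalence is used through
  \<open>p_compatible_family_eq\<close>.\<close>

inductive p_series :: "nat \<Rightarrow> 'a set \<Rightarrow> bool" for p where
  top: "p_series p (carrier G)"
| step: "p_series p N \<Longrightarrow> M \<lhd> G \<Longrightarrow> compatible A B \<phi> M \<Longrightarrow> M \<subseteq> N \<Longrightarrow>
    order (G\<lparr>carrier := N\<rparr> Mod M) = p \<Longrightarrow>
    (\<And>a. a \<in> A \<Longrightarrow> a \<in> N \<Longrightarrow> \<phi> a \<otimes> inv a \<in> M) \<Longrightarrow> p_series p M"

lemma p_series_normal: "p_series p M \<Longrightarrow> M \<lhd> G"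
  by (induction rule: p_series.induct) (auto intro: normal_invI subgroup_self)

lemma p_series_compatible: "p_series p M \<Longrightarrow> compatible A B \<phi> M"
proof (induction rule: p_series.induct)
  case top
  have "A \<inter> carrier G = A" "B \<inter> carrier G = B" by auto
  then show ?case by (simp add: compatible_def phi_image)
qed

lemma left_coset_eq_iff:
  assumes "M \<lhd> G" "a \<in> A"
  shows "\<phi> a <# M = a <# M \<longleftrightarrow> \<phi> a \<otimes> inv a \<in> M"
  using coset_eq_iff[OF assms(1), of "\<phi> a" a] normal.coset_eq[OF assms(1)] assms(2) by auto

lemma p_series_imp_p_compatible: "p_series p M \<Longrightarrow> p_compatible G A B \<phi> p M"
proof (induction rule: p_series.induct)
  case top
  show ?case
    unfolding p_compatible_def
    using p_series_normal[OF p_series.top] p_series_compatible[OF p_series.top]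
    by (intro exI[of _ 0] exI[of _ "\<lambda>_. carrier G"]) simp
next
  case (step N M)
  obtain n K where K: "K 0 = N" "K n = carrier G" "\<forall>i<n. K i \<subseteq> K (Suc i)"
    "\<forall>i\<le>n. compatible A B \<phi> (K i) \<and> K i \<lhd> G"
    "\<forall>i<n. order (G\<lparr>carrier := K (Suc i)\<rparr> Mod K i) = p \<and>
       (\<forall>a\<in>A \<inter> K (Suc i). \<phi> a <# K i = a <# K i)"
    using step.IH unfolding p_compatible_def by blast
  define K' where "K' i = (case i of 0 \<Rightarrow> M | Suc j \<Rightarrow> K j)" for i
  have K': "K' 0 = M" "K' (Suc i) = K i" for i by (simp_all add: K'_def)
  show ?case
    unfolding p_compatible_def
  proof (intro exI[of _ "Suc n"] exI[of _ K'] conjI allI impI)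
    fix i assume "i < Suc n"
    then show "K' i \<subseteq> K' (Suc i)"
      using K(1,3) step.hyps by (cases i) (auto simp: K')
    show "order (G\<lparr>carrier := K' (Suc i)\<rparr> Mod K' i) = p"
      using K(1,5) step.hyps \<open>i < Suc n\<close> by (cases i) (auto simp: K')
    show "\<forall>a\<in>A \<inter> K' (Suc i). \<phi> a <# K' i = a <# K' i"
      using K(1,5) step.hyps \<open>i < Suc n\<close> left_coset_eq_iff[of M] by (cases i) (auto simp: K')
  next
    fix i assume "i \<le> Suc n"
    then show "compatible A B \<phi> (K' i)" "K' i \<lhd> G"
      using K(4) step.hyps by (cases i; simp add: K')+
  qed (use K in \<open>simp_all add: K'\<close>)
qed

lemma p_compatible_imp_p_series:
  assumes "p_compatible G A B \<phi> p M"
  shows "p_series p M"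
proof -
  obtain n K where K: "K 0 = M" "K n = carrier G" "\<forall>i<n. K i \<subseteq> K (Suc i)"
    "\<forall>i\<le>n. compatible A B \<phi> (K i) \<and> K i \<lhd> G"
    "\<forall>i<n. order (G\<lparr>carrier := K (Suc i)\<rparr> Mod K i) = p \<and>
       (\<forall>a\<in>A \<inter> K (Suc i). \<phi> a <# K i = a <# K i)"
    using assms unfolding p_compatible_def by blast
  have "p_series p (K (n - j))" if "j \<le> n" for j
    using that
  proof (induction j)
    case 0
    then show ?case using K(2) p_series.top by simp
  next
    case (Suc j)
    then have i: "n - Suc j < n" "Suc (n - Suc j) = n - j" by auto
    show ?case
    proof (rule p_series.step)
      show "p_series p (K (n - j))" using Suc by simp
      show "K (n - Suc j) \<lhd> G" "compatible A B \<phi> (K (n - Suc j))"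
        using K(4) i(1) by simp_all
      then show "\<phi> a \<otimes> inv a \<in> K (n - Suc j)" if "a \<in> A" "a \<in> K (n - j)" for a
        using K(5) i that left_coset_eq_iff by (metis IntI)
    qed (use K(3,5) i in metis)+
  qed
  from this[of n] show ?thesis using K(1) by simp
qed

lemma p_compatible_family_eq: "p_compatible_family G A B \<phi> p = {M. p_series p M}"
  using p_series_imp_p_compatible p_compatible_imp_p_series normal_imp_subgroup[OF p_series_normal]
  by (auto simp: p_compatible_family_def)

text \<open>Neighbouring terms of an intersected or pulled back chain may coincide; such a step is
  skipped.\<close>

lemma p_series_weak_step:
  assumes "prime p" "p_series p N" "M \<lhd> G" "compatible A B \<phi> M" "M \<subseteq> N" "group Q" "order Q = p"
    and "f \<in> hom (G\<lparr>carrier := N\<rparr>) Q" "\<And>x. x \<in> N \<Longrightarrow> f x = \<one>\<^bsub>Q\<^esub> \<longleftrightarrow> x \<in> M"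
    and "\<And>a. a \<in> A \<Longrightarrow> a \<in> N \<Longrightarrow> \<phi> a \<otimes> inv a \<in> M"
  shows "p_series p M"
  using quotient_index_1_or_prime[OF assms(1,3) p_series_normal[OF assms(2)] assms(5-9)]
    p_series.step[OF assms(2-5) _ assms(10)] assms(2) by auto

text \<open>The chain above \<open>M\<close> is intersected with \<open>K\<close>. It climbs from
  \<open>M \<inter> K\<close> to \<open>carrier G \<inter> K = K\<close>, where the chain of
  \<open>K\<close> takes over.\<close>

lemma p_series_inter:
  assumes "prime p" "p_series p M" "p_series p K"
  shows "p_series p (M \<inter> K)"
  using assms(2)
proof (induction rule: p_series.induct)
  case top
  have "carrier G \<inter> K = K"
    using p_series_normal[OF assms(3)] normal_imp_subgroup subgroup.subset by blast
  then show ?case using assms(3) by simp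
next
  case (step N M)
  let ?Q = "G\<lparr>carrier := N\<rparr> Mod M"
  have N: "subgroup N G"
    using p_series_normal[OF step.hyps(1)] by (rule normal_imp_subgroup)
  have K: "K \<lhd> G" "compatible A B \<phi> K"
    using assms(3) p_series_normal p_series_compatible by auto
  have M: "M \<lhd> G\<lparr>carrier := N\<rparr>"
    using normal_restrict_supergroup[OF N step.hyps(2,4)] .
  have carr: "x \<in> carrier G" if "x \<in> N" for x
    using N that by (rule subgroup.mem_carrier)
  show ?case
  proof (rule p_series_weak_step[OF assms(1) step.IH])
    show "M \<inter> K \<lhd> G" using step.hyps(2) K(1) by (rule normal_subgroup_intersect)
    show "compatible A B \<phi> (M \<inter> K)"
    proof -
      have "\<phi> ` (A \<inter> (M \<inter> K)) = \<phi> ` ((A \<inter> M) \<inter> (A \<inter> K))" by (rule arg_cong) auto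
      also have "\<dots> = \<phi> ` (A \<inter> M) \<inter> \<phi> ` (A \<inter> K)"
        using phi_inj by (intro inj_on_image_Int) auto
      finally show ?thesis using step.hyps(3) K(2) by (auto simp: compatible_def)
    qed
    show "M \<inter> K \<subseteq> N \<inter> K" using step.hyps(4) by auto
    show "group ?Q" using M by (rule normal.factorgroup_is_group)
    show "order ?Q = p" by (rule step.hyps(5))
    show "(\<lambda>x. M #> x) \<in> hom (G\<lparr>carrier := N \<inter> K\<rparr>) ?Q"
      by (auto simp: hom_def carrier_subgroup_quotient
        normal.rcos_sum[OF step.hyps(2)] carr)
    show "M #> x = \<one>\<^bsub>?Q\<^esub> \<longleftrightarrow> x \<in> M \<inter> K" if "x \<in> N \<inter> K" for x
      using that coset_eq_self_iff[OF step.hyps(2)] carr by auto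
    show "\<phi> a \<otimes> inv a \<in> M \<inter> K" if "a \<in> A" "a \<in> N \<inter> K" for a
    proof -
      have "\<phi> a \<in> K" using K(2) that by (auto simp: compatible_def)
      then have "\<phi> a \<otimes> inv a \<in> K"
        using normal_imp_subgroup[OF K(1)] that by (auto intro: subgroup.m_closed subgroup.m_inv_closed)
      then show ?thesis using step.hyps(6) that by auto
    qed
  qed
qed

text \<open>A central series of a finite \<open>p\<close>-quotient of the HNN-extension restricts to \<open>G\<close>:
  conjugation by \<open>t\<close> preserves its terms and acts trivially on its factors.\<close>

lemma p_series_preimage:
  fixes P :: "('c, 'n) monoid_scheme"
  assumes p: "prime p" and fin: "finite_p_group p P" and h: "h \<in> hom \<Gamma> P" and L: "L \<lhd> P"
  shows "p_series p {g \<in> carrier G. h (base g) \<in> L}"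
  using L
\<comment> \<open>The induction climbs: it passes from \<open>L\<close> to the next term
  \<open>N\<close> of a central series and ends at \<open>L = carrier P\<close>.\<close>
proof (induction "order P - card L" arbitrary: L rule: less_induct)
  case (less L)
  interpret P: group P using fin by (simp add: finite_p_group_def)
  have finP: "finite (carrier P)" using fin by (simp add: finite_p_group_def)
  have sub: "subgroup L P" if "L \<lhd> P" for L using that by (rule normal_imp_subgroup)
  have h_closed: "h (base g) \<in> carrier P" if "g \<in> carrier G" for g
    using h that by (auto simp: hom_def)
  have h_mult: "h (base (x \<otimes> y)) = h (base x) \<otimes>\<^bsub>P\<^esub> h (base y)" if "x \<in> carrier G" "y \<in> carrier G" for x y
    using that by (simp add: base_mult hom_mult[OF h])
  have h_one: "h (base \<one>) = \<one>\<^bsub>P\<^esub>" using hom_one[OF h \<Gamma>.is_group P.is_group] by (simp add: base_one)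
  have h_inv: "h (base (inv x)) = inv\<^bsub>P\<^esub> h (base x)" if "x \<in> carrier G" for x
    using h_mult[of "inv x" x] that h_one h_closed by (intro P.inv_equality[symmetric]) auto
  let ?pre = "\<lambda>L. {g \<in> carrier G. h (base g) \<in> L}"
  have pre_normal: "?pre L \<lhd> G" if "L \<lhd> P" for L
  proof (rule normal_invI)
    show "subgroup (?pre L) G"
      using subgroup.one_closed[OF sub[OF that]] subgroup.m_closed[OF sub[OF that]]
        subgroup.m_inv_closed[OF sub[OF that]]
      by (intro subgroupI) (auto simp: h_one h_mult h_inv intro!: exI[of _ \<one>])
    show "x \<otimes> g \<otimes> inv x \<in> ?pre L" if "x \<in> carrier G" "g \<in> ?pre L" for x g
      using that normal.inv_op_closed2[OF \<open>L \<lhd> P\<close>, of "h (base x)" "h (base g)"]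
      by (auto simp: h_mult h_inv h_closed)
  qed
  let ?t = "h stable"
  have t: "?t \<in> carrier P" using h by (auto simp: hom_def)
  have conj: "h (base a) = ?t \<otimes>\<^bsub>P\<^esub> h (base (\<phi> a)) \<otimes>\<^bsub>P\<^esub> inv\<^bsub>P\<^esub> ?t"
    and conj': "h (base (\<phi> a)) = inv\<^bsub>P\<^esub> ?t \<otimes>\<^bsub>P\<^esub> h (base a) \<otimes>\<^bsub>P\<^esub> ?t" if "a \<in> A" for a
  proof -
    have "h (base a) \<otimes>\<^bsub>P\<^esub> ?t = ?t \<otimes>\<^bsub>P\<^esub> h (base (\<phi> a))"
      using arg_cong[OF base_stable[OF that], of h] that by (simp add: hom_mult[OF h])
    note eq = this
    show "h (base a) = ?t \<otimes>\<^bsub>P\<^esub> h (base (\<phi> a)) \<otimes>\<^bsub>P\<^esub> inv\<^bsub>P\<^esub> ?t"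
      unfolding eq[symmetric] using t h_closed[of a] that by (simp add: P.m_assoc)
    have "inv\<^bsub>P\<^esub> ?t \<otimes>\<^bsub>P\<^esub> h (base a) \<otimes>\<^bsub>P\<^esub> ?t = inv\<^bsub>P\<^esub> ?t \<otimes>\<^bsub>P\<^esub> (h (base a) \<otimes>\<^bsub>P\<^esub> ?t)"
      using t h_closed[of a] that by (simp add: P.m_assoc)
    also have "\<dots> = h (base (\<phi> a))"
      unfolding eq using t h_closed[of "\<phi> a"] that by (simp add: P.m_assoc[symmetric])
    finally show "h (base (\<phi> a)) = inv\<^bsub>P\<^esub> ?t \<otimes>\<^bsub>P\<^esub> h (base a) \<otimes>\<^bsub>P\<^esub> ?t"
      by simp
  qed
  have pre_compatible: "compatible A B \<phi> (?pre L)" if L: "L \<lhd> P" for L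
  proof -
    have "h (base (\<phi> a)) \<in> L \<longleftrightarrow> h (base a) \<in> L" if "a \<in> A" for a
      using conj[OF that] conj'[OF that] normal.inv_op_closed1[OF L t] normal.inv_op_closed2[OF L t]
      by metis
    then show ?thesis
      using phi_image by (auto simp: compatible_def)
  qed
  show ?case
  proof (cases "L = carrier P")
    case True
    then have "?pre L = carrier G" using h_closed by auto
    then show ?thesis using p_series.top by simp
  next
    case False
    obtain N where N: "N \<lhd> P" "L \<subset> N" "order (P\<lparr>carrier := N\<rparr> Mod L) = p"
      "\<And>x n. x \<in> carrier P \<Longrightarrow> n \<in> N \<Longrightarrow> L #>\<^bsub>P\<^esub> (x \<otimes>\<^bsub>P\<^esub> n) = L #>\<^bsub>P\<^esub> (n \<otimes>\<^bsub>P\<^esub> x)"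
      using P.p_group_central_step[OF p fin less.prems False] by blast
    let ?Q = "P\<lparr>carrier := N\<rparr> Mod L"
    have LN: "L \<lhd> P\<lparr>carrier := N\<rparr>"
      using P.normal_restrict_supergroup[OF sub[OF N(1)] less.prems] N(2) by auto
    have "card L < card N" "card N \<le> order P"
      using N(2) finP subgroup.subset[OF sub[OF N(1)]]
      by (auto simp: order_def intro!: psubset_card_mono card_mono finite_subset[OF _ finP])
    then have IH: "p_series p (?pre N)" using less.hyps[of N] N(1) by simp
    show ?thesis
    proof (rule p_series_weak_step[OF p IH pre_normal[OF less.prems] pre_compatible[OF less.prems]])
      show "?pre L \<subseteq> ?pre N" using N(2) by auto
      show "group ?Q" using LN by (rule normal.factorgroup_is_group)
      show "order ?Q = p" by (rule N(3))
      show "(\<lambda>x. L #>\<^bsub>P\<^esub> h (base x)) \<in> hom (G\<lparr>carrier := ?pre N\<rparr>) ?Q"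
        by (auto simp: hom_def P.carrier_subgroup_quotient h_mult normal.rcos_sum[OF less.prems] h_closed)
      show "L #>\<^bsub>P\<^esub> h (base x) = \<one>\<^bsub>?Q\<^esub> \<longleftrightarrow> x \<in> ?pre L" if "x \<in> ?pre N" for x
        using that P.coset_eq_self_iff[OF less.prems] h_closed by auto
      show "\<phi> a \<otimes> inv a \<in> ?pre L" if "a \<in> A" "a \<in> ?pre N" for a
      proof -
        let ?n = "h (base a)"
        have n: "?n \<in> carrier P" "?n \<in> N" using that h_closed by auto
        have "L #>\<^bsub>P\<^esub> (inv\<^bsub>P\<^esub> ?t \<otimes>\<^bsub>P\<^esub> ?n \<otimes>\<^bsub>P\<^esub> ?t) = L #>\<^bsub>P\<^esub> (?n \<otimes>\<^bsub>P\<^esub> inv\<^bsub>P\<^esub> ?t \<otimes>\<^bsub>P\<^esub> ?t)"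
          using n t by (intro P.coset_mult_cong[OF less.prems N(4) HOL.refl]) auto
        then have "L #>\<^bsub>P\<^esub> h (base (\<phi> a)) = L #>\<^bsub>P\<^esub> ?n"
          using conj'[OF that(1)] n t by (simp add: P.m_assoc)
        then have "h (base (\<phi> a)) \<otimes>\<^bsub>P\<^esub> inv\<^bsub>P\<^esub> ?n \<in> L"
          using P.coset_eq_iff[OF less.prems] h_closed that(1) n by auto
        then show ?thesis using that by (simp add: h_mult h_inv)
      qed
    qed
  qed
qed

end

section \<open>The base group embeds\<close>

context hnn_data
begin

text \<open>The factor \<open>lists (carrier G)\<close> makes the sets of \<open>A\<close>-orbits and of \<open>B\<close>-orbits equipollent, even if
  \<open>A\<close> and \<open>B\<close> have different indices in \<open>G\<close>.\<close>

lemma equivariant_bijection: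
  obtains \<tau> where "\<tau> permutes (carrier G \<times> lists (carrier G))"
    "\<And>a x l. a \<in> A \<Longrightarrow> x \<in> carrier G \<Longrightarrow> l \<in> lists (carrier G) \<Longrightarrow>
      \<tau> (a \<otimes> x, l) = (\<phi> a \<otimes> fst (\<tau> (x, l)), snd (\<tau> (x, l)))"
proof -
  let ?L = "lists (carrier G)"
  define R where "R H = coset_rep H ` carrier G" for H
  have R_carrier: "R H \<subseteq> carrier G" if "subgroup H G" for H
    using coset_rep_closed that by (auto simp: R_def)
  have rep_idem: "coset_rep H r = r" if "subgroup H G" "r \<in> R H" for H r
    using that by (auto simp: R_def coset_rep_idem)
  have rep_prod: "coset_rep H (h \<otimes> r) = r" if "subgroup H G" "r \<in> R H" "h \<in> H" for H h r
    using coset_rep_mult[OF that(1) _ that(3)] rep_idem[OF that(1,2)] R_carrier[OF that(1)] that(2) by auto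
  \<comment> \<open>The representative is stored as a new head of the list, so any number of orbits
    fits over a single one. Schroeder-Bernstein then gives \<open>\<beta>\<close>.\<close>
  have lepoll: "R H \<times> ?L \<lesssim> R K \<times> ?L" if "subgroup H G" "subgroup K G" for H K
  proof -
    have "coset_rep K \<one> \<in> R K" by (simp add: R_def)
    then show ?thesis
      unfolding lepoll_def using R_carrier[OF that(1)]
      by (intro exI[of _ "\<lambda>(r, l). (coset_rep K \<one>, r # l)"]) (auto simp: inj_on_def)
  qed
  obtain \<beta> where \<beta>: "bij_betw \<beta> (R A \<times> ?L) (R B \<times> ?L)"
    using lepoll_antisym[OF lepoll[OF A B] lepoll[OF B A]] by (auto simp: eqpoll_def)
  \<comment> \<open>The factor \<open>x \<otimes> inv (coset_rep A x)\<close> is the element of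
    \<open>A\<close> that carries the representative to \<open>x\<close>; equivariance leaves no
    choice once \<open>\<beta>\<close> has mapped the representatives.\<close>
  define \<tau> where "\<tau> = (\<lambda>(x, l). if x \<in> carrier G \<and> l \<in> ?L
     then (\<phi> (x \<otimes> inv (coset_rep A x)) \<otimes> fst (\<beta> (coset_rep A x, l)), snd (\<beta> (coset_rep A x, l))) else (x, l))"
  have \<tau>: "\<tau> (a \<otimes> r, l) = (\<phi> a \<otimes> fst (\<beta> (r, l)), snd (\<beta> (r, l)))"
    if "a \<in> A" "r \<in> R A" "l \<in> ?L" for a r l
    using that R_carrier[OF A] rep_prod[OF A that(2,1)] by (auto simp: \<tau>_def m_assoc)
  have \<beta>_mem: "fst (\<beta> (r, l)) \<in> R B" "snd (\<beta> (r, l)) \<in> ?L" if "r \<in> R A" "l \<in> ?L" for r l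
    using bij_betwE[OF \<beta>] that by (auto simp: mem_Times_iff)
  have inj: "inj_on \<tau> (carrier G \<times> ?L)"
  proof (rule inj_onI)
    fix s s' assume s: "s \<in> carrier G \<times> ?L" "s' \<in> carrier G \<times> ?L" "\<tau> s = \<tau> s'"
    obtain x l x' l' where xl: "s = (x, l)" "s' = (x', l')" by fastforce
    then have *: "\<tau> (x, l) = \<tau> (x', l')" "x \<in> carrier G" "x' \<in> carrier G"
      and l: "l \<in> ?L" "l' \<in> ?L"
      using s by auto
    obtain a a' where a: "a \<in> A" "x = a \<otimes> coset_rep A x" "a' \<in> A" "x' = a' \<otimes> coset_rep A x'"
      using coset_rep_split[OF A] * by metis
    let ?b = "\<beta> (coset_rep A x, l)" and ?b' = "\<beta> (coset_rep A x', l')"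
    have r: "coset_rep A x \<in> R A" "coset_rep A x' \<in> R A" using * by (auto simp: R_def)
    have eq: "\<phi> a \<otimes> fst ?b = \<phi> a' \<otimes> fst ?b'" "snd ?b = snd ?b'"
      using *(1) \<tau>[OF a(1) r(1) l(1)] \<tau>[OF a(3) r(2) l(2)] a by auto
    have "coset_rep B (\<phi> a \<otimes> fst ?b) = fst ?b" "coset_rep B (\<phi> a' \<otimes> fst ?b') = fst ?b'"
      using rep_prod[OF B] \<beta>_mem r l a by auto
    then have b: "fst ?b = fst ?b'" using eq by simp
    then have "\<phi> a = \<phi> a'"
      using eq(1) \<beta>_mem[OF r(1) l(1)] R_carrier[OF B] a by (metis B_closed phi_mem right_cancel subsetD)
    then have "a = a'" using a phi_inj by (auto dest: inj_onD)
    have "?b = ?b'" using b eq(2) by (simp add: prod_eq_iff)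
    then have "(coset_rep A x, l) = (coset_rep A x', l')"
      using r l \<beta> by (auto simp: bij_betw_def dest: inj_onD)
    with \<open>a = a'\<close> a show "s = s'" using xl by auto
  qed
  have maps: "\<tau> ` (carrier G \<times> ?L) = carrier G \<times> ?L"
  proof
    show "\<tau> ` (carrier G \<times> ?L) \<subseteq> carrier G \<times> ?L"
    proof (intro image_subsetI)
      fix s assume s: "s \<in> carrier G \<times> ?L"
      obtain x l where xl: "s = (x, l)" by force
      then have *: "x \<in> carrier G" and l: "l \<in> ?L" using s by auto
      obtain a where a: "a \<in> A" "x = a \<otimes> coset_rep A x" using coset_rep_split[OF A] * by metis
      have r: "coset_rep A x \<in> R A" using * by (auto simp: R_def)
      have "\<tau> s = (\<phi> a \<otimes> fst (\<beta> (coset_rep A x, l)), snd (\<beta> (coset_rep A x, l)))"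
        using \<tau>[OF a(1) r l] a(2) xl by simp
      then show "\<tau> s \<in> carrier G \<times> ?L"
        using \<beta>_mem[OF r l] R_carrier[OF B] a by (auto simp del: in_lists_conv_set)
    qed
    show "carrier G \<times> ?L \<subseteq> \<tau> ` (carrier G \<times> ?L)"
    proof
      fix s assume "s \<in> carrier G \<times> ?L"
      then obtain y m where s: "s = (y, m)" and y: "y \<in> carrier G" and m: "m \<in> ?L" by blast
      obtain b where b: "b \<in> B" "y = b \<otimes> coset_rep B y" using coset_rep_split[OF B] y by metis
      then obtain a where a: "a \<in> A" "b = \<phi> a" using phi_image by auto
      have "(coset_rep B y, m) \<in> \<beta> ` (R A \<times> ?L)" using y m \<beta> by (simp add: bij_betw_def R_def)
      then obtain s' where s': "s' \<in> R A \<times> ?L" "\<beta> s' = (coset_rep B y, m)" by (metis imageE)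
      obtain r l where "s' = (r, l)" by (cases s')
      then have r: "r \<in> R A" "l \<in> ?L" "\<beta> (r, l) = (coset_rep B y, m)" using s' by auto
      then have "\<tau> (a \<otimes> r, l) = (y, m)" using \<tau>[OF a(1) r(1,2)] a b by simp
      moreover have "a \<otimes> r \<in> carrier G" using a r R_carrier[OF A] by auto
      ultimately show "s \<in> \<tau> ` (carrier G \<times> ?L)"
        using r(2) s by (intro image_eqI[of _ _ "(a \<otimes> r, l)"]) (simp_all del: in_lists_conv_set)
    qed
  qed
  have outside: "\<tau> s = s" if "s \<notin> carrier G \<times> ?L" for s
    using that by (cases s) (auto simp add: \<tau>_def simp del: in_lists_conv_set)
  show thesis
  proof
    show "\<tau> permutes (carrier G \<times> ?L)"
    proof (rule bij_imp_permutes)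
      show "bij_betw \<tau> (carrier G \<times> ?L) (carrier G \<times> ?L)" using inj maps by (simp only: bij_betw_def)
    qed (rule outside)
    fix a x l assume *: "a \<in> A" "x \<in> carrier G" and l: "l \<in> ?L"
    obtain b where b: "b \<in> A" "x = b \<otimes> coset_rep A x" using coset_rep_split[OF A] * by metis
    have r: "coset_rep A x \<in> R A" using * by (auto simp: R_def)
    have "a \<otimes> x = (a \<otimes> b) \<otimes> coset_rep A x" using b * coset_rep_closed[OF A] by (metis A_closed m_assoc)
    then have "\<tau> (a \<otimes> x, l) = (\<phi> (a \<otimes> b) \<otimes> fst (\<beta> (coset_rep A x, l)), snd (\<beta> (coset_rep A x, l)))"
      using \<tau>[OF subgroup.m_closed[OF A *(1) b(1)] r l] by simp
    moreover have "\<tau> (x, l) = (\<phi> b \<otimes> fst (\<beta> (coset_rep A x, l)), snd (\<beta> (coset_rep A x, l)))"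
      using \<tau>[OF b(1) r l] b by simp
    ultimately show "\<tau> (a \<otimes> x, l) = (\<phi> a \<otimes> fst (\<tau> (x, l)), snd (\<tau> (x, l)))"
      using * b \<beta>_mem[OF r l] R_carrier[OF B] by (simp add: phi_mult m_assoc subset_iff)
  qed
qed

text \<open>With composition of functions, \<open>a t = t (\<phi> a)\<close> says that
  \<open>t\<inverse>\<close> intertwines \<open>a\<close> with \<open>\<phi> a\<close>. Hence
  \<open>\<tau>\<close> is the action of \<open>t\<inverse>\<close>, and \<open>stable\<close> goes
  to its inverse.\<close>

lemma hnn_action:
  assumes \<rho>: "\<rho> \<in> hom G (permutation_group S)" and \<tau>: "\<tau> permutes S"
    and comm: "\<And>a s. a \<in> A \<Longrightarrow> s \<in> S \<Longrightarrow> \<tau> (\<rho> a s) = \<rho> (\<phi> a) (\<tau> s)"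
  obtains F where "F \<in> hom \<Gamma> (permutation_group S)"
    "\<And>x. x \<in> carrier G \<Longrightarrow> F (base x) = \<rho> x" "F stable = Hilbert_Choice.inv \<tau>"
proof -
  let ?E = "permutation_group S"
  have perm: "\<rho> x permutes S" if "x \<in> carrier G" for x
    using \<rho> that by (auto simp: hom_def)
  have "\<rho> a \<circ> Hilbert_Choice.inv \<tau> = Hilbert_Choice.inv \<tau> \<circ> \<rho> (\<phi> a)" if a: "a \<in> A" for a
  proof
    fix s
    have "\<tau> (\<rho> a s) = \<rho> (\<phi> a) (\<tau> s)" for s
    proof (cases "s \<in> S")
      case False
      then show ?thesis
        using permutes_not_in[OF perm False] permutes_not_in[OF \<tau> False] a by simp
    qed (rule comm[OF a])
    then show "(\<rho> a \<circ> Hilbert_Choice.inv \<tau>) s = (Hilbert_Choice.inv \<tau> \<circ> \<rho> (\<phi> a)) s"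
      using permutes_inverses[OF \<tau>] by (metis comp_apply)
  qed
  then show thesis
    using hnn_hom[OF group_permutation_group \<rho>, of "Hilbert_Choice.inv \<tau>"] permutes_inv[OF \<tau>] that by auto
qed

text \<open>\<open>G\<close> acts on \<open>?S\<close> by left translation of the first factor,
  where only \<open>\<one>\<close> fixes the point \<open>(\<one>, [])\<close>;
  \<open>equivariant_bijection\<close> extends this to the HNN-extension.\<close>

lemma base_eq_one_iff:
  assumes g: "g \<in> carrier G"
  shows "base g = \<one>\<^bsub>\<Gamma>\<^esub> \<longleftrightarrow> g = \<one>"
proof
  let ?S = "carrier G \<times> lists (carrier G)"
  let ?E = "permutation_group ?S"
  interpret E: group ?E by (rule group_permutation_group)
  obtain \<tau> where \<tau>: "\<tau> permutes ?S"
    "\<And>a x l. a \<in> A \<Longrightarrow> x \<in> carrier G \<Longrightarrow> l \<in> lists (carrier G) \<Longrightarrow>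
      \<tau> (a \<otimes> x, l) = (\<phi> a \<otimes> fst (\<tau> (x, l)), snd (\<tau> (x, l)))"
    using equivariant_bijection by blast
  define \<rho> where "\<rho> x = (\<lambda>(y, l). if y \<in> carrier G \<and> l \<in> lists (carrier G) then (x \<otimes> y, l) else (y, l))" for x
  have \<rho>: "\<rho> x permutes ?S" if "x \<in> carrier G" for x
  proof (rule bij_imp_permutes)
    show "bij_betw (\<rho> x) ?S ?S"
      using that by (intro bij_betw_byWitness[where f' = "\<rho> (inv x)"]) (auto simp: \<rho>_def m_assoc[symmetric] simp del: in_lists_conv_set split: if_splits)
  qed (auto simp: \<rho>_def simp del: in_lists_conv_set split: if_splits)
  have \<rho>_hom: "\<rho> \<in> hom G ?E"
    using \<rho> by (auto simp: hom_def) (auto simp: \<rho>_def fun_eq_iff m_assoc)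
  have mem: "fst (\<tau> s) \<in> carrier G" "snd (\<tau> s) \<in> lists (carrier G)" if "s \<in> ?S" for s
    using permutes_in_image[OF \<tau>(1), of s] that by (simp_all add: mem_Times_iff)
  have "\<tau> (\<rho> a s) = \<rho> (\<phi> a) (\<tau> s)" if "a \<in> A" "s \<in> ?S" for a s
  proof -
    obtain x l where s: "s = (x, l)" by force
    then show ?thesis
      using \<tau>(2)[OF that(1), of x l] mem[OF that(2)] that(2) by (simp add: \<rho>_def split_beta)
  qed
  then obtain F where F: "F \<in> hom \<Gamma> ?E" "\<And>x. x \<in> carrier G \<Longrightarrow> F (base x) = \<rho> x"
    using hnn_action[OF \<rho>_hom \<tau>(1)] by metis
  assume "base g = \<one>\<^bsub>\<Gamma>\<^esub>"
  then have "\<rho> g = id"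
    using F(2)[OF g] hom_one[OF F(1) \<Gamma>.is_group E.is_group] by simp
  then have "\<rho> g (\<one>, []) = (\<one>, [])" by simp
  then show "g = \<one>" using g by (simp add: \<rho>_def)
qed (simp add: base_one)

end

section \<open>Realising \<open>\<phi>\<close> modulo a chain\<close>

locale p_chain = hnn_data +
  fixes p n :: nat and N :: "nat \<Rightarrow> 'a set"
  assumes prime: "prime p" and N_top: "N n = carrier G"
    and N_normal: "i \<le> n \<Longrightarrow> N i \<lhd> G"
    and N_Suc: "i < n \<Longrightarrow> N i \<subseteq> N (Suc i)"
    and N_order: "i < n \<Longrightarrow> order (G\<lparr>carrier := N (Suc i)\<rparr> Mod N i) = p"
    and N_phi: "i < n \<Longrightarrow> a \<in> A \<Longrightarrow> a \<in> N (Suc i) \<Longrightarrow> \<phi> a \<otimes> inv a \<in> N i"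
begin

lemma N_mono: "i \<le> j \<Longrightarrow> j \<le> n \<Longrightarrow> N i \<subseteq> N j"
proof (induction j)
  case (Suc j)
  then show ?case using N_Suc[of j] by (cases "i = Suc j") auto
qed simp

lemma N_closed: "i \<le> n \<Longrightarrow> x \<in> N i \<Longrightarrow> x \<in> carrier G"
  using N_mono[of i n] N_top by auto

lemma N_pow: "i < n \<Longrightarrow> y \<in> N (Suc i) \<Longrightarrow> y [^] p \<in> N i"
  using quotient_order_prime(1)[OF prime N_normal N_normal N_Suc N_order] by simp

lemma N_power_pow: "j \<le> n \<Longrightarrow> g \<in> carrier G \<Longrightarrow> g [^] (p ^ j) \<in> N (n - j)"
proof (induction j)
  case (Suc j)
  then have "(g [^] (p ^ j)) [^] p \<in> N (n - Suc j)"
    using N_pow[of "n - Suc j" "g [^] (p ^ j)"] by (simp add: Suc_diff_Suc)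
  then show ?case using Suc.prems by (simp add: nat_pow_pow mult.commute)
qed (simp add: N_top)

text \<open>\<open>N_power_pow\<close> bounds the order of \<open>g\<close> modulo
  \<open>N i\<close> by a power of \<open>p\<close>, so conjugation by \<open>g\<close> cannot move
  a factor of order \<open>p\<close>. Hence every factor of the chain is central.\<close>

lemma N_central:
  assumes "i < n" "g \<in> carrier G" "y \<in> N (Suc i)"
  shows "N i #> (g \<otimes> y) = N i #> (y \<otimes> g)"
  using assms N_power_pow[of "n - i" g]
  by (intro prime_quotient_central[OF prime N_normal N_normal N_Suc N_order]) auto

lemma coset_N_mono:
  assumes "i \<le> j" "j \<le> n" "N i #> x = N i #> y" "x \<in> carrier G" "y \<in> carrier G"
  shows "N j #> x = N j #> y"
  using coset_eq_mono[OF N_normal N_normal N_mono assms(3-5)] assms(1,2) by simp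

lemma N_top_coset: "x \<in> carrier G \<Longrightarrow> N n #> x = carrier G"
  by (simp only: N_top coset_join2 subgroup_self)

text \<open>Representatives modulo \<open>N i\<close> arise as products of those of
  \<open>N (Suc i)\<close> modulo \<open>N i\<close> and those of \<open>G\<close> modulo
  \<open>N (Suc i)\<close>. The index \<open>n - j\<close> lets the induction descend from
  \<open>N n\<close>.\<close>

lemma finite_cosets: "j \<le> n \<Longrightarrow> finite ((\<lambda>x. N (n - j) #> x) ` carrier G)"
proof (induction j)
  case 0
  have "(\<lambda>x. N n #> x) ` carrier G \<subseteq> {carrier G}" by (auto simp: N_top_coset)
  then show ?case by (simp add: finite_subset)
next
  case (Suc j)
  define i where "i = n - Suc j"
  have i: "i < n" "Suc i = n - j" using Suc.prems by (auto simp: i_def)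
  obtain X where X: "X \<subseteq> carrier G" "finite X"
    "(\<lambda>x. N (Suc i) #> x) ` carrier G = (\<lambda>x. N (Suc i) #> x) ` X"
    using finite_subset_image[of "(\<lambda>x. N (Suc i) #> x) ` carrier G" "\<lambda>x. N (Suc i) #> x" "carrier G"]
      Suc i by auto
  have "finite ((\<lambda>x. N i #> x) ` N (Suc i))"
    using N_order[OF i(1)] prime_gt_0_nat[OF prime]
    by (intro card_ge_0_finite) (simp add: order_def carrier_subgroup_quotient)
  then obtain Y where Y: "Y \<subseteq> N (Suc i)" "finite Y" "(\<lambda>x. N i #> x) ` N (Suc i) = (\<lambda>x. N i #> x) ` Y"
    using finite_subset_image[of "(\<lambda>x. N i #> x) ` N (Suc i)" "\<lambda>x. N i #> x" "N (Suc i)"] by auto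
  have Mi: "N i \<lhd> G" "N (Suc i) \<lhd> G" using N_normal i by auto
  have "(\<lambda>x. N i #> x) ` carrier G \<subseteq> (\<lambda>(y, x). N i #> (y \<otimes> x)) ` (Y \<times> X)"
  proof (rule image_subsetI)
    fix g assume g: "g \<in> carrier G"
    then obtain x where x: "x \<in> X" "N (Suc i) #> g = N (Suc i) #> x" using X(3) by blast
    then have xG: "x \<in> carrier G" using X(1) by auto
    have c: "g \<otimes> inv x \<in> N (Suc i)" using x g xG coset_eq_iff[OF Mi(2)] by auto
    then obtain y where y: "y \<in> Y" "N i #> (g \<otimes> inv x) = N i #> y" using Y(3) by blast
    then have yG: "y \<in> carrier G" using Y(1) N_closed[of "Suc i"] i by auto
    have "N i #> (g \<otimes> inv x \<otimes> x) = N i #> (y \<otimes> x)"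
      using g xG yG by (intro coset_mult_cong[OF Mi(1) y(2) HOL.refl]) auto
    then have "N i #> g = N i #> (y \<otimes> x)" using g xG by (simp add: m_assoc)
    then show "N i #> g \<in> (\<lambda>(y, x). N i #> (y \<otimes> x)) ` (Y \<times> X)"
      using x(1) y(1) by auto
  qed
  from finite_subset[OF this] show ?case
    using X(2) Y(2) by (simp add: i_def)
qed

text \<open>On the regular representation of \<open>G / N 0\<close>, a map with \<open>twist 0 s\<close> realises \<open>\<phi>\<close> as
  conjugation inside a finite \<open>p\<close>-group of permutations.\<close>

definition twist :: "nat \<Rightarrow> ('a \<Rightarrow> 'a) \<Rightarrow> bool" where
  "twist i s \<longleftrightarrow> s \<in> carrier G \<rightarrow> carrier G \<and>
     (\<forall>a\<in>A. \<forall>x\<in>carrier G. N i #> s (a \<otimes> x) = N i #> (\<phi> a \<otimes> s x)) \<and>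
     (\<forall>y\<in>N i. \<forall>x\<in>carrier G. N i #> s (y \<otimes> x) = N i #> s x) \<and>
     (\<forall>j. i \<le> j \<and> j < n \<longrightarrow>
        (\<forall>y\<in>N (Suc j). \<forall>x\<in>carrier G. N j #> s (y \<otimes> x) = N j #> (y \<otimes> s x)))"

text \<open>On each coset of the subgroup \<open>N (Suc i) A\<close> the new map is
  \<open>c a r \<mapsto> c (\<phi> a) (s r)\<close>, where \<open>r\<close> is a representative. The choice of \<open>c\<close> and \<open>a\<close> is irrelevant
  modulo \<open>N i\<close> because \<open>\<phi> a = a\<close> modulo \<open>N i\<close> for \<open>a\<close> in \<open>A \<inter> N (Suc i)\<close>.\<close>

lemma twist_descend:
  assumes i: "i < n" and s: "twist (Suc i) s"
  shows "\<exists>s'. twist i s'"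
proof -
  have Mi: "N i \<lhd> G" "N (Suc i) \<lhd> G" using N_normal i by auto
  have subN: "subgroup (N (Suc i)) G" using Mi(2) by (rule normal_imp_subgroup)
  have NG: "c \<in> carrier G" if "c \<in> N (Suc i)" for c using that N_closed[of "Suc i"] i by simp
  have sG: "s x \<in> carrier G" if "x \<in> carrier G" for x using s that by (auto simp: twist_def)
  have s_phi: "N (Suc i) #> s (a \<otimes> x) = N (Suc i) #> (\<phi> a \<otimes> s x)" if "a \<in> A" "x \<in> carrier G" for a x
    using s that by (auto simp: twist_def)
  have s_N: "N (Suc i) #> s (y \<otimes> x) = N (Suc i) #> s x" if "y \<in> N (Suc i)" "x \<in> carrier G" for x y
    using s that by (auto simp: twist_def)
  have s_chain: "N j #> s (y \<otimes> x) = N j #> (y \<otimes> s x)"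
    if "Suc i \<le> j" "j < n" "y \<in> N (Suc j)" "x \<in> carrier G" for j x y
    using s that by (auto simp: twist_def)
  define S where "S = N (Suc i) <#> A"
  have S: "subgroup S G" unfolding S_def using Mi(2) A by (rule mult_norm_subgroup)
  have S_mem: "c \<otimes> a \<in> S" if "c \<in> N (Suc i)" "a \<in> A" for a c
    using that by (auto simp: S_def set_mult_def)
  have split: "\<exists>c\<in>N (Suc i). \<exists>a\<in>A. x = c \<otimes> a \<otimes> coset_rep S x" if "x \<in> carrier G" for x
    using coset_rep_split[OF S that] by (force simp: S_def set_mult_def)
  define ca where "ca x = (SOME y. fst y \<in> N (Suc i) \<and> snd y \<in> A \<and> x = fst y \<otimes> snd y \<otimes> coset_rep S x)" for x
  have ca: "fst (ca x) \<in> N (Suc i)" "snd (ca x) \<in> A" "x = fst (ca x) \<otimes> snd (ca x) \<otimes> coset_rep S x"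
    if "x \<in> carrier G" for x
  proof -
    have "\<exists>y. fst y \<in> N (Suc i) \<and> snd y \<in> A \<and> x = fst y \<otimes> snd y \<otimes> coset_rep S x"
      using split[OF that] by auto
    from someI_ex[OF this]
    show "fst (ca x) \<in> N (Suc i)" "snd (ca x) \<in> A" "x = fst (ca x) \<otimes> snd (ca x) \<otimes> coset_rep S x"
      unfolding ca_def by blast+
  qed
  define s' where "s' x = fst (ca x) \<otimes> \<phi> (snd (ca x)) \<otimes> s (coset_rep S x)" for x
  have s'_eq: "N i #> s' x = N i #> (c \<otimes> \<phi> a \<otimes> s (coset_rep S x))"
    if x: "x \<in> carrier G" and c: "c \<in> N (Suc i)" and a: "a \<in> A" and eq: "x = c \<otimes> a \<otimes> coset_rep S x" for x c a
  proof -
    let ?c = "fst (ca x)" and ?a = "snd (ca x)" and ?r = "coset_rep S x"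
    note ca = ca[OF x]
    have closed: "?c \<in> carrier G" "?a \<in> carrier G" "c \<in> carrier G" "a \<in> carrier G" "?r \<in> carrier G"
      using ca c a NG coset_rep_closed[OF S x] by auto
    have "?c \<otimes> ?a = c \<otimes> a"
      using ca(3) eq closed by (metis m_closed right_cancel)
    define b where "b = ?a \<otimes> inv a"
    have b: "b \<in> A" using ca a A by (auto simp: b_def intro: subgroup.m_closed subgroup.m_inv_closed)
    have b_eq: "b = inv ?c \<otimes> c"
      using \<open>?c \<otimes> ?a = c \<otimes> a\<close> closed unfolding b_def 
      by (metis inv_closed inv_solve_left inv_solve_right m_assoc m_closed)
    have "b \<in> N (Suc i)"
      unfolding b_eq using ca c subN by (auto intro: subgroup.m_closed subgroup.m_inv_closed)
    then have phi_b: "N i #> \<phi> b = N i #> b"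
      using N_phi[OF i b] coset_eq_iff[OF Mi(1)] b by simp
    have "?a = b \<otimes> a" using closed by (simp add: b_def m_assoc)
    then have phi_a: "\<phi> ?a = \<phi> b \<otimes> \<phi> a" using b a by (simp add: phi_mult)
    have "N i #> (?c \<otimes> \<phi> b) = N i #> (?c \<otimes> b)"
      using closed b by (intro coset_mult_cong[OF Mi(1) HOL.refl phi_b]) auto
    also have "?c \<otimes> b = c" using closed by (simp add: b_eq m_assoc[symmetric])
    finally have "N i #> (?c \<otimes> \<phi> b \<otimes> (\<phi> a \<otimes> s ?r)) = N i #> (c \<otimes> (\<phi> a \<otimes> s ?r))"
      using closed b a sG by (intro coset_mult_cong[OF Mi(1) _ HOL.refl]) auto
    then show ?thesis
      using closed b a sG by (simp add: s'_def phi_a m_assoc)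
  qed
  have s'G: "s' x \<in> carrier G" if "x \<in> carrier G" for x
    using ca[OF that] NG sG coset_rep_closed[OF S that] by (simp add: s'_def)
  \<comment> \<open>Modulo \<open>N (Suc i)\<close> nothing changes, so the conditions on the higher
    factors are inherited from \<open>s\<close>.\<close>
  have s'_s: "N (Suc i) #> s' x = N (Suc i) #> s x" if x: "x \<in> carrier G" for x
  proof -
    let ?c = "fst (ca x)" and ?a = "snd (ca x)" and ?r = "coset_rep S x"
    note ca = ca[OF x]
    have r: "?r \<in> carrier G" using coset_rep_closed[OF S x] .
    have "N (Suc i) #> s x = N (Suc i) #> s (?c \<otimes> (?a \<otimes> ?r))"
      using ca r NG by (metis A_closed m_assoc)
    also have "\<dots> = N (Suc i) #> (\<phi> ?a \<otimes> s ?r)"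
      using ca r by (simp add: s_N s_phi)
    also have "\<dots> = N (Suc i) #> (\<one> \<otimes> (\<phi> ?a \<otimes> s ?r))"
      using ca r sG by simp
    also have "\<dots> = N (Suc i) #> (?c \<otimes> (\<phi> ?a \<otimes> s ?r))"
      using ca NG r sG subN coset_eq_iff[OF Mi(2), of \<one> ?c]
      by (intro coset_mult_cong[OF Mi(2) _ HOL.refl]) (simp_all add: subgroup.m_inv_closed)
    also have "\<dots> = N (Suc i) #> s' x"
      using ca NG r sG by (simp add: s'_def m_assoc)
    finally show ?thesis by simp
  qed
  have s'_phi: "N i #> s' (a \<otimes> x) = N i #> (\<phi> a \<otimes> s' x)" if a: "a \<in> A" and x: "x \<in> carrier G" for a x
  proof -
    let ?c = "fst (ca x)" and ?b = "snd (ca x)" and ?r = "coset_rep S x"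
    note ca = ca[OF x]
    have closed: "?c \<in> carrier G" "?r \<in> carrier G" "s ?r \<in> carrier G"
      using ca NG coset_rep_closed[OF S x] sG by auto
    \<comment> \<open>Moving \<open>a\<close> past \<open>?c\<close> conjugates \<open>?c\<close>,
      which is invisible modulo \<open>N i\<close> because the factor is central.\<close>
    define c where "c = a \<otimes> ?c \<otimes> inv a"
    have c: "c \<in> N (Suc i)"
      using normal.inv_op_closed2[OF Mi(2)] a ca by (simp add: c_def)
    have rep: "coset_rep S (a \<otimes> x) = ?r"
      using coset_rep_mult[OF S x S_mem[OF subgroup.one_closed[OF subN] a]] a by simp
    have c_cent: "N i #> c = N i #> ?c"
    proof -
      have "N i #> (a \<otimes> ?c \<otimes> inv a) = N i #> (?c \<otimes> a \<otimes> inv a)"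
        using a ca closed by (intro coset_mult_cong[OF Mi(1) N_central[OF i] HOL.refl]) auto
      then show ?thesis using a closed by (simp add: c_def m_assoc)
    qed
    have "a \<otimes> x = a \<otimes> (?c \<otimes> ?b \<otimes> ?r)" using ca by simp
    also have "\<dots> = c \<otimes> (a \<otimes> ?b) \<otimes> ?r"
      using a ca closed by (simp add: c_def m_assoc) (simp add: m_assoc[symmetric])
    finally have ax: "a \<otimes> x = c \<otimes> (a \<otimes> ?b) \<otimes> coset_rep S (a \<otimes> x)" unfolding rep .
    have "N i #> s' (a \<otimes> x) = N i #> (c \<otimes> \<phi> (a \<otimes> ?b) \<otimes> s ?r)"
      using s'_eq[OF _ c subgroup.m_closed[OF A a ca(2)] ax] a x unfolding rep by simp
    also have "\<dots> = N i #> (c \<otimes> \<phi> a \<otimes> (\<phi> ?b \<otimes> s ?r))"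
      using a ca closed NG[OF c] by (simp add: phi_mult m_assoc)
    also have "\<dots> = N i #> (?c \<otimes> \<phi> a \<otimes> (\<phi> ?b \<otimes> s ?r))"
      using a ca closed NG[OF c] by (intro coset_mult_cong[OF Mi(1)] c_cent HOL.refl) auto
    also have "\<dots> = N i #> (\<phi> a \<otimes> ?c \<otimes> (\<phi> ?b \<otimes> s ?r))"
      using a ca closed by (intro coset_mult_cong[OF Mi(1)] N_central[OF i, symmetric] HOL.refl) auto
    also have "\<dots> = N i #> (\<phi> a \<otimes> s' x)"
      using a ca closed by (simp add: s'_def m_assoc)
    finally show ?thesis .
  qed
  have s'_N: "N i #> s' (y \<otimes> x) = N i #> (y \<otimes> s' x)" if y: "y \<in> N (Suc i)" and x: "x \<in> carrier G" for y x
  proof -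
    let ?c = "fst (ca x)" and ?b = "snd (ca x)" and ?r = "coset_rep S x"
    note ca = ca[OF x]
    have closed: "?c \<in> carrier G" "?r \<in> carrier G" "s ?r \<in> carrier G" "y \<in> carrier G"
      using ca NG coset_rep_closed[OF S x] sG y by auto
    have rep: "coset_rep S (y \<otimes> x) = ?r"
      using coset_rep_mult[OF S x S_mem[OF y subgroup.one_closed[OF A]]] closed by simp
    have "y \<otimes> x = y \<otimes> (?c \<otimes> ?b \<otimes> ?r)" using ca by simp
    also have "\<dots> = (y \<otimes> ?c) \<otimes> ?b \<otimes> ?r" using closed ca by (simp add: m_assoc)
    finally have yx: "y \<otimes> x = (y \<otimes> ?c) \<otimes> ?b \<otimes> coset_rep S (y \<otimes> x)" unfolding rep .
    have "N i #> s' (y \<otimes> x) = N i #> ((y \<otimes> ?c) \<otimes> \<phi> ?b \<otimes> s ?r)"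
      using s'_eq[OF _ subgroup.m_closed[OF subN y ca(1)] ca(2) yx] x closed unfolding rep by simp
    then show ?thesis using closed ca by (simp add: s'_def m_assoc)
  qed
  have "twist i s'"
    unfolding twist_def
  proof (intro conjI ballI allI impI)
    show "N i #> s' (y \<otimes> x) = N i #> s' x" if y: "y \<in> N i" and x: "x \<in> carrier G" for y x
    proof -
      have "y \<in> N (Suc i)" using y N_Suc[OF i] by auto
      then have "N i #> s' (y \<otimes> x) = N i #> (y \<otimes> s' x)" using x by (rule s'_N)
      also have "\<dots> = N i #> (\<one> \<otimes> s' x)"
        using y x s'G NG[OF \<open>y \<in> N (Suc i)\<close>]
        by (intro coset_mult_cong[OF Mi(1)]) (simp_all add: coset_eq_iff[OF Mi(1)])
      finally show ?thesis using x s'G by simp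
    qed
    show "N j #> s' (y \<otimes> x) = N j #> (y \<otimes> s' x)"
      if j: "i \<le> j \<and> j < n" and y: "y \<in> N (Suc j)" and x: "x \<in> carrier G" for j x y
    proof (cases "j = i")
      case True
      then show ?thesis using s'_N y x by simp
    next
      case False
      then have j: "Suc i \<le> j" "j < n" using j by auto
      have yG: "y \<in> carrier G" using N_closed[of "Suc j"] j y by simp
      have up: "N j #> s' z = N j #> s z" if "z \<in> carrier G" for z
        using that j s'G sG by (intro coset_N_mono[OF j(1) _ s'_s]) auto
      have "N j #> s' (y \<otimes> x) = N j #> (y \<otimes> s x)"
        using up[of "y \<otimes> x"] s_chain[OF j y x] x yG by simp
      also have "\<dots> = N j #> (y \<otimes> s' x)"
        using x yG s'G sG j N_normal[of j] up[OF x] by (intro coset_mult_cong) auto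
      finally show ?thesis .
    qed
  qed (use s'G s'_phi in auto)
  then show ?thesis by blast
qed

lemma twist_exists:
  obtains s where "twist 0 s"
proof -
  have "\<exists>s. twist (n - j) s" if "j \<le> n" for j
    using that
  proof (induction j)
    case 0
    \<comment> \<open>Modulo \<open>N n\<close>, the whole group, there is a single coset, and no
      factor lies above it; so the identity will do.\<close>
    have "twist n (\<lambda>x. x)" by (simp add: twist_def N_top_coset N_closed[OF order.refl])
    then show ?case by auto
  next
    case (Suc j)
    then show ?case using twist_descend[of "n - Suc j"] by (auto simp add: Suc_diff_Suc)
  qed
  from this[of n] that show thesis by auto
qed

end

section \<open>Shears\<close>

text \<open>A unipotent substitute for the Magnus embedding: a point at \<open>x\<close> carries a vector \<open>z\<close> over
  \<open>\<int>/q\<close>, and passing through \<open>x\<close> with sign \<open>\<epsilon>\<close> adds \<open>\<epsilon> z\<^bsub>j-1\<^esub>\<close> to \<open>z\<^bsub>j\<^esub>\<close> whenever \<open>x\<close> lies in the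
  test set \<open>d j\<close>. If consecutive test sets are disjoint, the square of the added nilpotent
  operator vanishes, so that \<open>- \<epsilon>\<close> undoes \<open>\<epsilon>\<close>.\<close>

definition shear :: "int \<Rightarrow> (nat \<Rightarrow> 'a set) \<Rightarrow> int \<Rightarrow> 'a \<Rightarrow> (nat \<Rightarrow> int) \<Rightarrow> nat \<Rightarrow> int" where
  "shear q d \<epsilon> x z j = (if j = 0 then z 0 else (z j + (if x \<in> d j then \<epsilon> * z (j - 1) else 0)) mod q)"

text \<open>The last pair is applied first, in accordance with composition of maps. The start is the
  first unit vector, whose entry \<open>0\<close> is never altered and feeds all others.\<close>

primrec shears :: "int \<Rightarrow> (nat \<Rightarrow> 'a set) \<Rightarrow> (int \<times> 'a) list \<Rightarrow> nat \<Rightarrow> int" where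
  "shears q d [] = (\<lambda>j. if j = 0 then 1 else 0)"
| "shears q d (a # M) = shear q d (fst a) (snd a) (shears q d M)"

lemma shear_cancel:
  assumes "\<And>j. d j \<inter> d (Suc j) = {}" "\<And>j. 0 \<le> z j \<and> z j < q"
  shows "shear q d (- \<epsilon>) x (shear q d \<epsilon> x z) = z"
proof
  fix j
  show "shear q d (- \<epsilon>) x (shear q d \<epsilon> x z) j = z j"
  proof (cases j)
    case (Suc i)
    show ?thesis
    proof (cases "x \<in> d j")
      case True
      then have "x \<notin> d i" using assms(1)[of i] Suc by auto
      then have "shear q d \<epsilon> x z i = z i" using assms(2) by (simp add: shear_def)
      then have "shear q d (- \<epsilon>) x (shear q d \<epsilon> x z) j = ((z j + \<epsilon> * z i) mod q - \<epsilon> * z i) mod q"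
        using True Suc by (simp add: shear_def)
      also have "\<dots> = z j" using assms(2)[of j] by (simp add: mod_diff_left_eq)
      finally show ?thesis .
    qed (use assms(2)[of j] Suc in \<open>simp add: shear_def\<close>)
  qed (simp add: shear_def)
qed

text \<open>The tests are the classes met along \<open>M\<close>, repetitions removed. Then \<open>z\<^bsub>k\<^esub>\<close> is the product of the
  signed lengths of the maximal runs inside one class; these do not vanish since the sign is
  constant on each run. The sets \<open>d'\<close> allow for the tests added later in the induction.\<close>

definition detects :: "('a \<Rightarrow> 'a set) \<Rightarrow> 'a set \<Rightarrow> (int \<times> 'a) list \<Rightarrow> nat \<Rightarrow> (nat \<Rightarrow> 'a set) \<Rightarrow> int \<Rightarrow> int \<Rightarrow> bool" where
  "detects cl X M k d C D \<longleftrightarrow> k \<ge> 1 \<and> d k = cl (snd (hd M)) \<and> fst (hd M) * C * D > 0 \<and>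
    (\<forall>j. d j = {} \<or> d j \<in> cl ` X) \<and> (\<forall>j. d j \<inter> d (Suc j) = {}) \<and> (\<forall>j>k. d j = {}) \<and>
    (\<forall>d' q. (\<forall>j\<le>k. d' j = d j) \<and> (\<forall>j. d' j \<inter> d' (Suc j) = {}) \<and> q > 1 \<longrightarrow>
      shears q d' M k = D mod q \<and> shears q d' M (k - 1) = C mod q \<and> (\<forall>j>k. shears q d' M j = 0))"

text \<open>A pair prepended to \<open>M\<close> acts last. \<open>C\<close> and \<open>D\<close>
  are the entries \<open>k - 1\<close> and \<open>k\<close> before reduction modulo
  \<open>q\<close>. Inside the class \<open>d k\<close> the new pair turns \<open>D\<close> into
  \<open>D + \<epsilon> * C\<close>; since the run keeps its sign, the invariant
  \<open>\<epsilon> * C * D > 0\<close> excludes cancellation. A new class opens the coordinate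
  \<open>Suc k\<close>, and \<open>(C, D)\<close> becomes
  \<open>(D, \<epsilon> * D)\<close>.\<close>

lemma shears_detect_aux:
  fixes cl :: "'a \<Rightarrow> 'a set"
  assumes cl: "\<forall>x\<in>X. x \<in> cl x"
    and disjoint: "\<forall>x\<in>X. \<forall>y\<in>X. cl x \<noteq> cl y \<longrightarrow> cl x \<inter> cl y = {}"
    and "M \<noteq> []" "set M \<subseteq> {1, -1} \<times> X"
    and "successively (\<lambda>a b. fst a \<noteq> fst b \<longrightarrow> cl (snd a) \<noteq> cl (snd b)) M"
  shows "\<exists>k d C D. detects cl X M k d C D"
  using assms(3-5)
proof (induction M)
  case (Cons a M)
  obtain \<epsilon> x where a: "a = (\<epsilon>, x)" by force
  have \<epsilon>: "\<epsilon> = 1 \<or> \<epsilon> = -1" and x: "x \<in> X" using Cons.prems a by auto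
  show ?case
  proof (cases M)
    case Nil
    \<comment> \<open>Entry \<open>0\<close> always holds \<open>1\<close>; hence the first run
      lives at \<open>k = 1\<close> with \<open>C = 1\<close>.\<close>
    let ?d = "(\<lambda>_. {})(1 := cl x)"
    show ?thesis
    proof (rule exI[of _ "1 :: nat"], rule exI[of _ ?d], rule exI[of _ "1 :: int"], rule exI[of _ \<epsilon>], unfold detects_def, intro conjI allI impI)
      show "0 < fst (hd (a # M)) * 1 * \<epsilon>" using a \<epsilon> by auto
    next
      fix d' :: "nat \<Rightarrow> 'a set" and q :: int
      assume *: "(\<forall>j\<le>1. d' j = ?d j) \<and> (\<forall>j. d' j \<inter> d' (Suc j) = {}) \<and> 1 < q"
      then have "d' 1 = cl x" by simp
      moreover have "d' 1 \<inter> d' 2 = {}" using * by (metis Suc_1)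
      ultimately have "x \<in> d' 1" "x \<notin> d' 2" using bspec[OF cl x] by auto
      then show "shears q d' (a # M) 1 = \<epsilon> mod q" "shears q d' (a # M) (1 - 1) = 1 mod q"
        using * a Nil by (simp_all add: shear_def)
      show "shears q d' (a # M) j = 0" if "j > 1" for j
        using that a Nil by (simp add: shear_def)
    qed (use a x in auto)
  next
    case (Cons b M')
    obtain \<epsilon>' x' where b: "b = (\<epsilon>', x')" by force
    have x': "x' \<in> X" and adj: "\<epsilon> \<noteq> \<epsilon>' \<longrightarrow> cl x \<noteq> cl x'"
      and succ: "successively (\<lambda>a b. fst a \<noteq> fst b \<longrightarrow> cl (snd a) \<noteq> cl (snd b)) M"
      using Cons.prems Cons a b by auto
    obtain k d C D where "detects cl X M k d C D"
      using Cons.IH succ Cons Cons.prems by auto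
    then have IH: "k \<ge> 1" "d k = cl x'" "\<epsilon>' * C * D > 0"
      "\<And>j. d j = {} \<or> d j \<in> cl ` X" "\<And>j. d j \<inter> d (Suc j) = {}" "\<And>j. j > k \<Longrightarrow> d j = {}"
      and run: "\<And>d' q. \<lbrakk>\<forall>j\<le>k. d' j = d j; \<forall>j. d' j \<inter> d' (Suc j) = {}; q > 1\<rbrakk> \<Longrightarrow>
        shears q d' M k = D mod q \<and> shears q d' M (k - 1) = C mod q \<and> (\<forall>j>k. shears q d' M j = 0)"
      using Cons b unfolding detects_def by simp_all
    show ?thesis
    proof (cases "cl x = cl x'")
      case True
      then have eq: "\<epsilon> = \<epsilon>'" using adj by blast
      show ?thesis
      proof (rule exI[of _ k], rule exI[of _ d], rule exI[of _ C], rule exI[of _ "D + \<epsilon> * C"], unfold detects_def, intro conjI allI impI)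
        have "C \<noteq> 0" using IH(3) by auto
        then have "0 < C * C" by (auto simp: zero_less_mult_iff neq_iff)
        then have "0 < \<epsilon> * C * D + C * C" using IH(3) eq by (intro add_pos_pos) simp_all
        also have "\<epsilon> * C * D + C * C = \<epsilon> * C * (D + \<epsilon> * C)"
          using \<epsilon> by (auto simp: algebra_simps)
        finally show "0 < fst (hd (a # M)) * C * (D + \<epsilon> * C)" using a by simp
      next
        fix d' :: "nat \<Rightarrow> 'a set" and q :: int
        assume *: "(\<forall>j\<le>k. d' j = d j) \<and> (\<forall>j. d' j \<inter> d' (Suc j) = {}) \<and> 1 < q"
        then have z: "shears q d' M k = D mod q" "shears q d' M (k - 1) = C mod q"
          "\<And>j. j > k \<Longrightarrow> shears q d' M j = 0"
          using run by auto
        have x_k: "x \<in> d' k" using * IH(2) True bspec[OF cl x] by auto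
        have "d' (k - 1) \<inter> d' (Suc (k - 1)) = {}" "d' k \<inter> d' (Suc k) = {}" using * by blast+
        moreover have "Suc (k - 1) = k" using IH(1) by simp
        \<comment> \<open>Passing test \<open>k\<close> means failing its neighbours, so entry
          \<open>k - 1\<close> stays \<open>C\<close> and entry \<open>Suc k\<close> stays
          \<open>0\<close>.\<close>
        ultimately have x_n: "x \<notin> d' (k - 1)" "x \<notin> d' (Suc k)" using x_k by (metis disjoint_iff)+
        show "shears q d' (a # M) k = (D + \<epsilon> * C) mod q"
          using a z x_k IH(1) by (simp add: shear_def mod_simps) (metis mod_add_right_eq mod_mult_right_eq)
        show "shears q d' (a # M) (k - 1) = C mod q"
          using a z x_n by (cases "k - 1 = 0") (simp_all add: shear_def)
        show "shears q d' (a # M) j = 0" if "j > k" for j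
        proof (cases "j = Suc k")
          case False
          then have "j - 1 > k" using that by simp
          then show ?thesis using a z(3)[OF that] z(3)[of "j - 1"] that by (simp add: shear_def)
        qed (use a z(3)[OF that] x_n in \<open>simp add: shear_def\<close>)
      qed (use a True IH in auto)
    next
      case False
      let ?d = "d(Suc k := cl x)"
      have disj: "cl x' \<inter> cl x = {}" using disjoint x' x False by metis
      show ?thesis
      proof (rule exI[of _ "Suc k"], rule exI[of _ ?d], rule exI[of _ D], rule exI[of _ "\<epsilon> * D"], unfold detects_def, intro conjI allI impI)
        have "D \<noteq> 0" using IH(3) by auto
        then show "0 < fst (hd (a # M)) * D * (\<epsilon> * D)" using a \<epsilon> by (auto simp: zero_less_mult_iff)
        show "?d j \<inter> ?d (Suc j) = {}" for j
          using disj IH(2) IH(5)[of j] IH(6)[of "Suc j"] by (cases "j = k"; cases "j = Suc k") auto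
        show "?d j = {} \<or> ?d j \<in> cl ` X" for j using IH(4)[of j] x by auto
      next
        fix d' :: "nat \<Rightarrow> 'a set" and q :: int
        assume *: "(\<forall>j\<le>Suc k. d' j = ?d j) \<and> (\<forall>j. d' j \<inter> d' (Suc j) = {}) \<and> 1 < q"
        then have d': "\<forall>j\<le>k. d' j = d j" "d' (Suc k) = cl x" by auto
        then have z: "shears q d' M k = D mod q" "\<And>j. j > k \<Longrightarrow> shears q d' M j = 0"
          using run * by auto
        have "x \<in> d' (Suc k)" "x \<notin> d' k"
          using d' bspec[OF cl x] disj IH(2) by auto
        then show "shears q d' (a # M) (Suc k) = \<epsilon> * D mod q"
          "shears q d' (a # M) (Suc k - 1) = D mod q"
          using a z IH(1) by (simp_all add: shear_def mod_simps)
        show "shears q d' (a # M) j = 0" if "j > Suc k" for j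
          using a that z(2)[of j] z(2)[of "j - 1"] by (simp add: shear_def)
      qed (use a IH in auto)
    qed
  qed
qed simp

text \<open>\<open>d\<close> and \<open>D\<close> are obtained before \<open>q\<close>, so the
  modulus can be chosen afterwards to exceed the absolute value of \<open>D\<close>.\<close>

lemma shears_detect:
  fixes cl :: "'a \<Rightarrow> 'a set"
  assumes "\<forall>x\<in>X. x \<in> cl x"
    and "\<forall>x\<in>X. \<forall>y\<in>X. cl x \<noteq> cl y \<longrightarrow> cl x \<inter> cl y = {}"
    and "M \<noteq> []" "set M \<subseteq> {1, -1} \<times> X"
    and "successively (\<lambda>a b. fst a \<noteq> fst b \<longrightarrow> cl (snd a) \<noteq> cl (snd b)) M"
  obtains k d D where "k \<ge> 1" "D \<noteq> 0" "\<And>j. d j = {} \<or> d j \<in> cl ` X"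
    "\<And>j. d j \<inter> d (Suc j) = {}" "\<And>j. j > k \<Longrightarrow> d j = {}" "\<And>q. q > 1 \<Longrightarrow> shears q d M k = D mod q"
proof -
  obtain k d C D where *: "detects cl X M k d C D"
    using shears_detect_aux[OF assms] by blast
  then have "D \<noteq> 0" by (auto simp: detects_def)
  show thesis
  proof (rule that[of k D d])
    show "shears q d M k = D mod q" if "q > 1" for q
      using * that unfolding detects_def by blast
  qed (use * \<open>D \<noteq> 0\<close> in \<open>simp_all add: detects_def\<close>)
qed

section \<open>The action on the tower\<close>

lemma shear_range: "q > 0 \<Longrightarrow> 0 \<le> z 0 \<Longrightarrow> z 0 < q \<Longrightarrow> shear q d \<epsilon> x z j \<in> {0..<q}"
  by (simp add: shear_def)

locale twisted_chain = p_chain +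
  fixes s :: "'a \<Rightarrow> 'a"
  assumes twist: "twist 0 s"
begin

lemma s_closed: "x \<in> carrier G \<Longrightarrow> s x \<in> carrier G"
  using twist by (auto simp: twist_def)

lemma s_phi: "a \<in> A \<Longrightarrow> x \<in> carrier G \<Longrightarrow> N 0 #> s (a \<otimes> x) = N 0 #> (\<phi> a \<otimes> s x)"
  using twist by (auto simp: twist_def)

lemma s_chain: "i < n \<Longrightarrow> y \<in> N (Suc i) \<Longrightarrow> x \<in> carrier G \<Longrightarrow> N i #> s (y \<otimes> x) = N i #> (y \<otimes> s x)"
  using twist by (auto simp: twist_def)

lemma coset_absorb:
  assumes "i \<le> n" "c \<in> N i" "x \<in> carrier G"
  shows "N i #> (c \<otimes> x) = N i #> x"
  using assms N_closed[OF assms(1,2)] coset_mult_cong[OF N_normal[OF assms(1)], of c \<one> x x]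
    coset_eq_iff[OF N_normal[OF assms(1)], of c \<one>] by simp

lemma s_cong:
  assumes i: "i \<le> n" and xy: "x \<in> carrier G" "y \<in> carrier G" "N i #> x = N i #> y"
  shows "N i #> s x = N i #> s y"
proof -
  define c where "c = x \<otimes> inv y"
  have c: "c \<in> N i" using coset_eq_iff[OF N_normal[OF i]] xy by (simp add: c_def)
  have x: "x = c \<otimes> y" using xy by (simp add: c_def m_assoc)
  show ?thesis
  proof (cases i)
    \<comment> \<open>No factor lies below \<open>N 0\<close>, so \<open>s_chain\<close> gives
      nothing here; this is what the third condition of \<open>twist\<close> is for.\<close>
    case 0
    then show ?thesis using twist c xy x by (auto simp: twist_def)
  next
    case (Suc k)
    have cG: "c \<in> carrier G" using N_closed[OF i c] .
    have "N k #> s x = N k #> (c \<otimes> s y)" using s_chain[of k c y] c xy i Suc x by simp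
    then have "N i #> s x = N i #> (c \<otimes> s y)"
      using Suc i xy cG s_closed by (intro coset_N_mono[of k i]) auto
    then show ?thesis using coset_absorb[OF i c] s_closed xy by simp
  qed
qed

text \<open>Descends the chain: if \<open>x = c \<otimes> y\<close> with \<open>c\<close> in
  \<open>N (Suc i)\<close>, then \<open>s x\<close> is \<open>c \<otimes> s y\<close> modulo
  \<open>N i\<close>, and its equality with \<open>s y\<close> puts \<open>c\<close> into
  \<open>N i\<close>.\<close>

lemma s_inj:
  assumes xy: "x \<in> carrier G" "y \<in> carrier G" "N 0 #> s x = N 0 #> s y"
  shows "N 0 #> x = N 0 #> y"
proof -
  have "N (n - j) #> x = N (n - j) #> y" if "j \<le> n" for j
    using that
  proof (induction j)
    case 0
    then show ?case using xy by (simp add: N_top_coset)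
  next
    case (Suc j)
    define i where "i = n - Suc j"
    have i: "i < n" "n - j = Suc i" using Suc.prems by (auto simp: i_def)
    define c where "c = x \<otimes> inv y"
    have c: "c \<in> N (Suc i)"
      using coset_eq_iff[OF N_normal[of "Suc i"]] xy Suc i by (simp add: c_def)
    have x: "x = c \<otimes> y" using xy by (simp add: c_def m_assoc)
    have cG: "c \<in> carrier G" using N_closed[OF _ c] i by simp
    have Ni: "N i \<lhd> G" using N_normal i by simp
    have "N i #> s y = N i #> s x"
      using coset_N_mono[of 0 i "s x" "s y"] xy(3) s_closed[OF xy(1)] s_closed[OF xy(2)] i by simp
    then have e1: "N i #> (c \<otimes> s y) = N i #> (\<one> \<otimes> s y)"
      using s_chain[OF i(1) c xy(2)] x xy s_closed by simp
    have "N i #> (c \<otimes> s y \<otimes> inv (s y)) = N i #> (\<one> \<otimes> s y \<otimes> inv (s y))"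
      using xy s_closed cG by (intro coset_mult_cong[OF Ni e1 HOL.refl]) auto
    then have e2: "N i #> c = N i #> \<one>" using xy s_closed cG by (simp add: m_assoc)
    have "N i #> (c \<otimes> y) = N i #> (\<one> \<otimes> y)"
      using xy cG by (intro coset_mult_cong[OF Ni e2 HOL.refl]) auto
    then show ?case using x xy by (simp add: i_def)
  qed
  from this[of n] show ?thesis by simp
qed

section \<open>The action on \<open>G / N 0\<close>, with the representatives in \<open>R\<close> as
  points\<close>

abbreviation "r \<equiv> coset_rep (N 0)"
definition R :: "'a set" where "R = r ` carrier G"

lemma subgroup_N0: "subgroup (N 0) G"
  using N_normal[of 0] normal_imp_subgroup by simp

lemma r_closed: "x \<in> carrier G \<Longrightarrow> r x \<in> carrier G"
  using coset_rep_closed[OF subgroup_N0] .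

lemma r_mem: "x \<in> carrier G \<Longrightarrow> r x \<in> R"
  by (simp add: R_def)

lemma R_closed: "x \<in> R \<Longrightarrow> x \<in> carrier G"
  using r_closed by (auto simp: R_def)

lemma r_R: "x \<in> R \<Longrightarrow> r x = x"
  using coset_rep_idem[OF subgroup_N0] by (auto simp: R_def)

lemma N_r: "i \<le> n \<Longrightarrow> x \<in> carrier G \<Longrightarrow> N i #> r x = N i #> x"
  using coset_N_mono[of 0 i "r x" x] coset_rep_eq[OF subgroup_N0] r_closed by simp

lemma r_eq_iff: "x \<in> carrier G \<Longrightarrow> y \<in> carrier G \<Longrightarrow> r x = r y \<longleftrightarrow> N 0 #> x = N 0 #> y"
  using coset_rep_eq[OF subgroup_N0] coset_rep_cong by metis

lemma r_mult:
  assumes "x \<in> carrier G" "g \<in> carrier G"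
  shows "r (g \<otimes> r x) = r (g \<otimes> x)"
proof -
  have "N 0 #> (g \<otimes> r x) = N 0 #> (g \<otimes> x)"
    using assms r_closed
    by (intro coset_mult_cong[OF N_normal HOL.refl coset_rep_eq[OF subgroup_N0]]) auto
  then show ?thesis using assms r_closed by (simp add: r_eq_iff)
qed

lemma r_s: "x \<in> carrier G \<Longrightarrow> r (s (r x)) = r (s x)"
  using r_closed s_closed s_cong[of 0 "r x" x] coset_rep_eq[OF subgroup_N0] by (simp add: r_eq_iff)

lemma finite_R: "finite R"
proof -
  have "finite ((\<lambda>x. N 0 #> x) ` carrier G)" using finite_cosets[of n] by simp
  moreover have "R = (\<lambda>C. SOME y. y \<in> C) ` (\<lambda>x. N 0 #> x) ` carrier G"
    by (simp add: R_def coset_rep_def image_image)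
  ultimately show ?thesis by simp
qed

definition turn :: "'a \<Rightarrow> 'a" where "turn x = r (s x)"

lemma turn_bij: "bij_betw turn R R"
proof -
  have "inj_on turn R"
  proof (rule inj_onI)
    fix x y assume "x \<in> R" "y \<in> R" "turn x = turn y"
    then have "r x = r y"
      using s_inj[of x y] R_closed s_closed by (simp add: turn_def r_eq_iff)
    then show "x = y" using \<open>x \<in> R\<close> \<open>y \<in> R\<close> r_R by metis
  qed
  moreover have "turn ` R \<subseteq> R" using R_closed s_closed r_mem by (auto simp: turn_def)
  ultimately show ?thesis using finite_R by (simp add: bij_betw_def endo_inj_surj)
qed

definition unturn :: "'a \<Rightarrow> 'a" where "unturn = inv_into R turn"

lemma unturn: "x \<in> R \<Longrightarrow> unturn x \<in> R" "x \<in> R \<Longrightarrow> turn (unturn x) = x"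
  using turn_bij bij_betw_imp_surj_on[OF turn_bij]
  by (auto simp: unturn_def intro: inv_into_into f_inv_into_f)

lemma turn_mem: "x \<in> R \<Longrightarrow> turn x \<in> R"
  using turn_bij by (rule bij_betw_apply)

definition A_orbit :: "'a \<Rightarrow> 'a set" where
  "A_orbit x = {r (a \<otimes> x) | a. a \<in> A}"

lemma A_orbit_self: "x \<in> R \<Longrightarrow> x \<in> A_orbit x"
  using subgroup.one_closed[OF A] r_R[of x] R_closed[of x] by (force simp: A_orbit_def)

lemma A_orbit_mult:
  assumes "a \<in> A" "x \<in> carrier G"
  shows "A_orbit (r (a \<otimes> x)) = A_orbit x"
proof -
  have *: "A_orbit (r (a \<otimes> x)) \<subseteq> A_orbit x" if "a \<in> A" "x \<in> carrier G" for a x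
  proof
    fix y assume "y \<in> A_orbit (r (a \<otimes> x))"
    then obtain b where b: "b \<in> A" "y = r (b \<otimes> r (a \<otimes> x))" by (auto simp: A_orbit_def)
    then have "y = r ((b \<otimes> a) \<otimes> x)" using that by (simp add: r_mult m_assoc)
    moreover have "b \<otimes> a \<in> A" using subgroup.m_closed[OF A b(1) that(1)] .
    ultimately show "y \<in> A_orbit x" by (auto simp: A_orbit_def)
  qed
  have "A_orbit x \<subseteq> A_orbit (r (a \<otimes> x))"
  proof
    fix y assume "y \<in> A_orbit x"
    then obtain b where b: "b \<in> A" "y = r (b \<otimes> x)" by (auto simp: A_orbit_def)
    have "y = r ((b \<otimes> inv a) \<otimes> r (a \<otimes> x))"
      using b assms by (simp add: r_mult m_assoc) (simp add: m_assoc[symmetric])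
    moreover have "b \<otimes> inv a \<in> A"
      using b assms A by (simp add: subgroup.m_closed subgroup.m_inv_closed)
    ultimately show "y \<in> A_orbit (r (a \<otimes> x))" by (auto simp: A_orbit_def)
  qed
  with *[OF assms] show ?thesis by auto
qed

lemma A_orbit_disjoint:
  assumes "x \<in> R" "y \<in> R" "A_orbit x \<noteq> A_orbit y"
  shows "A_orbit x \<inter> A_orbit y = {}"
proof (rule ccontr)
  assume "A_orbit x \<inter> A_orbit y \<noteq> {}"
  then obtain a b where "a \<in> A" "b \<in> A" "r (a \<otimes> x) = r (b \<otimes> y)" by (auto simp: A_orbit_def)
  then show False using A_orbit_mult assms R_closed by metis
qed

lemma turn_mult:
  assumes "a \<in> A" "x \<in> R"
  shows "turn (r (a \<otimes> x)) = r (\<phi> a \<otimes> turn x)"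
  using assms R_closed[OF assms(2)] s_closed s_phi by (simp add: turn_def r_s r_mult r_eq_iff)

text \<open>\<open>G / N 0\<close> acts freely on itself, so elements that agree at one point agree
  modulo \<open>N 0\<close>. This carries reducedness over to paths.\<close>

lemma coset_cancel:
  assumes "r (g \<otimes> u) = r (h \<otimes> u)" "u \<in> R" "g \<in> carrier G" "h \<in> H" "H \<subseteq> carrier G"
  shows "g \<in> H <#> N 0"
proof -
  have N0: "N 0 \<lhd> G" using N_normal by simp
  have closed: "u \<in> carrier G" "h \<in> carrier G" using assms R_closed by auto
  have eq: "N 0 #> (g \<otimes> u) = N 0 #> (h \<otimes> u)" using assms(1,3) closed by (simp add: r_eq_iff)
  have "N 0 #> (g \<otimes> u \<otimes> inv u) = N 0 #> (h \<otimes> u \<otimes> inv u)"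
    using assms(3) closed by (intro coset_mult_cong[OF N0 eq HOL.refl]) auto
  then have "g \<otimes> inv h \<in> N 0" using assms(3) closed coset_eq_iff[OF N0] by (simp add: m_assoc)
  then have "inv h \<otimes> (g \<otimes> inv h) \<otimes> h \<in> N 0" using normal.inv_op_closed1[OF N0 closed(2)] by simp
  then have "inv h \<otimes> g \<in> N 0" using assms(3) closed by (simp add: m_assoc)
  moreover have "g = h \<otimes> (inv h \<otimes> g)" using assms(3) closed by (simp add: m_assoc[symmetric])
  ultimately show ?thesis using assms(4) by (auto simp: set_mult_def)
qed

text \<open>The image of the trivial coset under the word, evaluated from the right.\<close>

primrec position :: "'a \<Rightarrow> (bool \<times> 'a) list \<Rightarrow> 'a" where
  "position g [] = r g"
| "position g (a # L) =
     r (g \<otimes> (if fst a then unturn (position (snd a) L) else turn (position (snd a) L)))"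

text \<open>The letter \<open>t\<inverse>\<close> leads from \<open>x\<close> to \<open>turn x\<close> and the letter \<open>t\<close> back from \<open>turn x\<close> to \<open>x\<close>. In both
  cases the trace records \<open>x\<close>.\<close>

primrec trace :: "(bool \<times> 'a) list \<Rightarrow> (int \<times> 'a) list" where
  "trace [] = []"
| "trace (a # L) = (if fst a then (-1, unturn (position (snd a) L)) else (1, position (snd a) L)) # trace L"

lemma position_mem: "g \<in> carrier G \<Longrightarrow> snd ` set L \<subseteq> carrier G \<Longrightarrow> position g L \<in> R"
  by (induction L arbitrary: g) (auto intro!: r_mem m_closed intro: R_closed unturn turn_mem)

lemma trace_mem: "snd ` set L \<subseteq> carrier G \<Longrightarrow> set (trace L) \<subseteq> {1, -1} \<times> R"
  by (induction L) (auto intro!: position_mem unturn)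

text \<open>Suppose two opposite letters in succession pass through one \<open>A\<close>-orbit. Then
  the base element between them acts on the point reached like an element of \<open>A\<close> in the
  case \<open>t\<inverse> g t\<close>, and, transported by \<open>turn_mult\<close>, like an element
  of \<open>B\<close> in the case \<open>t g t\<inverse>\<close>. By \<open>coset_cancel\<close>
  this contradicts the hypothesis.\<close>

lemma trace_reduced:
  assumes "snd ` set L \<subseteq> carrier G"
    and "successively (\<lambda>(e, g) (e', g'). e \<noteq> e' \<longrightarrow> g \<notin> (if e then B else A) <#> N 0) L"
  shows "successively (\<lambda>a b. fst a \<noteq> fst b \<longrightarrow> A_orbit (snd a) \<noteq> A_orbit (snd b)) (trace L)"
  using assms
proof (induction L)
  case (Cons a L)
  show ?case
  proof (cases L)
    case (Cons b L')
    obtain e g e' g' where ab: "a = (e, g)" "b = (e', g')" by force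
    let ?x = "position g' L'"
    have g: "g \<in> carrier G" "g' \<in> carrier G" and L': "snd ` set L' \<subseteq> carrier G"
      using Cons.prems(1) Cons ab by auto
    have x: "?x \<in> R" using position_mem[OF g(2) L'] .
    have red: "e \<noteq> e' \<Longrightarrow> g \<notin> (if e then B else A) <#> N 0"
      using Cons.prems(2) Cons ab by simp
    have IH: "successively (\<lambda>a b. fst a \<noteq> fst b \<longrightarrow> A_orbit (snd a) \<noteq> A_orbit (snd b)) (trace L)"
      using Cons.IH Cons.prems Cons ab by simp
    have key: "A_orbit (snd (hd (trace (a # L)))) \<noteq> A_orbit (snd (hd (trace L)))" if e: "e \<noteq> e'"
    proof (cases e)
      case False
      let ?u = "unturn ?x"
      have u: "?u \<in> R" using unturn x by simp
      have p: "position g L = r (g \<otimes> ?u)" using Cons ab e False by simp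
      have "A_orbit (r (g \<otimes> ?u)) \<noteq> A_orbit ?u"
      proof
        assume "A_orbit (r (g \<otimes> ?u)) = A_orbit ?u"
        then have "r (g \<otimes> ?u) \<in> A_orbit ?u"
          using A_orbit_self[of "r (g \<otimes> ?u)"] r_mem g u R_closed by simp
        then obtain b where b: "b \<in> A" "r (g \<otimes> ?u) = r (b \<otimes> ?u)" by (auto simp: A_orbit_def)
        then have "g \<in> A <#> N 0" using coset_cancel[OF b(2) u g(1) b(1)] by auto
        then show False using red e False by simp
      qed
      then show ?thesis using Cons ab e False p by simp
    next
      case True
      let ?u = "turn ?x"
      have u: "?u \<in> R" using turn_mem x by simp
      have p: "position g L = r (g \<otimes> ?u)" using Cons ab e True by simp
      have v: "r (g \<otimes> ?u) \<in> R" using r_mem g u R_closed by simp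
      have "A_orbit (unturn (r (g \<otimes> ?u))) \<noteq> A_orbit ?x"
      proof
        assume "A_orbit (unturn (r (g \<otimes> ?u))) = A_orbit ?x"
        then have "unturn (r (g \<otimes> ?u)) \<in> A_orbit ?x"
          using A_orbit_self[OF unturn(1)[OF v]] by simp
        then obtain b where b: "b \<in> A" "unturn (r (g \<otimes> ?u)) = r (b \<otimes> ?x)" by (auto simp: A_orbit_def)
        then have "r (g \<otimes> ?u) = r (\<phi> b \<otimes> ?u)"
          using unturn(2)[OF v] turn_mult[OF b(1) x] by simp
        then have "g \<in> B <#> N 0" using coset_cancel[OF _ u g(1) phi_mem[OF b(1)]] by auto
        then show False using red e True by simp
      qed
      then show ?thesis using Cons ab e True p by simp
    qed
    have "fst (hd (trace (a # L))) = (if e then -1 else 1)" "fst (hd (trace L)) = (if e' then -1 else 1)"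
      using Cons ab by simp_all
    then have key': "fst (hd (trace (a # L))) \<noteq> fst (hd (trace L)) \<longrightarrow>
        A_orbit (snd (hd (trace (a # L)))) \<noteq> A_orbit (snd (hd (trace L)))"
      using key by auto
    define c where "c = hd (trace (a # L))"
    have tr: "trace (a # L) = c # trace L" by (simp add: c_def)
    show ?thesis
      unfolding tr successively_Cons using IH key'[folded c_def] by blast
  qed simp
qed simp

end

text \<open>The letter \<open>t\<inverse>\<close> acts by \<open>(x, z) \<mapsto> (turn x, shear z)\<close>.\<close>

locale tower_action = twisted_chain +
  fixes d :: "nat \<Rightarrow> 'a set" and K e :: nat
  assumes d_orbit: "d j = {} \<or> d j \<in> A_orbit ` R"
    and d_disjoint: "d j \<inter> d (Suc j) = {}"
    and d_top: "j > K \<Longrightarrow> d j = {}"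
    and e_pos: "e > 0"
begin

abbreviation "q \<equiv> int p ^ e"
text \<open>Canonical residues, and the default value \<open>0\<close> beyond \<open>K\<close>, make
  the set finite and make equality of vectors an equality of functions.\<close>

definition "Z = {z. \<forall>j. (j \<in> {..K} \<longrightarrow> z j \<in> {0..<q}) \<and> (j \<notin> {..K} \<longrightarrow> z j = 0)}"
abbreviation "\<Omega> \<equiv> R \<times> Z"

lemma q_gt_1: "q > 1"
  using prime_gt_1_nat[OF prime] e_pos by simp

lemma Z_range: "z \<in> Z \<Longrightarrow> 0 \<le> z j \<and> z j < q"
  using prime_gt_0_nat[OF prime] by (cases "j \<le> K") (auto simp: Z_def)

lemma finite_space: "finite \<Omega>"
  using finite_R finite_set_of_finite_funs[of "{..K}" "{0..<q}" 0] by (simp add: Z_def)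

lemma d_mult:
  assumes "a \<in> A" "x \<in> R"
  shows "r (a \<otimes> x) \<in> d j \<longleftrightarrow> x \<in> d j"
proof -
  have *: "x \<in> A_orbit y \<longleftrightarrow> A_orbit x = A_orbit y" if "x \<in> R" "y \<in> R" for x y
    using A_orbit_disjoint[OF that] A_orbit_self[OF that(1)] by auto
  have "r (a \<otimes> x) \<in> R" using assms R_closed r_mem by auto
  then have "r (a \<otimes> x) \<in> A_orbit y \<longleftrightarrow> x \<in> A_orbit y" if "y \<in> R" for y
    using *[of _ y] that assms A_orbit_mult[OF assms(1) R_closed[OF assms(2)]] by simp
  then show ?thesis
    using d_orbit[of j] by auto
qed

lemma shear_mem:
  assumes "z \<in> Z"
  shows "shear q d \<epsilon> x z \<in> Z"
proof -
  have "shear q d \<epsilon> x z j \<in> {0..<q}" for j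
    using Z_range[OF assms, of 0] q_gt_1 by (intro shear_range) linarith+
  moreover have "shear q d \<epsilon> x z j = 0" if "j > K" for j
    using assms that d_top[OF that] by (auto simp: shear_def Z_def)
  ultimately show ?thesis by (auto simp: Z_def)
qed

lemma shear_inverse: "z \<in> Z \<Longrightarrow> shear q d (- \<epsilon>) x (shear q d \<epsilon> x z) = z"
  using shear_cancel[of d z q \<epsilon> x] d_disjoint Z_range by simp

definition translate :: "'a \<Rightarrow> 'a \<times> (nat \<Rightarrow> int) \<Rightarrow> 'a \<times> (nat \<Rightarrow> int)" where
  "translate g \<sigma> = (if \<sigma> \<in> \<Omega> then (r (g \<otimes> fst \<sigma>), snd \<sigma>) else \<sigma>)"

definition tau :: "'a \<times> (nat \<Rightarrow> int) \<Rightarrow> 'a \<times> (nat \<Rightarrow> int)" where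
  "tau \<sigma> = (if \<sigma> \<in> \<Omega> then (turn (fst \<sigma>), shear q d 1 (fst \<sigma>) (snd \<sigma>)) else \<sigma>)"

lemma translate_apply: "\<sigma> \<in> \<Omega> \<Longrightarrow> translate g \<sigma> = (r (g \<otimes> fst \<sigma>), snd \<sigma>)"
  by (simp add: translate_def)

lemma tau_apply: "\<sigma> \<in> \<Omega> \<Longrightarrow> tau \<sigma> = (turn (fst \<sigma>), shear q d 1 (fst \<sigma>) (snd \<sigma>))"
  by (simp add: tau_def)

lemma translate_mem: "g \<in> carrier G \<Longrightarrow> \<sigma> \<in> \<Omega> \<Longrightarrow> translate g \<sigma> \<in> \<Omega>"
  using R_closed r_mem by (auto simp: translate_def)

lemma tau_mem: "\<sigma> \<in> \<Omega> \<Longrightarrow> tau \<sigma> \<in> \<Omega>"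
  using turn_mem shear_mem by (auto simp: tau_def)

lemma translate_permutes:
  assumes g: "g \<in> carrier G"
  shows "translate g permutes \<Omega>"
proof (rule bij_imp_permutes)
  have inv: "translate (inv h) (translate h \<sigma>) = \<sigma>" if "h \<in> carrier G" "\<sigma> \<in> \<Omega>" for h \<sigma>
  proof -
    have x: "fst \<sigma> \<in> R" "fst \<sigma> \<in> carrier G" using that R_closed by auto
    have "r (inv h \<otimes> r (h \<otimes> fst \<sigma>)) = r (inv h \<otimes> (h \<otimes> fst \<sigma>))"
      using that x by (intro r_mult) auto
    also have "inv h \<otimes> (h \<otimes> fst \<sigma>) = fst \<sigma>"
      using that x(2) by (simp add: m_assoc[symmetric])
    also note r_R[OF x(1)]
    finally have "r (inv h \<otimes> r (h \<otimes> fst \<sigma>)) = fst \<sigma>" .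
    then show ?thesis
      using that translate_mem[OF that] by (simp add: translate_def)
  qed
  show "bij_betw (translate g) \<Omega> \<Omega>"
    using inv[of g] inv[of "inv g"] g translate_mem
    by (intro bij_betw_byWitness[where f' = "translate (inv g)"] ballI image_subsetI) simp_all
qed (simp add: translate_def)

lemma tau_permutes: "tau permutes \<Omega>"
proof (rule bij_imp_permutes)
  have "inj_on tau \<Omega>"
  proof (rule inj_onI)
    fix \<sigma> \<sigma>' assume *: "\<sigma> \<in> \<Omega>" "\<sigma>' \<in> \<Omega>" "tau \<sigma> = tau \<sigma>'"
    then have "fst \<sigma> = fst \<sigma>'"
      using bij_betw_imp_inj_on[OF turn_bij] by (auto simp: tau_def dest: inj_onD)
    moreover from this have "snd \<sigma> = snd \<sigma>'"
      using * shear_inverse[of "snd \<sigma>" 1 "fst \<sigma>"] shear_inverse[of "snd \<sigma>'" 1 "fst \<sigma>"]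
      by (simp add: tau_def mem_Times_iff)
    ultimately show "\<sigma> = \<sigma>'" by (rule prod_eqI)
  qed
  then show "bij_betw tau \<Omega> \<Omega>"
    using tau_mem endo_inj_surj[OF finite_space] by (simp add: bij_betw_def image_subsetI)
qed (simp add: tau_def)

lemma translate_hom: "translate \<in> hom G (permutation_group \<Omega>)"
proof (rule homI)
  fix g h assume gh: "g \<in> carrier G" "h \<in> carrier G"
  show "translate (g \<otimes> h) = translate g \<otimes>\<^bsub>permutation_group \<Omega>\<^esub> translate h"
  proof
    fix \<sigma>
    show "translate (g \<otimes> h) \<sigma> = (translate g \<otimes>\<^bsub>permutation_group \<Omega>\<^esub> translate h) \<sigma>"
    proof (cases "\<sigma> \<in> \<Omega>")
      case True
      then have x: "fst \<sigma> \<in> carrier G" using R_closed by auto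
      show ?thesis
        using True x translate_mem[OF gh(2) True] gh by (simp add: translate_def r_mult m_assoc)
    qed (simp add: translate_def)
  qed
qed (use translate_permutes in auto)

text \<open>By \<open>d_mult\<close> the tests are \<open>A\<close>-invariant, so
  \<open>translate a\<close> leaves the shear unchanged, while \<open>turn\<close> intertwines
  \<open>a\<close> with \<open>\<phi> a\<close>. This is the relation that \<open>hnn_action\<close>
  asks for.\<close>

lemma tau_translate:
  assumes "a \<in> A" "\<sigma> \<in> \<Omega>"
  shows "tau (translate a \<sigma>) = translate (\<phi> a) (tau \<sigma>)"
proof -
  have x: "fst \<sigma> \<in> R" "fst \<sigma> \<in> carrier G" using assms R_closed by auto
  have "shear q d 1 (r (a \<otimes> fst \<sigma>)) z = shear q d 1 (fst \<sigma>) z" for z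
    using d_mult[OF assms(1) x(1)] by (simp add: shear_def fun_eq_iff)
  then show ?thesis
    using assms turn_mult[OF assms(1) x(1)] translate_mem[of a \<sigma>] tau_mem[OF assms(2)] by (simp add: translate_def tau_def)
qed

text \<open>The inverse shears with sign \<open>-1\<close> at the point where it arrives, just as
  \<open>trace\<close> records the letter \<open>t\<close>.\<close>

lemma inv_tau:
  assumes "x \<in> R" "z \<in> Z"
  shows "Hilbert_Choice.inv tau (x, z) = (unturn x, shear q d (-1) (unturn x) z)"
proof -
  have "tau (unturn x, shear q d (-1) (unturn x) z) = (x, z)"
    using assms unturn[of x] shear_mem shear_inverse[of z "-1" "unturn x"] by (simp add: tau_def)
  then show ?thesis by (metis permutes_inverses(2)[OF tau_permutes])
qed

text \<open>Levels below \<open>n\<close> are the factors of the chain, from the top down; level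
  \<open>n + j\<close> is entry \<open>j\<close> over a common point with common earlier entries. A
  \<open>\<delta>\<close> that is not a residue merely contributes the empty relation.\<close>

definition translation_rels :: "nat \<Rightarrow> (('a \<times> (nat \<Rightarrow> int)) \<times> ('a \<times> (nat \<Rightarrow> int))) set set" where
  "translation_rels l = (if l < n
     then (\<lambda>y. {(\<sigma>, \<sigma>'). N (n - Suc l) #> fst \<sigma>' = N (n - Suc l) #> (y \<otimes> fst \<sigma>)}) ` N (n - l)
     else (\<lambda>\<delta>. {(\<sigma>, \<sigma>'). fst \<sigma> = fst \<sigma>' \<and> (\<forall>i<l - n. snd \<sigma> i = snd \<sigma>' i) \<and>
       (snd \<sigma>' (l - n) - snd \<sigma> (l - n)) mod q = \<delta>}) ` UNIV)"

lemma translation_rels_low: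
  assumes "l \<le> n" "\<sigma> \<in> \<Omega>" "\<sigma>' \<in> \<Omega>" "N (n - l) #> fst \<sigma>' = N (n - l) #> fst \<sigma>"
  shows "\<exists>\<theta>\<in>translation_rels l. (\<sigma>, \<sigma>') \<in> \<theta>"
proof -
  have x: "fst \<sigma> \<in> carrier G" "fst \<sigma>' \<in> carrier G" "r (fst \<sigma>) = fst \<sigma>" "r (fst \<sigma>') = fst \<sigma>'"
    using assms R_closed r_R by (auto simp: mem_Times_iff)
  show ?thesis
  proof (cases "l < n")
    case True
    have "fst \<sigma>' \<otimes> inv (fst \<sigma>) \<in> N (n - l)"
      using assms(4) x coset_eq_iff[OF N_normal] by simp
    then show ?thesis
      using True x by (auto simp: translation_rels_def m_assoc intro!: bexI[of _ "fst \<sigma>' \<otimes> inv (fst \<sigma>)"])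
  next
    case False
    then have "l = n" using assms(1) by simp
    then have "fst \<sigma> = fst \<sigma>'" using assms(4) x r_eq_iff[of "fst \<sigma>" "fst \<sigma>'"] by simp
    then show ?thesis using \<open>l = n\<close> by (auto simp: translation_rels_def)
  qed
qed

sublocale tower: translation_tower \<Omega> translation_rels "Suc (n + K)" p e
proof
  show "prime p" by (rule prime)
  show "finite \<Omega>" by (rule finite_space)
  show "\<exists>\<theta>\<in>translation_rels 0. (\<sigma>, \<sigma>') \<in> \<theta>" if "\<sigma> \<in> \<Omega>" "\<sigma>' \<in> \<Omega>" for \<sigma> \<sigma>'
    using that R_closed by (intro translation_rels_low) (auto simp: N_top_coset)
  show "\<sigma> = \<sigma>'" if \<theta>: "\<theta> \<in> translation_rels (Suc (n + K))" "(\<sigma>, \<sigma>') \<in> \<theta>" and \<sigma>: "\<sigma> \<in> \<Omega>" "\<sigma>' \<in> \<Omega>"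
    for \<theta> \<sigma> \<sigma>'
  proof -
    have "fst \<sigma> = fst \<sigma>'" "\<forall>i<Suc K. snd \<sigma> i = snd \<sigma>' i"
      using \<theta> by (auto simp: translation_rels_def)
    moreover have "snd \<sigma> i = snd \<sigma>' i" if "\<not> i < Suc K" for i
      using \<sigma> that by (auto simp: Z_def)
    ultimately show ?thesis by (intro prod_eqI ext) blast+
  qed
  fix l \<theta> f
  assume l: "l < Suc (n + K)" and \<theta>: "\<theta> \<in> translation_rels l" and f: "\<And>i. f i \<in> \<Omega>"
    and step: "\<And>i. (f i, f (Suc i)) \<in> \<theta>"
  show "\<exists>\<theta>'\<in>translation_rels (Suc l). (f 0, f (p ^ e)) \<in> \<theta>'"
  proof (cases "l < n")
    case True
    let ?i = "n - Suc l"
    have i: "?i < n" "Suc ?i = n - l" using True by auto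
    obtain y where y: "y \<in> N (Suc ?i)" "\<And>k. N ?i #> fst (f (Suc k)) = N ?i #> (y \<otimes> fst (f k))"
      using \<theta> step True i by (auto simp: translation_rels_def)
    have yG: "y \<in> carrier G" using N_closed[OF _ y(1)] i by simp
    have xG: "fst (f k) \<in> carrier G" for k using f[of k] R_closed by auto
    have Ni: "N ?i \<lhd> G" using N_normal i by simp
    have pow: "N ?i #> fst (f k) = N ?i #> (y [^] k \<otimes> fst (f 0))" for k
    proof (induction k)
      case (Suc k)
      have "N ?i #> (y \<otimes> fst (f k)) = N ?i #> (y \<otimes> (y [^] k \<otimes> fst (f 0)))"
        using xG yG by (intro coset_mult_cong[OF Ni HOL.refl Suc]) auto
      also have "y \<otimes> (y [^] k \<otimes> fst (f 0)) = y [^] Suc k \<otimes> fst (f 0)"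
        using xG yG by (metis m_assoc nat_pow_Suc2 nat_pow_closed)
      finally show ?case using y(2)[of k] by simp
    qed (use xG in simp)
    \<comment> \<open>Here \<open>p\<close> equal steps would suffice; \<open>p ^ e\<close> is
      dictated by the vector levels, where a difference vanishes modulo \<open>q\<close> after
      \<open>q\<close> equal steps.\<close>
    have "y [^] p \<in> N ?i" using N_pow[OF i(1) y(1)] .
    then have "(y [^] p) [^] (p ^ (e - 1)) \<in> N ?i"
      using normal_imp_subgroup[OF Ni] subgroup_int_pow_closed by (metis int_pow_int)
    then have "y [^] (p ^ e) \<in> N ?i"
      using yG e_pos by (simp add: nat_pow_pow power_eq_if)
    then have "N ?i #> fst (f (p ^ e)) = N ?i #> fst (f 0)"
      using pow[of "p ^ e"] coset_absorb[of ?i "y [^] (p ^ e)" "fst (f 0)"] xG by simp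
    then show ?thesis
      using translation_rels_low[of "Suc l"] True f by simp
  next
    case False
    define j where "j = l - n"
    have lj: "l = n + j" using False by (simp add: j_def)
    obtain \<delta> where \<delta>: "\<And>k. fst (f k) = fst (f (Suc k))" "\<And>k i. i < j \<Longrightarrow> snd (f k) i = snd (f (Suc k)) i"
      "\<And>k. (snd (f (Suc k)) j - snd (f k) j) mod q = \<delta>"
      using \<theta> step lj by (auto simp: translation_rels_def)
    have fst: "fst (f k) = fst (f 0)" for k by (induction k) (use \<delta>(1) in auto)
    have snd: "snd (f k) i = snd (f 0) i" if "i < j" for i k by (induction k) (use \<delta>(2)[OF that] in auto)
    have cong: "[snd (f k) j = snd (f 0) j + int k * \<delta>] (mod q)" for k
    proof (induction k)
      case (Suc k)
      have "[snd (f (Suc k)) j - snd (f k) j = \<delta>] (mod q)"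
        using \<delta>(3)[of k] by (auto simp: cong_def)
      then have "[snd (f k) j + (snd (f (Suc k)) j - snd (f k) j) = snd (f 0) j + int k * \<delta> + \<delta>] (mod q)"
        by (intro cong_add Suc)
      then show ?case by (simp add: algebra_simps)
    qed simp
    have "[snd (f (p ^ e)) j = snd (f 0) j] (mod q)"
      using cong[of "p ^ e"] by (simp add: cong_def)
    then have "snd (f (p ^ e)) j = snd (f 0) j"
      using Z_range f by (intro cong_less_imp_eq_int) (auto simp: mem_Times_iff)
    then have "\<forall>i<Suc j. snd (f 0) i = snd (f (p ^ e)) i"
      using snd[where k = "p ^ e"] by (auto simp: less_Suc_eq)
    then show ?thesis
      using lj fst[of "p ^ e"] by (auto simp: translation_rels_def)
  qed
qed

text \<open>By \<open>N_central\<close>, left translation by \<open>g\<close> commutes with the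
  translations \<open>y\<close> of each factor; the vectors are untouched.\<close>

lemma translate_respecting:
  assumes g: "g \<in> carrier G"
  shows "translate g \<in> tower.respecting"
  unfolding tower.respecting_def
proof (intro CollectI conjI allI impI ballI translate_permutes[OF g])
  fix l \<theta> \<sigma> \<sigma>'
  assume \<theta>: "\<theta> \<in> translation_rels l" "(\<sigma>, \<sigma>') \<in> \<theta>" and \<sigma>: "\<sigma> \<in> \<Omega>" "\<sigma>' \<in> \<Omega>"
  have x: "fst \<sigma> \<in> carrier G" "fst \<sigma>' \<in> carrier G" using \<sigma> R_closed by auto
  show "(translate g \<sigma>, translate g \<sigma>') \<in> \<theta>"
  proof (cases "l < n")
    case True
    let ?i = "n - Suc l"
    have i: "?i < n" "Suc ?i = n - l" using True by auto
    have Ni: "N ?i \<lhd> G" using N_normal i by simp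
    obtain y where y: "y \<in> N (Suc ?i)" "N ?i #> fst \<sigma>' = N ?i #> (y \<otimes> fst \<sigma>)"
      and \<theta>': "\<theta> = {(\<sigma>, \<sigma>'). N ?i #> fst \<sigma>' = N ?i #> (y \<otimes> fst \<sigma>)}"
      using \<theta> True i by (auto simp: translation_rels_def)
    have yG: "y \<in> carrier G" using N_closed[OF _ y(1)] i by simp
    have "N ?i #> r (g \<otimes> fst \<sigma>') = N ?i #> (g \<otimes> fst \<sigma>')" using x g by (simp add: N_r)
    also have "\<dots> = N ?i #> (g \<otimes> (y \<otimes> fst \<sigma>))"
      using x g yG by (intro coset_mult_cong[OF Ni HOL.refl y(2)]) auto
    also have "\<dots> = N ?i #> ((g \<otimes> y) \<otimes> fst \<sigma>)" using x g yG by (simp add: m_assoc)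
    also have "\<dots> = N ?i #> ((y \<otimes> g) \<otimes> fst \<sigma>)"
      using x g yG by (intro coset_mult_cong[OF Ni N_central[OF i(1) g y(1)] HOL.refl]) auto
    also have "\<dots> = N ?i #> (y \<otimes> (g \<otimes> fst \<sigma>))" using x g yG by (simp add: m_assoc)
    also have "\<dots> = N ?i #> (y \<otimes> r (g \<otimes> fst \<sigma>))"
      using x g yG r_closed N_r[of ?i "g \<otimes> fst \<sigma>"] by (intro coset_mult_cong[OF Ni HOL.refl]) auto
    finally show ?thesis using \<sigma> by (simp add: \<theta>' translate_def)
  next
    case False
    then show ?thesis using \<theta> \<sigma> by (auto simp: translation_rels_def translate_def)
  qed
qed

text \<open>On the levels of points this is \<open>s_chain\<close>. On a vector level the two
  elements share the point and the earlier entries, so the shear adds the same amount to both and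
  keeps their difference.\<close>

lemma tau_respecting: "tau \<in> tower.respecting"
  unfolding tower.respecting_def
proof (intro CollectI conjI allI impI ballI tau_permutes)
  fix l \<theta> \<sigma> \<sigma>'
  assume \<theta>: "\<theta> \<in> translation_rels l" "(\<sigma>, \<sigma>') \<in> \<theta>" and \<sigma>: "\<sigma> \<in> \<Omega>" "\<sigma>' \<in> \<Omega>"
  have x: "fst \<sigma> \<in> carrier G" "fst \<sigma>' \<in> carrier G" using \<sigma> R_closed by auto
  show "(tau \<sigma>, tau \<sigma>') \<in> \<theta>"
  proof (cases "l < n")
    case True
    let ?i = "n - Suc l"
    have i: "?i < n" "Suc ?i = n - l" using True by auto
    have Ni: "N ?i \<lhd> G" using N_normal i by simp
    obtain y where y: "y \<in> N (Suc ?i)" "N ?i #> fst \<sigma>' = N ?i #> (y \<otimes> fst \<sigma>)"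
      and \<theta>': "\<theta> = {(\<sigma>, \<sigma>'). N ?i #> fst \<sigma>' = N ?i #> (y \<otimes> fst \<sigma>)}"
      using \<theta> True i by (auto simp: translation_rels_def)
    have yG: "y \<in> carrier G" using N_closed[OF _ y(1)] i by simp
    have "N ?i #> turn (fst \<sigma>') = N ?i #> s (fst \<sigma>')" using x s_closed by (simp add: turn_def N_r)
    also have "\<dots> = N ?i #> s (y \<otimes> fst \<sigma>)" using x yG y(2) i by (intro s_cong) auto
    also have "\<dots> = N ?i #> (y \<otimes> s (fst \<sigma>))" using s_chain[OF i(1) y(1) x(1)] .
    also have "\<dots> = N ?i #> (y \<otimes> turn (fst \<sigma>))"
      using x yG r_closed s_closed N_r[of ?i "s (fst \<sigma>)"] unfolding turn_def
      by (intro coset_mult_cong[OF Ni HOL.refl]) auto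
    finally show ?thesis using \<sigma> by (simp add: \<theta>' tau_def)
  next
    case False
    define j where "j = l - n"
    obtain \<delta> where \<delta>: "fst \<sigma> = fst \<sigma>'" "\<forall>i<j. snd \<sigma> i = snd \<sigma>' i" "(snd \<sigma>' j - snd \<sigma> j) mod q = \<delta>"
      and \<theta>': "\<theta> = {(\<sigma>, \<sigma>'). fst \<sigma> = fst \<sigma>' \<and> (\<forall>i<j. snd \<sigma> i = snd \<sigma>' i) \<and> (snd \<sigma>' j - snd \<sigma> j) mod q = \<delta>}"
      using \<theta> False by (auto simp: translation_rels_def j_def)
    let ?S = "shear q d 1 (fst \<sigma>)"
    have "?S (snd \<sigma>) i = ?S (snd \<sigma>') i" if "i < j" for i
      using \<delta>(2) that by (simp add: shear_def)
    moreover have "(?S (snd \<sigma>') j - ?S (snd \<sigma>) j) mod q = \<delta>"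
    proof (cases "j = 0")
      case False
      then have "snd \<sigma> (j - 1) = snd \<sigma>' (j - 1)" using \<delta>(2) by simp
      then show ?thesis using \<delta>(3) False by (simp add: shear_def mod_diff_eq)
    qed (use \<delta>(3) in \<open>simp add: shear_def\<close>)
    ultimately show ?thesis using \<sigma> \<delta>(1) by (simp add: \<theta>' tau_def)
  qed
qed

lemma tower_hom:
  obtains F where "F \<in> hom \<Gamma> (permutation_group \<Omega>)"
    "\<And>g. g \<in> carrier G \<Longrightarrow> F (base g) = translate g" "F stable = Hilbert_Choice.inv tau"
    "finite_p_group p (permutation_group \<Omega>\<lparr>carrier := F ` carrier \<Gamma>\<rparr>)"
proof -
  let ?E = "permutation_group \<Omega>"
  interpret E: group ?E by (rule group_permutation_group)
  obtain F where F: "F \<in> hom \<Gamma> ?E" "\<And>g. g \<in> carrier G \<Longrightarrow> F (base g) = translate g"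
    "F stable = Hilbert_Choice.inv tau"
    using hnn_action[OF translate_hom tau_permutes tau_translate] by blast
  note sub = tower.subgroup_respecting
  have inv_tau: "inv\<^bsub>?E\<^esub> tau = Hilbert_Choice.inv tau"
    using inv_permutation_group[OF tau_permutes] .
  have stable: "Hilbert_Choice.inv tau \<in> tower.respecting" "inv\<^bsub>?E\<^esub> Hilbert_Choice.inv tau \<in> tower.respecting"
    using subgroup.m_inv_closed[OF sub] tau_respecting inv_tau by metis+
  \<comment> \<open>Syllable expressions exhaust the HNN-extension, so it is enough that the
    translations, \<open>tau\<close> and its inverse respect the tower.\<close>
  have "syllable_value ?E translate (Hilbert_Choice.inv tau) g L \<in> tower.respecting"
    if "g \<in> carrier G" "snd ` set L \<subseteq> carrier G" for g L
    using that
  proof (induction L arbitrary: g)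
    case (Cons a L)
    then have "syllable_value ?E translate (Hilbert_Choice.inv tau) (snd a) L \<in> tower.respecting" by simp
    then show ?case
      using Cons.prems stable translate_respecting
      by (auto simp del: permutation_group_simps intro!: subgroup.m_closed[OF sub])
  qed (simp add: translate_respecting)
  then have "F \<gamma> \<in> tower.respecting" if \<gamma>: "\<gamma> \<in> carrier \<Gamma>" for \<gamma>
    using nu_surj[OF \<gamma>] hom_nu[OF E.is_group F] by metis
  moreover have "subgroup (F ` carrier \<Gamma>) ?E"
    using F(1) by (intro group_hom.img_is_subgroup)
      (simp add: group_hom_def group_hom_axioms_def \<Gamma>.is_group E.is_group)
  ultimately have "finite_p_group p (?E\<lparr>carrier := F ` carrier \<Gamma>\<rparr>)"
    by (intro tower.respecting_p_group) auto
  with F that show thesis by blast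
qed

lemma shears_mem: "shears q d M \<in> Z"
proof (induction M)
  case Nil
  show ?case using q_gt_1 prime_gt_0_nat[OF prime] by (auto simp: Z_def)
qed (simp add: shear_mem)

text \<open>\<open>position\<close> and \<open>trace\<close> mirror, letter by letter, the orbit of
  the trivial coset equipped with the first unit vector.\<close>

lemma hom_value:
  assumes F: "F \<in> hom \<Gamma> (permutation_group \<Omega>)" "\<And>g. g \<in> carrier G \<Longrightarrow> F (base g) = translate g"
      "F stable = Hilbert_Choice.inv tau"
    and "g \<in> carrier G" "snd ` set L \<subseteq> carrier G"
  shows "F (\<nu> g L) (r \<one>, shears q d []) = (position g L, shears q d (trace L))"
proof -
  let ?E = "permutation_group \<Omega>"
  have inv: "inv\<^bsub>?E\<^esub> Hilbert_Choice.inv tau = tau"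
    using inv_permutation_group[OF permutes_inv[OF tau_permutes]] inv_inv_eq[OF permutes_bij[OF tau_permutes]]
    by simp
  have "syllable_value ?E translate (Hilbert_Choice.inv tau) g L (r \<one>, shears q d [])
      = (position g L, shears q d (trace L))"
    using assms(4,5)
  proof (induction L arbitrary: g)
    case Nil
    then show ?case
      using shears_mem[of "[]"] r_mem[of \<one>] r_mult[of \<one> g] by (simp add: translate_apply del: shears.simps(1))
  next
    case (Cons a L)
    let ?x = "position (snd a) L" and ?z = "shears q d (trace L)"
    have x: "?x \<in> R" using Cons.prems by (intro position_mem) auto
    have z: "?z \<in> Z" by (rule shears_mem)
    have IH: "syllable_value ?E translate (Hilbert_Choice.inv tau) (snd a) L (r \<one>, shears q d []) = (?x, ?z)"
      using Cons by simp
    show ?case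
    proof (cases "fst a")
      case True
      then show ?thesis
        using IH x z shear_mem[OF z] unturn(1)[OF x] by (simp add: inv_tau translate_apply del: shears.simps(1))
    next
      case False
      then show ?thesis
        using IH x z shear_mem[OF z] turn_mem[OF x] by (simp add: inv tau_apply translate_apply del: shears.simps(1))
    qed
  qed
  then show ?thesis
    using hom_nu[OF group_permutation_group F] assms(4,5) by simp
qed

end

section \<open>Finite \<open>p\<close>-quotients that separate a given element from the
  identity\<close>

context p_chain
begin

lemma separate_base:
  assumes g: "g \<in> carrier G" "g \<notin> N 0"
  shows "\<exists>(P :: ('a \<times> (nat \<Rightarrow> int) \<Rightarrow> 'a \<times> (nat \<Rightarrow> int)) monoid) h.
    finite_p_group p P \<and> h \<in> epi \<Gamma> P \<and> h (base g) \<noteq> \<one>\<^bsub>P\<^esub>"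
proof -
  obtain s where s: "twist 0 s" using twist_exists .
  \<comment> \<open>A base element is visible on \<open>G / N 0\<close> alone: empty tests switch
    the shears off, and \<open>e = 1\<close> is the least admissible exponent.\<close>
  interpret tower_action G A B \<phi> p n N s "\<lambda>_. {}" 0 1
    using s by unfold_locales auto
  obtain F where F: "F \<in> hom \<Gamma> (permutation_group \<Omega>)"
    "\<And>g. g \<in> carrier G \<Longrightarrow> F (base g) = translate g" "F stable = Hilbert_Choice.inv tau"
    "finite_p_group p (permutation_group \<Omega>\<lparr>carrier := F ` carrier \<Gamma>\<rparr>)"
    using tower_hom by blast
  have "F (base g) \<noteq> id"
  proof
    assume "F (base g) = id"
    then have "r g = r \<one>" using hom_value[OF F(1-3) g(1), of "[]"] by simp
    then have "N 0 #> g = N 0 #> \<one>" using g(1) by (simp add: r_eq_iff)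
    then show False using g coset_eq_iff[of "N 0" g \<one>] N_normal[of 0] by simp
  qed
  then show ?thesis
    using F g(1) group_permutation_group by (intro residual_quotient[where F = F]) auto
qed

lemma separate_syllables:
  assumes g: "g \<in> carrier G" "snd ` set L \<subseteq> carrier G" and L: "L \<noteq> []"
    and red: "successively (\<lambda>(e, g) (e', g'). e \<noteq> e' \<longrightarrow> g \<notin> (if e then B else A) <#> N 0) L"
  shows "\<exists>(P :: ('a \<times> (nat \<Rightarrow> int) \<Rightarrow> 'a \<times> (nat \<Rightarrow> int)) monoid) h.
    finite_p_group p P \<and> h \<in> epi \<Gamma> P \<and> h (\<nu> g L) \<noteq> \<one>\<^bsub>P\<^esub>"
proof -
  obtain s where s: "twist 0 s" using twist_exists .
  interpret twisted_chain G A B \<phi> p n N s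
    using s by unfold_locales
  have "trace L \<noteq> []" using L by (cases L) auto
  moreover have "\<forall>x\<in>R. x \<in> A_orbit x" using A_orbit_self by blast
  moreover have "\<forall>x\<in>R. \<forall>y\<in>R. A_orbit x \<noteq> A_orbit y \<longrightarrow> A_orbit x \<inter> A_orbit y = {}"
    using A_orbit_disjoint by blast
  ultimately obtain k d D where k: "k \<ge> 1" "D \<noteq> 0" "\<And>j. d j = {} \<or> d j \<in> A_orbit ` R"
    "\<And>j. d j \<inter> d (Suc j) = {}" "\<And>j. j > k \<Longrightarrow> d j = {}" "\<And>q. q > 1 \<Longrightarrow> shears q d (trace L) k = D mod q"
    using shears_detect[OF _ _ _ trace_mem[OF g(2)] trace_reduced[OF g(2) red]] by metis
  \<comment> \<open>Chosen so that \<open>\<bar>D\<bar> < 2 ^ e \<le> p ^ e\<close>, which keeps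
    \<open>D\<close> from vanishing modulo \<open>q\<close>; the successor makes \<open>e\<close>
    positive.\<close>
  define e where "e = Suc (nat \<bar>D\<bar>)"
  interpret tower_action G A B \<phi> p n N s d k e
    using k by unfold_locales (auto simp: e_def)
  obtain F where F: "F \<in> hom \<Gamma> (permutation_group \<Omega>)"
    "\<And>g. g \<in> carrier G \<Longrightarrow> F (base g) = translate g" "F stable = Hilbert_Choice.inv tau"
    "finite_p_group p (permutation_group \<Omega>\<lparr>carrier := F ` carrier \<Gamma>\<rparr>)"
    using tower_hom by blast
  have "nat \<bar>D\<bar> < 2 ^ e" unfolding e_def by (meson Suc_lessD less_exp)
  also have "(2 :: nat) ^ e \<le> p ^ e" using prime_ge_2_nat[OF prime] by (rule power_mono) simp
  finally have "\<bar>D\<bar> < q" by (simp add: nat_less_iff)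
  then have "D mod q \<noteq> 0" using k(2) by (metis dvd_eq_mod_eq_0 zdvd_not_zless zero_less_abs_iff dvd_abs_iff)
  have "F (\<nu> g L) \<noteq> id"
  proof
    assume "F (\<nu> g L) = id"
    \<comment> \<open>Since \<open>k \<ge> 1\<close>, entry \<open>k\<close> of the starting vector
      is \<open>0\<close>, whereas the final one is \<open>D mod q\<close>.\<close>
    then have "shears q d (trace L) k = shears q d [] k" using hom_value[OF F(1-3) g] by simp
    then show False using k(1,6) q_gt_1 \<open>D mod q \<noteq> 0\<close> by simp
  qed
  then show ?thesis
    using F g group_permutation_group nu_closed by (intro residual_quotient[where F = F]) auto
qed

end

section \<open>Residual finiteness\<close>

context hnn_data
begin

lemma p_chain_of_p_series:
  assumes "prime p" "p_series p M"
  obtains n N where "p_chain G A B \<phi> p n N" "N 0 = M"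
proof -
  obtain n N where N: "N 0 = M" "N n = carrier G" "\<forall>i<n. N i \<subseteq> N (Suc i)"
    "\<forall>i\<le>n. compatible A B \<phi> (N i) \<and> N i \<lhd> G"
    "\<forall>i<n. order (G\<lparr>carrier := N (Suc i)\<rparr> Mod N i) = p \<and>
       (\<forall>a\<in>A \<inter> N (Suc i). \<phi> a <# N i = a <# N i)"
    using p_series_imp_p_compatible[OF assms(2)] unfolding p_compatible_def by blast
  have "p_chain G A B \<phi> p n N"
  proof (intro p_chain.intro p_chain_axioms.intro hnn_data_axioms)
    show "\<phi> a \<otimes> inv a \<in> N i" if "i < n" "a \<in> A" "a \<in> N (Suc i)" for i a
      using that N(4,5) left_coset_eq_iff[of "N i" a] by simp
  qed (use assms(1) N in simp_all)
  then show thesis using that N(1) by blast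
qed

text \<open>Each of the finitely many base elements is kept out of \<open>A\<close> or
  \<open>B\<close> by a subgroup of its own; intersecting only shrinks the products with
  \<open>A\<close> and \<open>B\<close>.\<close>

lemma p_series_avoids:
  assumes p: "prime p" and pf: "pair_filtration G A B (p_compatible_family G A B \<phi> p)"
    and L: "snd ` set L \<subseteq> carrier G"
  shows "\<exists>M. p_series p M \<and> (\<forall>g\<in>snd ` set L. (g \<notin> A \<longrightarrow> g \<notin> A <#> M) \<and> (g \<notin> B \<longrightarrow> g \<notin> B <#> M))"
  using L
proof (induction L)
  case Nil
  then show ?case using p_series.top by auto
next
  case (Cons a L)
  let ?g = "snd a"
  have g: "?g \<in> carrier G" using Cons.prems by simp
  obtain M where M: "p_series p M"
    "\<forall>g\<in>snd ` set L. (g \<notin> A \<longrightarrow> g \<notin> A <#> M) \<and> (g \<notin> B \<longrightarrow> g \<notin> B <#> M)"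
    using Cons by auto
  have avoid: "\<exists>K. p_series p K \<and> (?g \<notin> H \<longrightarrow> ?g \<notin> H <#> K)"
    if "subgroup_filtration G H (p_compatible_family G A B \<phi> p)" for H
    using that g p_series.top unfolding subgroup_filtration_def p_compatible_family_eq by blast
  obtain K where K: "p_series p K" "?g \<notin> A \<longrightarrow> ?g \<notin> A <#> K"
    using avoid[of A] pf by (auto simp: pair_filtration_def)
  obtain K' where K': "p_series p K'" "?g \<notin> B \<longrightarrow> ?g \<notin> B <#> K'"
    using avoid[of B] pf by (auto simp: pair_filtration_def)
  have mono: "H <#> (M \<inter> (K \<inter> K')) \<subseteq> H <#> M" "H <#> (M \<inter> (K \<inter> K')) \<subseteq> H <#> K"
    "H <#> (M \<inter> (K \<inter> K')) \<subseteq> H <#> K'" for H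
    by (auto simp: set_mult_def)
  have "p_series p (M \<inter> (K \<inter> K'))"
    using p_series_inter[OF p] M(1) K(1) K'(1) by blast
  moreover have "?g \<notin> A \<longrightarrow> ?g \<notin> A <#> (M \<inter> (K \<inter> K'))" "?g \<notin> B \<longrightarrow> ?g \<notin> B <#> (M \<inter> (K \<inter> K'))"
    using K(2) K'(2) mono(2)[of A] mono(3)[of B] by blast+
  moreover have "\<forall>g\<in>snd ` set L. (g \<notin> A \<longrightarrow> g \<notin> A <#> (M \<inter> (K \<inter> K'))) \<and>
      (g \<notin> B \<longrightarrow> g \<notin> B <#> (M \<inter> (K \<inter> K')))"
    using M(2) mono(1)[of A] mono(1)[of B] by blast
  ultimately show ?case
    by (intro exI[of _ "M \<inter> (K \<inter> K')"] conjI) simp_all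
qed

lemma filtration_if_residual:
  assumes p: "prime p" and res: "residually_finite_p_group p \<Gamma>"
  shows "filtration G (p_compatible_family G A B \<phi> p)"
  unfolding filtration_def p_compatible_family_eq
proof (intro conjI ballI)
  show "N \<lhd> G" if "N \<in> {M. p_series p M}" for N using that p_series_normal by simp
  have "\<exists>M. p_series p M \<and> g \<notin> M" if g: "g \<in> carrier G" "g \<noteq> \<one>" for g
  proof -
    have "base g \<noteq> \<one>\<^bsub>\<Gamma>\<^esub>" using base_eq_one_iff g by simp
    then obtain P :: "nat monoid" and h where P: "finite_p_group p P" "h \<in> epi \<Gamma> P" "h (base g) \<noteq> \<one>\<^bsub>P\<^esub>"
      using res g(1) unfolding residually_finite_p_group_def by blast
    interpret P: group P using P(1) by (simp add: finite_p_group_def)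
    have "h \<in> hom \<Gamma> P" using P(2) by (simp add: epi_def)
    \<comment> \<open>For the trivial subgroup of \<open>P\<close> the preimage is the kernel of the
      composite \<open>G \<rightarrow> P\<close>, which misses \<open>g\<close>.\<close>
    from p_series_preimage[OF p P(1) this P.one_is_normal] P(3) show ?thesis by blast
  qed
  then show "carrier G \<inter> \<Inter> {M. p_series p M} = {\<one>}"
    using subgroup.one_closed[OF normal_imp_subgroup[OF p_series_normal]] by blast
qed

lemma residual_if_pair_filtration:
  assumes p: "prime p" and pf: "pair_filtration G A B (p_compatible_family G A B \<phi> p)"
  shows "residually_finite_p_group p \<Gamma>"
proof (rule residually_finite_p_groupI)
  fix \<gamma> assume \<gamma>: "\<gamma> \<in> carrier \<Gamma>" "\<gamma> \<noteq> \<one>\<^bsub>\<Gamma>\<^esub>"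
  obtain g L where gL: "g \<in> carrier G" "snd ` set L \<subseteq> carrier G" "\<gamma> = \<nu> g L" "reduced L"
    using reduced_form[OF \<gamma>(1)] by blast
  show "\<exists>(P :: ('a \<times> (nat \<Rightarrow> int) \<Rightarrow> 'a \<times> (nat \<Rightarrow> int)) monoid) h.
    finite_p_group p P \<and> h \<in> epi \<Gamma> P \<and> h \<gamma> \<noteq> \<one>\<^bsub>P\<^esub>"
  proof (cases "L = []")
    case True
    then have "g \<noteq> \<one>" using \<gamma>(2) gL(3) base_one by auto
    moreover have "carrier G \<inter> \<Inter> {M. p_series p M} = {\<one>}"
      using pf by (simp add: pair_filtration_def subgroup_filtration_def filtration_def p_compatible_family_eq)
    ultimately obtain M where M: "p_series p M" "g \<notin> M" using gL(1) by blast
    obtain n N where "p_chain G A B \<phi> p n N" "N 0 = M" using p_chain_of_p_series[OF p M(1)] .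
    then show ?thesis
      using p_chain.separate_base[of G A B \<phi> p n N g] M(2) gL True by simp
  next
    case False
    obtain M where M: "p_series p M"
      "\<forall>g\<in>snd ` set L. (g \<notin> A \<longrightarrow> g \<notin> A <#> M) \<and> (g \<notin> B \<longrightarrow> g \<notin> B <#> M)"
      using p_series_avoids[OF p pf gL(2)] by blast
    obtain n N where N: "p_chain G A B \<phi> p n N" "N 0 = M" using p_chain_of_p_series[OF p M(1)] .
    have "successively (\<lambda>(e, g) (e', g'). e \<noteq> e' \<longrightarrow> g \<notin> (if e then B else A) <#> N 0) L"
      using gL(4) unfolding reduced_def
    proof (rule successively_mono)
      fix a b :: "bool \<times> 'a"
      assume "a \<in> set L" and *: "(case a of (e, g) \<Rightarrow> \<lambda>(e', g'). e \<noteq> e' \<longrightarrow> g \<notin> (if e then B else A)) b" "b \<in> set L"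
      then have "snd a \<in> snd ` set L" by simp
      then show "(case a of (e, g) \<Rightarrow> \<lambda>(e', g'). e \<noteq> e' \<longrightarrow> g \<notin> (if e then B else A) <#> N 0) b"
        using M(2) N(2) * by (auto split: prod.splits if_splits)
    qed
    then show ?thesis
      using p_chain.separate_syllables[OF N(1) gL(1,2) False] gL(3) by simp
  qed
qed

end

theorem theorem2:
  fixes G :: "('a, 'm) monoid_scheme" and A B :: "'a set" and \<phi> :: "'a \<Rightarrow> 'a" and p :: nat
  assumes "prime p"
    and "group G"
    and "subgroup A G"
    and "subgroup B G"
    and "\<phi> \<in> iso (G\<lparr>carrier := A\<rparr>) (G\<lparr>carrier := B\<rparr>)"
  shows "(residually_finite_p_group p (HNN G A \<phi>) \<longrightarrow>
            filtration G (p_compatible_family G A B \<phi> p)) \<and>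
         (pair_filtration G A B (p_compatible_family G A B \<phi> p) \<longrightarrow>
            residually_finite_p_group p (HNN G A \<phi>))"
proof -
  interpret hnn_data G A B \<phi>
    using assms(2-5) by (simp add: hnn_data_def hnn_data_axioms_def)
  show ?thesis
    using filtration_if_residual[OF assms(1)] residual_if_pair_filtration[OF assms(1)] by blast
qed

end
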